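(* Let $({\rm X},{\sf d},\mathfrak m)$ be a metric measure space and $p\in(1,\infty)$, with conjugate exponent $q$. Let $\mathscr L\colon L^q(\mathfrak m)\to W^{-1,q}_{pd}({\rm X})$ be $\mathscr L(g)=L_g$, where $L_g(f)=\int fg\,d\mathfrak m$ for $f\in W^{1,p}({\rm X})$, and let $\mathscr L^*\colon W^{-1,q}_{pd}({\rm X})'\to L^p(\mathfrak m)$ be its adjoint (identifying $L^q(\mathfrak m)'$ with $L^p(\mathfrak m)$). Then $\mathscr L^*(W^{-1,q}_{pd}({\rm X})')=W^{1,p}({\rm X})$ and $\|\mathscr L^*(\Omega)\|_{W^{1,p}({\rm X})}=\|\Omega\|_{W^{-1,q}_{pd}({\rm X})'}$ for all $\Omega\in W^{-1,q}_{pd}({\rm X})'$. In particular, the dual of $W^{-1,q}_{pd}({\rm X})$ is isomorphic to $W^{1,p}({\rm X})$.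
   Context: A metric measure space is a complete separable metric space $({\rm X},{\sf d})$ with a nonnegative Borel measure $\mathfrak m$ finite on bounded Borel sets. $|Df|$: minimal weak $p$-upper gradient (least Borel $\rho\ge0$ in $L^p(\mathfrak m)$ with $|f(\gamma(b))-f(\gamma(a))|\le\int_\gamma\rho\,ds$ for all nonconstant rectifiable curves outside a family of zero $p$-modulus); $W^{1,p}({\rm X})\subseteq L^p(\mathfrak m)$: Banach space of $\mathfrak m$-a.e. classes of $p$-integrable functions with such $\rho$, $\|f\|^p_{W^{1,p}}=\|f\|^p_{L^p}+\||Df|\|^p_{L^p}$. $W^{-1,q}({\rm X})=W^{1,p}({\rm X})'$, and $W^{-1,q}_{pd}({\rm X})$ is the (closed) subspace of those $L$ such that $L(f_n)\to L(f_\infty)$ whenever $(f_n)_{n\in\mathbb N\cup\{\infty\}}\subseteq W^{1,p}({\rm X})$, $f_n\to f_\infty$ in $L^p(\mathfrak m)$ and $\sup_n\|f_n\|_{W^{1,p}}<\infty$, with the norm of $W^{-1,q}({\rm X})$. *)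

theory Defs
  imports "HOL-Analysis.Analysis"
begin

definition curve_length :: "(real \<Rightarrow> 'a::metric_space) \<Rightarrow> real \<Rightarrow> real \<Rightarrow> ennreal" where
  "curve_length \<gamma> s t =
     (SUP nt \<in> {(n::nat, \<tau>::nat \<Rightarrow> real). \<tau> 0 = s \<and> \<tau> n = t \<and> (\<forall>i<n. \<tau> i \<le> \<tau> (Suc i))}.
        (\<Sum>i<fst nt. ennreal (dist (\<gamma> (snd nt i)) (\<gamma> (snd nt (Suc i))))))"

definition arclength_curve :: "(real \<Rightarrow> 'a::metric_space) \<Rightarrow> real \<Rightarrow> bool" where
  "arclength_curve \<gamma> l \<longleftrightarrow> 0 < l \<and>
     (\<forall>s t. 0 \<le> s \<and> s \<le> t \<and> t \<le> l \<longrightarrow> curve_length \<gamma> s t = ennreal (t - s))"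

text \<open>Line integral of a nonnegative Borel function along an arc-length parametrized curve.\<close>
definition line_integral :: "('a \<Rightarrow> ennreal) \<Rightarrow> (real \<Rightarrow> 'a) \<Rightarrow> real \<Rightarrow> ennreal" where
  "line_integral \<rho> \<gamma> l = (\<integral>\<^sup>+ t \<in> {0..l}. \<rho> (\<gamma> t) \<partial>lborel)"

definition ennreal_powr :: "ennreal \<Rightarrow> real \<Rightarrow> ennreal" where
  "ennreal_powr x p = (if x = \<infinity> then \<infinity> else ennreal (enn2real x powr p))"

definition p_modulus :: "'a::metric_space measure \<Rightarrow> real \<Rightarrow> ((real \<Rightarrow> 'a) \<times> real) set \<Rightarrow> ennreal" where
  "p_modulus m p \<Gamma> =
     (INF \<rho> \<in> {\<rho>. \<rho> \<in> borel_measurable borel \<and> (\<forall>(\<gamma>, l) \<in> \<Gamma>. 1 \<le> line_integral \<rho> \<gamma> l)}.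
        (\<integral>\<^sup>+ x. ennreal_powr (\<rho> x) p \<partial>m))"

definition in_Lp :: "'a measure \<Rightarrow> real \<Rightarrow> ('a \<Rightarrow> real) \<Rightarrow> bool" where
  "in_Lp m p f \<longleftrightarrow> f \<in> borel_measurable m \<and> (\<integral>\<^sup>+ x. ennreal (\<bar>f x\<bar> powr p) \<partial>m) < \<infinity>"

definition Lp_norm :: "'a measure \<Rightarrow> real \<Rightarrow> ('a \<Rightarrow> real) \<Rightarrow> real" where
  "Lp_norm m p f = enn2real (\<integral>\<^sup>+ x. ennreal (\<bar>f x\<bar> powr p) \<partial>m) powr (1 / p)"

definition weak_upper_gradient :: "'a::metric_space measure \<Rightarrow> real \<Rightarrow> ('a \<Rightarrow> real) \<Rightarrow> ('a \<Rightarrow> real) \<Rightarrow> bool" where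
  "weak_upper_gradient m p f \<rho> \<longleftrightarrow> \<rho> \<in> borel_measurable borel \<and> (\<forall>x. 0 \<le> \<rho> x) \<and>
     (\<exists>\<Gamma>. p_modulus m p \<Gamma> = 0 \<and>
        (\<forall>\<gamma> l. arclength_curve \<gamma> l \<and> (\<gamma>, l) \<notin> \<Gamma> \<longrightarrow>
           ennreal \<bar>f (\<gamma> l) - f (\<gamma> 0)\<bar> \<le> line_integral (\<lambda>x. ennreal (\<rho> x)) \<gamma> l))"

definition sobolev_reps :: "'a::metric_space measure \<Rightarrow> real \<Rightarrow> ('a \<Rightarrow> real) \<Rightarrow> (('a \<Rightarrow> real) \<times> ('a \<Rightarrow> real)) set" where
  "sobolev_reps m p f = {(g, \<rho>). (AE x in m. g x = f x) \<and> in_Lp m p \<rho> \<and> weak_upper_gradient m p g \<rho>}"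

definition in_W1p :: "'a::metric_space measure \<Rightarrow> real \<Rightarrow> ('a \<Rightarrow> real) \<Rightarrow> bool" where
  "in_W1p m p f \<longleftrightarrow> in_Lp m p f \<and> sobolev_reps m p f \<noteq> {}"

text \<open>||f||_{W^{1,p}} = (||f||_p^p + || |Df| ||_p^p)^(1/p), with || |Df| ||_p the least
  L^p norm of a weak upper gradient (of a representative).\<close>
definition W1p_norm :: "'a::metric_space measure \<Rightarrow> real \<Rightarrow> ('a \<Rightarrow> real) \<Rightarrow> real" where
  "W1p_norm m p f = (Lp_norm m p f powr p +
      (INF gr \<in> sobolev_reps m p f. Lp_norm m p (snd gr) powr p)) powr (1 / p)"

definition W_dual :: "'a::metric_space measure \<Rightarrow> real \<Rightarrow> (('a \<Rightarrow> real) \<Rightarrow> real) \<Rightarrow> bool" where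
  "W_dual m p T \<longleftrightarrow>
     (\<forall>f g a b. in_W1p m p f \<and> in_W1p m p g \<longrightarrow>
        T (\<lambda>x. a * f x + b * g x) = a * T f + b * T g) \<and>
     (\<exists>C. \<forall>f. in_W1p m p f \<longrightarrow> \<bar>T f\<bar> \<le> C * W1p_norm m p f)"

definition W_dual_norm :: "'a::metric_space measure \<Rightarrow> real \<Rightarrow> (('a \<Rightarrow> real) \<Rightarrow> real) \<Rightarrow> real" where
  "W_dual_norm m p T = (SUP f \<in> {f. in_W1p m p f \<and> W1p_norm m p f \<le> 1}. \<bar>T f\<bar>)"

definition W_dual_pd :: "'a::metric_space measure \<Rightarrow> real \<Rightarrow> (('a \<Rightarrow> real) \<Rightarrow> real) \<Rightarrow> bool" where
  "W_dual_pd m p T \<longleftrightarrow> W_dual m p T \<and>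
     (\<forall>F f. (\<forall>n. in_W1p m p (F n)) \<and> in_W1p m p f \<and>
        (\<lambda>n. Lp_norm m p (\<lambda>x. F n x - f x)) \<longlonglongrightarrow> 0 \<and>
        bounded (range (\<lambda>n. W1p_norm m p (F n)))
        \<longrightarrow> (\<lambda>n. T (F n)) \<longlonglongrightarrow> T f)"

definition pd_bidual :: "'a::metric_space measure \<Rightarrow> real \<Rightarrow> ((('a \<Rightarrow> real) \<Rightarrow> real) \<Rightarrow> real) \<Rightarrow> bool" where
  "pd_bidual m p \<Omega> \<longleftrightarrow>
     (\<forall>S T a b. W_dual_pd m p S \<and> W_dual_pd m p T \<longrightarrow>
        \<Omega> (\<lambda>f. a * S f + b * T f) = a * \<Omega> S + b * \<Omega> T) \<and>
     (\<exists>C. \<forall>T. W_dual_pd m p T \<longrightarrow> \<bar>\<Omega> T\<bar> \<le> C * W_dual_norm m p T)"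

definition pd_bidual_norm :: "'a::metric_space measure \<Rightarrow> real \<Rightarrow> ((('a \<Rightarrow> real) \<Rightarrow> real) \<Rightarrow> real) \<Rightarrow> real" where
  "pd_bidual_norm m p \<Omega> = (SUP T \<in> {T. W_dual_pd m p T \<and> W_dual_norm m p T \<le> 1}. \<bar>\<Omega> T\<bar>)"

definition conj_exp :: "real \<Rightarrow> real" where
  "conj_exp p = p / (p - 1)"

definition pairing_functional :: "'a measure \<Rightarrow> ('a \<Rightarrow> real) \<Rightarrow> (('a \<Rightarrow> real) \<Rightarrow> real)" where
  "pairing_functional m g = (\<lambda>f. \<integral>x. f x * g x \<partial>m)"

text \<open>Adjoint of g \<mapsto> L_g, with L^q' identified with L^p: the (a.e. unique) f in L^p
  with Omega(L_g) = integral of f g for all g in L^q.\<close>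
definition adjoint_L :: "'a measure \<Rightarrow> real \<Rightarrow> ((('a \<Rightarrow> real) \<Rightarrow> real) \<Rightarrow> real) \<Rightarrow> ('a \<Rightarrow> real)" where
  "adjoint_L m p \<Omega> = (SOME f. in_Lp m p f \<and>
      (\<forall>g. in_Lp m (conj_exp p) g \<longrightarrow> \<Omega> (pairing_functional m g) = (\<integral>x. f x * g x \<partial>m)))"

end

theory Submission
  imports Defs
begin

text \<open>Composing \<open>\<Omega>\<close> with \<open>g \<mapsto> L\<^sub>g\<close> gives a bounded functional on \<open>L\<^sup>q\<close>, represented by some \<open>f\<close> in
  \<open>L\<^sup>p\<close>. Balls of \<open>W\<^sup>1\<^sup>,\<^sup>p\<close> are convex and closed in \<open>L\<^sup>p\<close>, so if \<open>f\<close> were outside the ball of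
  radius \<open>\<parallel>\<Omega>\<parallel>\<close>, some \<open>g\<close> would separate them, against \<open>\<bar>\<Omega> L\<^sub>g\<bar> \<le> \<parallel>\<Omega>\<parallel> \<parallel>L\<^sub>g\<parallel>\<close>. Conversely, the
  \<open>L\<^sub>g\<close> are dense among the functionals continuous under bounded \<open>L\<^sup>p\<close> convergence, so that
  \<open>\<Omega> T = T f\<close> for all of them and \<open>\<parallel>\<Omega>\<parallel> \<le> \<parallel>f\<parallel>\<close>. Separation, density and the representation of
  functionals on \<open>L\<^sup>q\<close> all come from nearest points: if \<open>w\<close> has least norm in a convex set, then
  \<open>sgn w \<bar>w\<bar>\<^sup>p\<^sup>-\<^sup>1\<close> in \<open>L\<^sup>q\<close> supports the set at \<open>w\<close>.\<close>

section \<open>Convexity of the power function\<close>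

text \<open>Compactness is taken from L^p instead, through the uniform convexity of its norm; curves
  enter only in showing that balls of W^{1,p} are convex, scale with their radius and are closed in
  L^p. Continuity under bounded L^p convergence is what makes the part of a ball where
  \<open>T\<close> is at least \<epsilon> closed in L^p, so that it has a point of least norm;
  functionals on W^{1,p} without this continuity are not norm limits of the L_g. The order of the
  two halves is forced: \<open>T f\<close> has a meaning only once \<open>f\<close> is known to lie
  in W^{1,p}, so separation has to precede the use of density. Elements are functions rather than
  classes, hence the explicit representatives and a.e. equalities.\<close>

definition sgn_powr :: "real \<Rightarrow> real \<Rightarrow> real" where
  "sgn_powr p s = sgn s * \<bar>s\<bar> powr (p - 1)"

lemma conj_exp_gt_1: "1 < p \<Longrightarrow> 1 < conj_exp p"
  by (simp add: conj_exp_def)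

lemma conj_exp_sum: "1 < p \<Longrightarrow> 1 / p + 1 / conj_exp p = 1"
  by (simp add: conj_exp_def field_simps)

lemma conj_exp_mult: "1 < p \<Longrightarrow> (p - 1) * conj_exp p = p"
  by (simp add: conj_exp_def)

lemma conj_exp_conj_exp: "1 < p \<Longrightarrow> conj_exp (conj_exp p) = p"
  by (simp add: conj_exp_def field_simps)

lemma abs_sgn_powr: "\<bar>sgn_powr p s\<bar> = \<bar>s\<bar> powr (p - 1)"
  by (simp add: sgn_powr_def abs_mult abs_sgn_eq)

lemma abs_sgn_powr_powr:
  assumes "1 < p"
  shows "\<bar>sgn_powr p s\<bar> powr conj_exp p = \<bar>s\<bar> powr p"
  using assms by (simp add: abs_sgn_powr powr_powr conj_exp_mult)

lemma sgn_powr_mult_self: "1 < p \<Longrightarrow> s * sgn_powr p s = \<bar>s\<bar> powr p"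
proof -
  have "s * sgn_powr p s = \<bar>s\<bar> * \<bar>s\<bar> powr (p - 1)"
    by (simp add: sgn_powr_def sgn_if abs_if)
  also have "\<dots> = \<bar>s\<bar> powr p"
    by (cases "s = 0") (auto simp: powr_diff)
  finally show ?thesis .
qed

lemma borel_measurable_sgn_powr [measurable]: "sgn_powr p \<in> borel_measurable borel"
  unfolding sgn_powr_def[abs_def] by measurable

text \<open>At 0 the sign jumps, and continuity comes from \<bar>s\<bar>^(p - 1) vanishing there, as
  p > 1. It serves to let the step size tend to 0 in
  \<open>Lp_minimizer_variational\<close>.\<close>

lemma continuous_sgn_powr:
  assumes "1 < p"
  shows "isCont (sgn_powr p) s"
proof (cases "s = 0")
  case True
  have "((\<lambda>t. \<bar>t\<bar> powr (p - 1)) \<longlongrightarrow> 0) (at (0::real))"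
    using tendsto_powr'[of "\<lambda>t::real. \<bar>t\<bar>" 0 "at 0" "\<lambda>_. p - 1" "p - 1"] assms
    by (auto intro!: tendsto_eq_intros)
  then have "((\<lambda>t. \<bar>sgn_powr p t\<bar>) \<longlongrightarrow> 0) (at (0::real))"
    by (simp add: abs_sgn_powr)
  then have "(sgn_powr p \<longlongrightarrow> 0) (at 0)"
    by (rule tendsto_rabs_zero_cancel)
  then show ?thesis
    using True by (simp add: isCont_def sgn_powr_def)
next
  case False
  then show ?thesis
    unfolding sgn_powr_def isCont_def by (auto intro!: tendsto_intros)
qed

text \<open>Young's inequality read as the tangent inequality of the convex function
  \<open>s \<mapsto> \<bar>s\<bar>\<^sup>p\<close>, whose derivative is \<open>p * sgn_powr p s\<close>.\<close>

lemma powr_tangent: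
  assumes "1 < p"
  shows "\<bar>a\<bar> powr p + p * sgn_powr p a * (b - a) \<le> \<bar>b\<bar> powr p"
proof -
  have "b * sgn_powr p a \<le> \<bar>b\<bar> * \<bar>sgn_powr p a\<bar>"
    by (metis abs_ge_self abs_mult)
  also have "\<dots> \<le> \<bar>b\<bar> powr p / p + \<bar>sgn_powr p a\<bar> powr conj_exp p / conj_exp p"
    using Youngs_inequality[of p "conj_exp p" "\<bar>b\<bar>" "\<bar>sgn_powr p a\<bar>"] assms
      conj_exp_gt_1[OF assms] conj_exp_sum[OF assms] by auto
  also have "\<dots> = \<bar>b\<bar> powr p / p + \<bar>a\<bar> powr p * (1 - 1 / p)"
    unfolding abs_sgn_powr_powr[OF assms] using assms
    by (simp add: conj_exp_def field_simps)
  finally have "p * (b * sgn_powr p a) \<le> \<bar>b\<bar> powr p + (p - 1) * \<bar>a\<bar> powr p"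
    using assms by (simp add: field_simps)
  moreover have "p * sgn_powr p a * (b - a) = p * (b * sgn_powr p a) - p * (a * sgn_powr p a)"
    by (simp add: algebra_simps)
  ultimately show ?thesis
    using sgn_powr_mult_self[OF assms, of a] by (simp add: algebra_simps)
qed

text \<open>Average the tangent inequalities at the intermediate point \<open>?c\<close>: the linear
  terms cancel.\<close>

lemma powr_abs_convex:
  fixes a b :: real
  assumes "1 < p" "0 \<le> t" "t \<le> 1"
  shows "\<bar>(1 - t) * a + t * b\<bar> powr p \<le> (1 - t) * \<bar>a\<bar> powr p + t * \<bar>b\<bar> powr p"
proof -
  let ?c = "(1 - t) * a + t * b"
  have "(1 - t) * (\<bar>?c\<bar> powr p + p * sgn_powr p ?c * (a - ?c))
      + t * (\<bar>?c\<bar> powr p + p * sgn_powr p ?c * (b - ?c))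
      \<le> (1 - t) * \<bar>a\<bar> powr p + t * \<bar>b\<bar> powr p"
    by (intro add_mono mult_left_mono powr_tangent) (use assms in auto)
  moreover have "(1 - t) * (X + Y * (a - ?c)) + t * (X + Y * (b - ?c)) = X" for X Y :: real
    by (simp add: algebra_simps)
  ultimately show ?thesis by simp
qed

lemma powr_abs_add_le:
  fixes a b :: real
  assumes "1 < p"
  shows "\<bar>a + b\<bar> powr p \<le> 2 powr p * (\<bar>a\<bar> powr p + \<bar>b\<bar> powr p)"
proof -
  \<comment> \<open>Convexity at the midpoint of 2a and 2b; the factor 1/2 is then given
    away.\<close>
  have "\<bar>(1 - 1/2) * (2 * a) + 1/2 * (2 * b)\<bar> powr p
      \<le> (1 - 1/2) * \<bar>2 * a\<bar> powr p + 1/2 * \<bar>2 * b\<bar> powr p"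
    by (rule powr_abs_convex) (use assms in auto)
  also have "\<dots> \<le> 2 powr p * (\<bar>a\<bar> powr p + \<bar>b\<bar> powr p)"
  proof -
    have "0 \<le> 2 powr p * \<bar>a\<bar> powr p" "0 \<le> 2 powr p * \<bar>b\<bar> powr p"
      by simp_all
    moreover have "(1 - 1/2) * x + 1/2 * y \<le> x + y" if "0 \<le> x" "0 \<le> y" for x y :: real
      using that by simp
    ultimately show ?thesis
      unfolding abs_mult powr_mult distrib_left abs_numeral by blast
  qed
  finally show ?thesis by simp
qed

section \<open>Strict and uniform convexity of the power function\<close>

lemma powr_midpoint_strict_nonneg:
  fixes a b :: real
  assumes "1 < p" "0 \<le> a" "a < b"
  shows "((a + b) / 2) powr p < (a powr p + b powr p) / 2"
proof -
  define c where "c = (a + b) / 2"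
  have c: "a < c" "c < b" "0 < c" "b - c = c - a"
    using assms by (auto simp: c_def field_simps)
  have deriv: "((\<lambda>x. x powr p) has_real_derivative p * z powr (p - 1)) (at z)" if "0 < z" for z
    using that by (auto intro!: derivative_eq_intros simp: powr_diff)
  have cont: "continuous_on {x..y} (\<lambda>x. x powr p)" if "0 \<le> x" for x y :: real
    using that assms by (intro continuous_intros continuous_on_powr') auto
  \<comment> \<open>The halves [a, c] and [c, b] have equal length, so by the mean value theorem the
    claim reduces to strict growth of the derivative. The left endpoint may be 0, where only
    continuity is at hand.\<close>
  have mv: "\<exists>z. x < z \<and> z < y \<and> y powr p - x powr p = (y - x) * (p * z powr (p - 1))"
    if "0 \<le> x" "x < y" for x y :: real
  proof -
    have "(\<lambda>x. x powr p) differentiable (at z)" if "x < z" for z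
      using deriv[of z] that \<open>0 \<le> x\<close> real_differentiable_def by force
    then obtain l z where z: "x < z" "z < y"
      "((\<lambda>x. x powr p) has_real_derivative l) (at z)" "y powr p - x powr p = (y - x) * l"
      using MVT[OF \<open>x < y\<close> cont[OF \<open>0 \<le> x\<close>]] by blast
    have "l = p * z powr (p - 1)"
      using z that deriv[of z] by (intro DERIV_unique) auto
    then show ?thesis using z by blast
  qed
  obtain z1 where z1: "a < z1" "z1 < c" "c powr p - a powr p = (c - a) * (p * z1 powr (p - 1))"
    using mv[of a c] c assms by auto
  obtain z2 where z2: "c < z2" "z2 < b" "b powr p - c powr p = (b - c) * (p * z2 powr (p - 1))"
    using mv[of c b] c assms by auto
  have "z1 powr (p - 1) < z2 powr (p - 1)"
    using z1 z2 assms by (intro powr_less_mono2) auto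
  then have "(c - a) * (p * z1 powr (p - 1)) < (b - c) * (p * z2 powr (p - 1))"
    using c assms by simp
  then have "c powr p < (a powr p + b powr p) / 2"
    using z1(3) z2(3) by simp
  then show ?thesis by (simp add: c_def)
qed

text \<open>Different absolute values reduce to the nonnegative case by the triangle inequality;
  equal ones force b = - a, whose midpoint is 0.\<close>

lemma powr_abs_midpoint_strict:
  fixes a b :: real
  assumes "1 < p" "a \<noteq> b"
  shows "\<bar>(a + b) / 2\<bar> powr p < (\<bar>a\<bar> powr p + \<bar>b\<bar> powr p) / 2"
proof (cases "\<bar>a\<bar> = \<bar>b\<bar>")
  case True
  then have b: "b = - a" using assms(2) by linarith
  then have "a \<noteq> 0" using assms(2) by simp
  then show ?thesis by (simp add: b)
next
  case False
  have "\<bar>(a + b) / 2\<bar> powr p \<le> ((\<bar>a\<bar> + \<bar>b\<bar>) / 2) powr p"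
    using assms by (intro powr_mono2) auto
  also have "\<dots> < (\<bar>a\<bar> powr p + \<bar>b\<bar> powr p) / 2"
    using powr_midpoint_strict_nonneg[of p "\<bar>a\<bar>" "\<bar>b\<bar>"]
      powr_midpoint_strict_nonneg[of p "\<bar>b\<bar>" "\<bar>a\<bar>"] assms False
    by (cases "\<bar>a\<bar> < \<bar>b\<bar>") (auto simp: add.commute)
  finally show ?thesis .
qed

text \<open>A scalar inequality that can be integrated, giving uniform convexity of L^p for all p >
  1 at once. Both sides are homogeneous of degree p, so pairs with \<open>N\<close> equal to 1
  suffice. Among these, close pairs are absorbed by the term with \<open>e\<close>; the others form
  a compact set, on which the convexity defect \<open>D\<close> has a positive minimum.\<close>

lemma powr_uniformly_convex:
  fixes p e :: real
  assumes p: "1 < p" and e: "0 < e"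
  obtains K where "0 \<le> K" "\<And>a b :: real. \<bar>a - b\<bar> powr p \<le> e * (\<bar>a\<bar> powr p + \<bar>b\<bar> powr p)
      + K * ((\<bar>a\<bar> powr p + \<bar>b\<bar> powr p) / 2 - \<bar>(a + b) / 2\<bar> powr p)"
proof -
  define N where "N = (\<lambda>z::real \<times> real. \<bar>fst z\<bar> powr p + \<bar>snd z\<bar> powr p)"
  define D where "D = (\<lambda>z. N z / 2 - \<bar>(fst z + snd z) / 2\<bar> powr p)"
  define S where "S = {z. N z = 1 \<and> e \<le> \<bar>fst z - snd z\<bar> powr p}"
  have contN: "continuous_on UNIV N"
    unfolding N_def using p by (intro continuous_intros continuous_on_powr') auto
  have contD: "continuous_on UNIV D"
    unfolding D_def using p by (intro continuous_intros continuous_on_powr' contN) auto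
  have contd: "continuous_on UNIV (\<lambda>z::real \<times> real. \<bar>fst z - snd z\<bar> powr p)"
    using p by (intro continuous_intros continuous_on_powr') auto
  have le1: "\<bar>fst z\<bar> \<le> 1 \<and> \<bar>snd z\<bar> \<le> 1" if "N z = 1" for z
  proof -
    have "\<bar>x\<bar> \<le> 1" if "\<bar>x\<bar> powr p \<le> 1" for x :: real
    proof (rule ccontr)
      assume "\<not> \<bar>x\<bar> \<le> 1"
      then have "1 powr p < \<bar>x\<bar> powr p" using p by (intro powr_less_mono2) auto
      then show False using that unfolding powr_one_eq_one by linarith
    qed
    moreover have "\<bar>fst z\<bar> powr p \<le> 1" "\<bar>snd z\<bar> powr p \<le> 1"
      using that unfolding N_def by (smt (verit) powr_ge_zero)+
    ultimately show ?thesis by auto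
  qed
  have "S \<subseteq> cbox (-1, -1) (1, 1)"
    using le1 unfolding S_def by (force simp: cbox_Pair_eq abs_le_iff mem_Times_iff)
  then have "bounded S" using bounded_cbox bounded_subset by blast
  moreover have "closed S"
    unfolding S_def Collect_conj_eq
    by (intro closed_Int closed_Collect_eq closed_Collect_le contN contd continuous_on_const)
  ultimately have "compact S" by (simp add: compact_eq_bounded_closed)
  have Dpos: "0 < D z" if "z \<in> S" for z
  proof -
    have "fst z \<noteq> snd z" using that e by (auto simp: S_def)
    then show ?thesis using powr_abs_midpoint_strict[OF p, of "fst z" "snd z"]
      by (simp add: D_def N_def)
  qed
  obtain c where c: "0 < c" "\<And>z. z \<in> S \<Longrightarrow> c \<le> D z"
  proof (cases "S = {}")
    case False
    then obtain z0 where "z0 \<in> S" "\<forall>z\<in>S. D z0 \<le> D z"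
      using continuous_attains_inf[OF \<open>compact S\<close> False] contD continuous_on_subset by blast
    then show ?thesis using that Dpos by blast
  qed (use that[of 1] in auto)
  \<comment> \<open>On \<open>S\<close> the left-hand side is at most 2^p and the defect is at least
    \<open>c\<close>.\<close>
  define K where "K = 2 powr p / c"
  have K: "0 \<le> K" using c by (simp add: K_def)
  have Dnn: "0 \<le> D z" for z
    using powr_abs_midpoint_strict[OF p, of "fst z" "snd z"]
    by (cases "fst z = snd z") (auto simp: D_def N_def abs_mult)
  have unit: "\<bar>fst z - snd z\<bar> powr p \<le> e + K * D z" if "N z = 1" for z
  proof (cases "e \<le> \<bar>fst z - snd z\<bar> powr p")
    case True
    then have "z \<in> S" using that by (simp add: S_def)
    have "\<bar>fst z - snd z\<bar> powr p \<le> 2 powr p"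
      using le1[OF that] p by (intro powr_mono2) auto
    also have "\<dots> = K * c" using c by (simp add: K_def)
    also have "\<dots> \<le> K * D z" using c(2)[OF \<open>z \<in> S\<close>] K by (intro mult_left_mono)
    finally show ?thesis using e by simp
  next
    case False
    then show ?thesis using K Dnn[of z] by (smt (verit) mult_nonneg_nonneg)
  qed
  have "\<bar>a - b\<bar> powr p \<le> e * N (a, b) + K * D (a, b)" for a b
  proof (cases "a = 0 \<and> b = 0")
    case True
    then show ?thesis by (simp add: N_def D_def)
  next
    case False
    \<comment> \<open>Dividing a and b by \<open>s\<close> makes \<open>N\<close> equal to 1 and
      divides every other term by \<open>N (a, b)\<close>.\<close>
    define s where "s = N (a, b) powr (1 / p)"
    have Npos: "0 < N (a, b)"
      using False by (auto simp: N_def add_pos_nonneg add_nonneg_pos)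
    then have s: "0 < s" "s powr p = N (a, b)"
      using p by (auto simp: s_def powr_powr)
    have sc: "\<bar>x / s\<bar> powr p = \<bar>x\<bar> powr p / N (a, b)" for x
      using s by (simp add: powr_divide abs_divide)
    have N1: "N (a / s, b / s) = 1"
    proof -
      have "N (a / s, b / s) = \<bar>a / s\<bar> powr p + \<bar>b / s\<bar> powr p"
        by (simp only: N_def fst_conv snd_conv)
      also have "\<dots> = (\<bar>a\<bar> powr p + \<bar>b\<bar> powr p) / N (a, b)"
        by (simp only: sc add_divide_distrib)
      also have "\<dots> = 1"
        using Npos by (simp add: N_def)
      finally show ?thesis .
    qed
    have "D (a / s, b / s) = 1 / 2 - \<bar>((a + b) / 2) / s\<bar> powr p"
      using N1 by (simp add: D_def add_divide_distrib algebra_simps)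
    also have "\<dots> = D (a, b) / N (a, b)"
      using Npos by (simp only: sc) (simp add: D_def field_simps)
    finally have D1: "D (a / s, b / s) = D (a, b) / N (a, b)" .
    have "\<bar>a / s - b / s\<bar> powr p \<le> e + K * D (a / s, b / s)"
      using unit[OF N1] by simp
    moreover have "\<bar>a / s - b / s\<bar> powr p = \<bar>a - b\<bar> powr p / N (a, b)"
      by (simp only: sc flip: diff_divide_distrib)
    ultimately show ?thesis
      using Npos by (simp add: D1 field_simps)
  qed
  then show ?thesis
    using that[OF K] by (simp add: N_def D_def)
qed

section \<open>Energy and Hoelder's inequality\<close>

text \<open>The p-th power of the norm, preferred because pointwise inequalities integrate to it
  directly. As a Bochner integral it defaults to 0 when the integrand is not integrable, so it is
  informative only together with \<open>in_Lp\<close>.\<close>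

definition Lp_energy :: "'a measure \<Rightarrow> real \<Rightarrow> ('a \<Rightarrow> real) \<Rightarrow> real" where
  "Lp_energy M p f = (\<integral>x. \<bar>f x\<bar> powr p \<partial>M)"

lemma Lp_energy_nonneg [simp]: "0 \<le> Lp_energy M p f"
  by (simp add: Lp_energy_def)

lemma in_Lp_iff:
  "in_Lp M p f \<longleftrightarrow> f \<in> borel_measurable M \<and> integrable M (\<lambda>x. \<bar>f x\<bar> powr p)"
  by (auto simp: in_Lp_def integrable_iff_bounded)

lemma in_Lp_measurable: "in_Lp M p f \<Longrightarrow> f \<in> borel_measurable M"
  by (simp add: in_Lp_def)

lemma in_Lp_integrable: "in_Lp M p f \<Longrightarrow> integrable M (\<lambda>x. \<bar>f x\<bar> powr p)"
  by (simp add: in_Lp_iff)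

lemma nn_integral_Lp_energy:
  "in_Lp M p f \<Longrightarrow> (\<integral>\<^sup>+ x. ennreal (\<bar>f x\<bar> powr p) \<partial>M) = ennreal (Lp_energy M p f)"
  unfolding Lp_energy_def by (intro nn_integral_eq_integral in_Lp_integrable) auto

lemma Lp_norm_eq: "in_Lp M p f \<Longrightarrow> Lp_norm M p f = Lp_energy M p f powr (1 / p)"
  by (simp add: Lp_norm_def nn_integral_Lp_energy)

lemma Lp_norm_powr: "1 < p \<Longrightarrow> in_Lp M p f \<Longrightarrow> Lp_norm M p f powr p = Lp_energy M p f"
  by (simp add: Lp_norm_eq powr_powr)

lemma Lp_norm_nonneg [simp]: "0 \<le> Lp_norm M p f"
  by (simp add: Lp_norm_def)

lemma Lp_norm_tendsto_0_iff:
  assumes "1 < p" "\<And>n. in_Lp M p (u n)"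
  shows "(\<lambda>n. Lp_norm M p (u n)) \<longlonglongrightarrow> 0 \<longleftrightarrow> (\<lambda>n. Lp_energy M p (u n)) \<longlonglongrightarrow> 0"
proof
  assume "(\<lambda>n. Lp_norm M p (u n)) \<longlonglongrightarrow> 0"
  then have "(\<lambda>n. Lp_norm M p (u n) powr p) \<longlonglongrightarrow> 0 powr p"
    by (intro tendsto_powr') (use assms in auto)
  then show "(\<lambda>n. Lp_energy M p (u n)) \<longlonglongrightarrow> 0"
    using assms by (simp add: Lp_norm_powr)
next
  assume "(\<lambda>n. Lp_energy M p (u n)) \<longlonglongrightarrow> 0"
  then have "(\<lambda>n. Lp_energy M p (u n) powr (1 / p)) \<longlonglongrightarrow> 0 powr (1 / p)"
    by (intro tendsto_powr') (use assms in auto)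
  then show "(\<lambda>n. Lp_norm M p (u n)) \<longlonglongrightarrow> 0"
    using assms by (simp add: Lp_norm_eq)
qed

lemma in_Lp_bound:
  assumes "f \<in> borel_measurable M" "integrable M h" "AE x in M. \<bar>f x\<bar> powr p \<le> h x"
  shows "in_Lp M p f"
  unfolding in_Lp_iff using assms
  by (intro conjI Bochner_Integration.integrable_bound[OF assms(2)]) auto

lemma in_Lp_zero [simp]: "in_Lp M p (\<lambda>x. 0)"
  by (simp add: in_Lp_def)

lemma in_Lp_cmult: "in_Lp M p f \<Longrightarrow> in_Lp M p (\<lambda>x. c * f x)"
  by (auto simp: in_Lp_iff abs_mult powr_mult)

lemma in_Lp_abs: "in_Lp M p f \<Longrightarrow> in_Lp M p (\<lambda>x. \<bar>f x\<bar>)"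
  by (auto simp: in_Lp_iff)

lemma in_Lp_add:
  assumes "1 < p" "in_Lp M p f" "in_Lp M p g"
  shows "in_Lp M p (\<lambda>x. f x + g x)"
proof (rule in_Lp_bound)
  show "integrable M (\<lambda>x. 2 powr p * (\<bar>f x\<bar> powr p + \<bar>g x\<bar> powr p))"
    using assms(2,3) by (intro integrable_mult_right Bochner_Integration.integrable_add in_Lp_integrable)
  show "AE x in M. \<bar>f x + g x\<bar> powr p \<le> 2 powr p * (\<bar>f x\<bar> powr p + \<bar>g x\<bar> powr p)"
    using powr_abs_add_le[OF assms(1)] by simp
qed (use assms(2,3) in \<open>auto intro: borel_measurable_add in_Lp_measurable\<close>)

lemma in_Lp_lincomb:
  assumes "1 < p" "in_Lp M p f" "in_Lp M p g"
  shows "in_Lp M p (\<lambda>x. a * f x + b * g x)"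
  using assms by (intro in_Lp_add in_Lp_cmult)

lemma in_Lp_diff:
  assumes "1 < p" "in_Lp M p f" "in_Lp M p g"
  shows "in_Lp M p (\<lambda>x. f x - g x)"
  using in_Lp_lincomb[OF assms, of 1 "-1"] by simp

lemma Lp_energy_zero [simp]: "Lp_energy M p (\<lambda>x. 0) = 0"
  by (simp add: Lp_energy_def)

lemma Lp_energy_cmult: "Lp_energy M p (\<lambda>x. c * f x) = \<bar>c\<bar> powr p * Lp_energy M p f"
  by (simp add: Lp_energy_def abs_mult powr_mult)

lemma Lp_energy_convex:
  assumes "1 < p" "in_Lp M p f" "in_Lp M p g" "0 \<le> t" "t \<le> 1"
  shows "Lp_energy M p (\<lambda>x. (1 - t) * f x + t * g x) \<le> (1 - t) * Lp_energy M p f + t * Lp_energy M p g"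
proof -
  have "Lp_energy M p (\<lambda>x. (1 - t) * f x + t * g x)
      \<le> (\<integral>x. (1 - t) * \<bar>f x\<bar> powr p + t * \<bar>g x\<bar> powr p \<partial>M)"
    unfolding Lp_energy_def
    by (intro integral_mono powr_abs_convex Bochner_Integration.integrable_add integrable_mult_right
          in_Lp_integrable in_Lp_lincomb assms)
  also have "\<dots> = (1 - t) * Lp_energy M p f + t * Lp_energy M p g"
    unfolding Lp_energy_def using assms(2,3)
    by (subst Bochner_Integration.integral_add)
      (auto intro!: integrable_mult_right in_Lp_integrable)
  finally show ?thesis .
qed

lemma Lp_energy_eq_0_iff:
  assumes "in_Lp M p f"
  shows "Lp_energy M p f = 0 \<longleftrightarrow> (AE x in M. f x = 0)"
  unfolding Lp_energy_def using integral_nonneg_eq_0_iff_AE[OF in_Lp_integrable[OF assms]] by simp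

text \<open>For functions scaled to unit norm, Young's inequality integrates to 1/p + 1/q = 1. Where
  scaling is impossible, one factor vanishes almost everywhere.\<close>

lemma Holder_inequality:
  assumes p: "1 < p" and f: "in_Lp M p f" and g: "in_Lp M (conj_exp p) g"
  shows "integrable M (\<lambda>x. f x * g x)"
    and "\<bar>\<integral>x. f x * g x \<partial>M\<bar> \<le> Lp_norm M p f * Lp_norm M (conj_exp p) g"
proof -
  let ?q = "conj_exp p"
  have q: "1 < ?q" "1 / p + 1 / ?q = 1"
    using conj_exp_gt_1[OF p] conj_exp_sum[OF p] by auto
  have [measurable]: "f \<in> borel_measurable M" "g \<in> borel_measurable M"
    using f g by (auto dest: in_Lp_measurable)
  have young: "\<bar>s * t\<bar> \<le> \<bar>s\<bar> powr p / p + \<bar>t\<bar> powr ?q / ?q" for s t :: real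
    using Youngs_inequality[of p ?q "\<bar>s\<bar>" "\<bar>t\<bar>"] p q by (simp add: abs_mult)
  have int: "integrable M (\<lambda>x. \<bar>f x\<bar> powr p / p + \<bar>g x\<bar> powr ?q / ?q)"
    using f g by (auto intro!: Bochner_Integration.integrable_add integrable_divide in_Lp_integrable)
  show ifg: "integrable M (\<lambda>x. f x * g x)"
    by (rule Bochner_Integration.integrable_bound[OF int])
      (use young in \<open>auto intro!: AE_I2 order_trans[OF _ abs_ge_self]\<close>)
  let ?A = "Lp_norm M p f" and ?B = "Lp_norm M ?q g"
  show "\<bar>\<integral>x. f x * g x \<partial>M\<bar> \<le> ?A * ?B"
  proof (cases "?A = 0 \<or> ?B = 0")
    case True
    have "(AE x in M. f x = 0) \<or> (AE x in M. g x = 0)"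
      using True Lp_energy_eq_0_iff[OF f] Lp_energy_eq_0_iff[OF g] by (simp add: Lp_norm_eq f g)
    then have "AE x in M. f x * g x = 0" by auto
    then have "(\<integral>x. f x * g x \<partial>M) = (\<integral>x. 0 \<partial>M)"
      by (intro integral_cong_AE) auto
    then show ?thesis by simp
  next
    case False
    then have AB: "0 < ?A" "0 < ?B" by (simp_all add: less_le)
    have sc: "Lp_energy M p (\<lambda>x. (1 / ?A) * f x) = 1" "Lp_energy M ?q (\<lambda>x. (1 / ?B) * g x) = 1"
      using AB p q Lp_norm_powr[OF p f] Lp_norm_powr[OF q(1) g]
      unfolding Lp_energy_cmult by (auto simp: powr_divide)
    have "(\<integral>x. \<bar>((1 / ?A) * f x) * ((1 / ?B) * g x)\<bar> \<partial>M)
        \<le> (\<integral>x. \<bar>(1 / ?A) * f x\<bar> powr p / p + \<bar>(1 / ?B) * g x\<bar> powr ?q / ?q \<partial>M)"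
    proof (rule integral_mono)
      have "integrable M (\<lambda>x. \<bar>((1 / ?A) * (1 / ?B)) * (f x * g x)\<bar>)"
        using ifg by auto
      then show "integrable M (\<lambda>x. \<bar>((1 / ?A) * f x) * ((1 / ?B) * g x)\<bar>)"
        by (simp add: mult_ac)
      show "integrable M (\<lambda>x. \<bar>(1 / ?A) * f x\<bar> powr p / p + \<bar>(1 / ?B) * g x\<bar> powr ?q / ?q)"
        using f g by (intro Bochner_Integration.integrable_add integrable_divide in_Lp_integrable in_Lp_cmult)
    qed (rule young)
    also have "\<dots> = Lp_energy M p (\<lambda>x. (1 / ?A) * f x) / p + Lp_energy M ?q (\<lambda>x. (1 / ?B) * g x) / ?q"
      unfolding Lp_energy_def
      using in_Lp_integrable[OF in_Lp_cmult[OF f, of "1 / ?A"]]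
        in_Lp_integrable[OF in_Lp_cmult[OF g, of "1 / ?B"]]
      by (subst Bochner_Integration.integral_add) auto
    also have "\<dots> = 1"
      using q by (simp only: sc)
    finally have "(\<integral>x. \<bar>f x * g x\<bar> \<partial>M) / (?A * ?B) \<le> 1"
      using AB by (simp add: abs_mult)
    then have "(\<integral>x. \<bar>f x * g x\<bar> \<partial>M) \<le> ?A * ?B"
      using AB by (simp add: field_simps)
    then show ?thesis
      using integral_abs_bound[of M "\<lambda>x. f x * g x"] by linarith
  qed
qed

section \<open>The duality map from L^p to L^q, tangents and semicontinuity of the energy\<close>

lemma in_Lp_sgn_powr:
  assumes "1 < p" "in_Lp M p u"
  shows "in_Lp M (conj_exp p) (\<lambda>x. sgn_powr p (u x))"
    and "Lp_energy M (conj_exp p) (\<lambda>x. sgn_powr p (u x)) = Lp_energy M p u"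
proof -
  have [measurable]: "u \<in> borel_measurable M"
    using assms by (auto dest: in_Lp_measurable)
  show "in_Lp M (conj_exp p) (\<lambda>x. sgn_powr p (u x))"
    unfolding in_Lp_iff abs_sgn_powr_powr[OF assms(1)]
    using in_Lp_integrable[OF assms(2)] by simp
  show "Lp_energy M (conj_exp p) (\<lambda>x. sgn_powr p (u x)) = Lp_energy M p u"
    unfolding Lp_energy_def abs_sgn_powr_powr[OF assms(1)] ..
qed

lemma integral_mult_sgn_powr:
  "1 < p \<Longrightarrow> (\<integral>x. u x * sgn_powr p (u x) \<partial>M) = Lp_energy M p u"
  by (simp add: Lp_energy_def sgn_powr_mult_self)

lemma tendsto_integral_mult:
  assumes p: "1 < p" and u: "\<And>n. in_Lp M p (u n)" and w: "in_Lp M p w" and g: "in_Lp M (conj_exp p) g"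
    and lim: "(\<lambda>n. Lp_energy M p (\<lambda>x. u n x - w x)) \<longlonglongrightarrow> 0"
  shows "(\<lambda>n. \<integral>x. u n x * g x \<partial>M) \<longlonglongrightarrow> (\<integral>x. w x * g x \<partial>M)"
proof -
  have d: "in_Lp M p (\<lambda>x. u n x - w x)" for n
    using in_Lp_diff[OF p u w] .
  have "(\<lambda>n. Lp_norm M p (\<lambda>x. u n x - w x) * Lp_norm M (conj_exp p) g) \<longlonglongrightarrow> 0 * Lp_norm M (conj_exp p) g"
    using lim Lp_norm_tendsto_0_iff[OF p, of M "\<lambda>n x. u n x - w x"] d by (intro tendsto_mult) auto
  then have "(\<lambda>n. Lp_norm M p (\<lambda>x. u n x - w x) * Lp_norm M (conj_exp p) g) \<longlonglongrightarrow> 0"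
    by simp
  then have "(\<lambda>n. (\<integral>x. u n x * g x \<partial>M) - (\<integral>x. w x * g x \<partial>M)) \<longlonglongrightarrow> 0"
  proof (rule Lim_null_comparison[rotated], intro always_eventually allI)
    fix n
    have "(\<integral>x. u n x * g x \<partial>M) - (\<integral>x. w x * g x \<partial>M) = (\<integral>x. (u n x - w x) * g x \<partial>M)"
      using Holder_inequality(1)[OF p u g] Holder_inequality(1)[OF p w g]
      by (simp add: left_diff_distrib)
    then show "norm ((\<integral>x. u n x * g x \<partial>M) - (\<integral>x. w x * g x \<partial>M))
        \<le> Lp_norm M p (\<lambda>x. u n x - w x) * Lp_norm M (conj_exp p) g"
      using Holder_inequality(2)[OF p d g] by simp
  qed
  then show ?thesis by (rule LIM_zero_cancel)
qed

text \<open>The integrated form of \<open>powr_tangent\<close>; it yields both lower semicontinuity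
  of the energy and the first-order condition at minimizers.\<close>

lemma Lp_energy_tangent:
  assumes p: "1 < p" and u: "in_Lp M p u" and v: "in_Lp M p v"
  shows "Lp_energy M p u + p * (\<integral>x. (v x - u x) * sgn_powr p (u x) \<partial>M) \<le> Lp_energy M p v"
proof -
  have i: "integrable M (\<lambda>x. (v x - u x) * sgn_powr p (u x))"
    by (intro Holder_inequality(1)[OF p] in_Lp_diff in_Lp_sgn_powr assms)
  have "Lp_energy M p u + p * (\<integral>x. (v x - u x) * sgn_powr p (u x) \<partial>M)
      = (\<integral>x. \<bar>u x\<bar> powr p + p * ((v x - u x) * sgn_powr p (u x)) \<partial>M)"
    unfolding Lp_energy_def using i in_Lp_integrable[OF u]
    by (subst Bochner_Integration.integral_add) auto
  also have "\<dots> \<le> Lp_energy M p v"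
    unfolding Lp_energy_def
  proof (rule integral_mono)
    show "integrable M (\<lambda>x. \<bar>u x\<bar> powr p + p * ((v x - u x) * sgn_powr p (u x)))"
      by (intro Bochner_Integration.integrable_add integrable_mult_right in_Lp_integrable u i)
    show "\<bar>u x\<bar> powr p + p * ((v x - u x) * sgn_powr p (u x)) \<le> \<bar>v x\<bar> powr p" for x
      using powr_tangent[OF p, of "u x" "v x"] by (simp add: mult_ac)
  qed (rule in_Lp_integrable[OF v])
  finally show ?thesis .
qed

text \<open>Use the tangent at the limit \<open>w\<close>: its linear term is a pairing with a fixed
  element of L^q and tends to 0.\<close>

lemma Lp_energy_lower_semicontinuous:
  assumes p: "1 < p" and u: "\<And>n. in_Lp M p (u n)" and w: "in_Lp M p w"
    and lim: "(\<lambda>n. Lp_energy M p (\<lambda>x. u n x - w x)) \<longlonglongrightarrow> 0"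
    and b: "b \<longlonglongrightarrow> B" "\<And>n. Lp_energy M p (u n) \<le> b n"
  shows "Lp_energy M p w \<le> B"
proof (rule LIMSEQ_le[OF _ b(1)])
  have "(\<lambda>n. \<integral>x. (u n x - w x) * sgn_powr p (w x) \<partial>M) \<longlonglongrightarrow> (\<integral>x. 0 * sgn_powr p (w x) \<partial>M)"
    using lim by (intro tendsto_integral_mult[OF p]) (auto intro!: in_Lp_diff in_Lp_sgn_powr p u w)
  then show "(\<lambda>n. Lp_energy M p w + p * (\<integral>x. (u n x - w x) * sgn_powr p (w x) \<partial>M)) \<longlonglongrightarrow> Lp_energy M p w"
    by (auto intro!: tendsto_eq_intros)
  show "\<exists>N. \<forall>n\<ge>N. Lp_energy M p w + p * (\<integral>x. (u n x - w x) * sgn_powr p (w x) \<partial>M) \<le> b n"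
    using Lp_energy_tangent[OF p w u] b(2) order_trans by blast
qed

section \<open>Completeness of \<open>L\<^sup>p\<close>\<close>

lemma ennreal_powr_ennreal: "0 \<le> a \<Longrightarrow> ennreal_powr (ennreal a) p = ennreal (a powr p)"
  by (simp add: ennreal_powr_def)

lemma ennreal_powr_top [simp]: "ennreal_powr top p = top"
  by (simp add: ennreal_powr_def)

lemma ennreal_powr_0 [simp]: "ennreal_powr 0 p = 0"
  by (simp add: ennreal_powr_def)

lemma ennreal_powr_mono:
  assumes "0 \<le> p" "x \<le> y"
  shows "ennreal_powr x p \<le> ennreal_powr y p"
proof (cases y)
  case (real b)
  then obtain a where "x = ennreal a" "0 \<le> a" "a \<le> b"
    using assms(2) by (cases x) (auto simp: top_unique)
  then show ?thesis
    using real assms(1) by (auto simp: ennreal_powr_ennreal intro!: ennreal_leI powr_mono2)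
qed simp

lemma ennreal_powr_cmult:
  assumes "0 < c"
  shows "ennreal_powr (ennreal c * x) p = ennreal (c powr p) * ennreal_powr x p"
proof (cases x)
  case (real a)
  then show ?thesis
    using assms by (simp add: ennreal_powr_ennreal powr_mult flip: ennreal_mult)
next
  case top
  then show ?thesis
    using assms by (simp add: ennreal_mult_top)
qed

lemma ennreal_powr_le_imp_le:
  assumes "0 < p" "0 \<le> S" "ennreal_powr x p \<le> ennreal S"
  shows "x \<le> ennreal (S powr (1 / p))"
proof (cases x)
  case (real a)
  then have "a powr p \<le> S"
    using assms by (simp add: ennreal_powr_ennreal)
  then have "(a powr p) powr (1 / p) \<le> S powr (1 / p)"
    using assms by (intro powr_mono2) auto
  then show ?thesis
    using real assms by (simp add: powr_powr ennreal_leI)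
next
  case top
  then show ?thesis
    using assms by (simp add: top_unique)
qed

text \<open>Each term is at most the sum S of the series, so each \<open>x k\<close> is at most
  S^(1/p). Trading the supremum for a series allows termwise integration.\<close>

lemma ennreal_powr_SUP_le:
  fixes x :: "nat \<Rightarrow> ennreal"
  assumes "0 < p"
  shows "ennreal_powr (SUP k. x k) p \<le> (\<Sum>k. ennreal_powr (x k) p)"
proof (cases "\<Sum>k. ennreal_powr (x k) p")
  case (real S)
  have "ennreal_powr (x k) p \<le> ennreal S" for k
    using sum_le_suminf[of "\<lambda>k. ennreal_powr (x k) p" "{k}"] real by (simp add: summableI)
  then have "(SUP k. x k) \<le> ennreal (S powr (1 / p))"
    using assms real by (intro SUP_least ennreal_powr_le_imp_le) auto
  then have "ennreal_powr (SUP k. x k) p \<le> ennreal_powr (ennreal (S powr (1 / p))) p"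
    using assms by (intro ennreal_powr_mono) auto
  then show ?thesis
    using assms real by (simp add: ennreal_powr_ennreal powr_powr)
qed simp

lemma borel_measurable_ennreal_powr [measurable]:
  "(\<lambda>x. ennreal_powr x p) \<in> borel_measurable borel"
  unfolding ennreal_powr_def by measurable

text \<open>Chosen so that \<open>2\<^sup>k * g\<close> has energy at most \<open>2\<^sup>-\<^sup>k\<close> when \<open>g\<close> has energy at most
  \<open>geometric_tolerance p k\<close>.\<close>

definition geometric_tolerance :: "real \<Rightarrow> nat \<Rightarrow> real" where
  "geometric_tolerance p k = (1 / 2) ^ k / (2 ^ k) powr p"

lemma geometric_tolerance_pos: "0 < geometric_tolerance p k"
  by (simp add: geometric_tolerance_def)

text \<open>Packs a fast decreasing sequence into one function: wherever the supremum is finite,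
  \<open>g k\<close> decays like 2^-k. The tolerance cancels the factor 2^(k p) and leaves a
  geometric series.\<close>

lemma nn_integral_weighted_SUP_le:
  fixes g :: "nat \<Rightarrow> 'a \<Rightarrow> ennreal"
  assumes "0 < p" and [measurable]: "\<And>k. g k \<in> borel_measurable M"
    and le: "\<And>k. (\<integral>\<^sup>+ x. ennreal_powr (g k x) p \<partial>M) \<le> ennreal (geometric_tolerance p k)"
  shows "(\<integral>\<^sup>+ x. ennreal_powr (SUP k. ennreal (2 ^ k) * g k x) p \<partial>M) < \<infinity>"
proof -
  have "(\<integral>\<^sup>+ x. ennreal_powr (SUP k. ennreal (2 ^ k) * g k x) p \<partial>M)
      \<le> (\<integral>\<^sup>+ x. (\<Sum>k. ennreal_powr (ennreal (2 ^ k) * g k x) p) \<partial>M)"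
    by (intro nn_integral_mono ennreal_powr_SUP_le assms(1))
  also have "\<dots> = (\<Sum>k. ennreal ((2 ^ k) powr p) * (\<integral>\<^sup>+ x. ennreal_powr (g k x) p \<partial>M))"
    by (subst nn_integral_suminf) (simp_all add: ennreal_powr_cmult nn_integral_cmult)
  also have "\<dots> \<le> (\<Sum>k. ennreal ((1 / 2) ^ k))"
  proof (intro suminf_le summableI)
    fix k
    have "ennreal ((2 ^ k) powr p) * (\<integral>\<^sup>+ x. ennreal_powr (g k x) p \<partial>M)
        \<le> ennreal ((2 ^ k) powr p) * ennreal (geometric_tolerance p k)"
      by (intro mult_left_mono le) auto
    also have "\<dots> = ennreal ((1 / 2) ^ k)"
      by (subst ennreal_mult[symmetric]) (auto simp: geometric_tolerance_def)
    finally show "ennreal ((2 ^ k) powr p) * (\<integral>\<^sup>+ x. ennreal_powr (g k x) p \<partial>M) \<le> ennreal ((1 / 2) ^ k)" .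
  qed
  also have "\<dots> = ennreal (\<Sum>k. (1 / 2) ^ k)"
    by (intro suminf_ennreal2) auto
  also have "\<dots> < \<infinity>" by simp
  finally show ?thesis .
qed

lemma AE_finite_of_nn_integral_ennreal_powr:
  assumes [measurable]: "H \<in> borel_measurable M" and "(\<integral>\<^sup>+ x. ennreal_powr (H x) p \<partial>M) < \<infinity>"
  shows "AE x in M. H x < \<infinity>"
proof -
  have "AE x in M. ennreal_powr (H x) p \<noteq> \<infinity>"
    using assms by (intro nn_integral_PInf_AE) auto
  then show ?thesis
    by (rule AE_mp) (auto simp: ennreal_powr_def less_top intro!: AE_I2)
qed

lemma nn_integral_ennreal_powr_abs:
  "in_Lp M p f \<Longrightarrow> (\<integral>\<^sup>+ x. ennreal_powr (ennreal \<bar>f x\<bar>) p \<partial>M) = ennreal (Lp_energy M p f)"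
  by (simp add: ennreal_powr_ennreal nn_integral_Lp_energy)

lemma exists_subsequence_le:
  fixes a d :: "nat \<Rightarrow> real"
  assumes "a \<longlonglongrightarrow> 0" "\<And>k. 0 < d k"
  obtains r where "strict_mono r" "\<And>k. a (r k) \<le> d k"
proof -
  have ev: "\<exists>N. \<forall>n\<ge>N. a n \<le> d k" for k
    using order_tendstoD(2)[OF assms(1) assms(2)[of k]]
    by (auto simp: eventually_sequentially intro: less_imp_le)
  have "\<exists>r. \<forall>k. a (r k) \<le> d k \<and> r k < r (Suc k)"
  proof (rule dependent_nat_choice)
    show "\<exists>n. a n \<le> d 0" using ev[of 0] by blast
  next
    fix n k
    obtain N where "\<forall>n\<ge>N. a n \<le> d (Suc k)" using ev by blast
    then show "\<exists>y. a y \<le> d (Suc k) \<and> n < y"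
      by (intro exI[of _ "max N (Suc n)"]) auto
  qed
  then show ?thesis
    using that by (auto simp: strict_mono_Suc_iff)
qed

text \<open>Besides a.e. convergence of a subsequence this records its rate in a function
  \<open>H\<close>, so that the rate can later be integrated along curves.\<close>

lemma Lp_geometric_subsequence:
  assumes "1 < p" "\<And>n. in_Lp M p (u n)" "in_Lp M p w"
    and "(\<lambda>n. Lp_energy M p (\<lambda>x. u n x - w x)) \<longlonglongrightarrow> 0"
  obtains r H where "strict_mono r" "H \<in> borel_measurable M"
    "(\<integral>\<^sup>+ x. ennreal_powr (H x) p \<partial>M) < \<infinity>"
    "\<And>k x. ennreal (2 ^ k) * ennreal \<bar>u (r k) x - w x\<bar> \<le> H x"
proof -
  obtain r where r: "strict_mono r"
    "\<And>k. Lp_energy M p (\<lambda>x. u (r k) x - w x) \<le> geometric_tolerance p k"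
    using exists_subsequence_le[where d = "geometric_tolerance p", OF assms(4) geometric_tolerance_pos]
    by blast
  have [measurable]: "u n \<in> borel_measurable M" "w \<in> borel_measurable M" for n
    using assms by (auto intro: in_Lp_measurable)
  define H where "H = (\<lambda>x. SUP k. ennreal (2 ^ k) * ennreal \<bar>u (r k) x - w x\<bar>)"
  show ?thesis
  proof (rule that[of r H])
    show "H \<in> borel_measurable M"
      unfolding H_def by measurable
    show "(\<integral>\<^sup>+ x. ennreal_powr (H x) p \<partial>M) < \<infinity>"
      unfolding H_def
    proof (rule nn_integral_weighted_SUP_le)
      show "(\<integral>\<^sup>+ x. ennreal_powr (ennreal \<bar>u (r k) x - w x\<bar>) p \<partial>M) \<le> ennreal (geometric_tolerance p k)" for k
        using r(2)[of k] assms by (subst nn_integral_ennreal_powr_abs) (auto intro: in_Lp_diff ennreal_leI)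
    qed (use assms in auto)
    show "ennreal (2 ^ k) * ennreal \<bar>u (r k) x - w x\<bar> \<le> H x" for k x
      unfolding H_def by (rule SUP_upper) simp
  qed (rule r)
qed

lemma tendsto_0_of_geometric_bound:
  fixes d :: "nat \<Rightarrow> real" and h :: ennreal
  assumes "h < \<infinity>" "\<And>k. ennreal (2 ^ k) * ennreal \<bar>d k\<bar> \<le> h"
  shows "d \<longlonglongrightarrow> 0" "summable d"
proof -
  obtain c where c: "h = ennreal c" "0 \<le> c"
    using assms(1) by (cases h) auto
  have "norm (d k) \<le> c * (1 / 2) ^ k" for k
  proof -
    have "ennreal (2 ^ k * \<bar>d k\<bar>) \<le> ennreal c"
      using assms(2)[of k] c by (simp add: ennreal_mult)
    then have "2 ^ k * \<bar>d k\<bar> \<le> c" using c by simp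
    then show ?thesis by (simp add: field_simps power_one_over)
  qed
  then have le: "\<forall>k\<ge>0. norm (d k) \<le> c * (1 / 2) ^ k" by blast
  have "summable (\<lambda>k. c * (1 / 2) ^ k)"
    by (intro summable_mult summable_geometric) simp
  then show "summable d"
    using le by (meson summable_comparison_test)
  then show "d \<longlonglongrightarrow> 0" by (rule summable_LIMSEQ_zero)
qed

lemma Lp_complete:
  assumes p: "1 < p" and u: "\<And>n. in_Lp M p (u n)"
    and cauchy: "\<And>e. 0 < e \<Longrightarrow> \<exists>N. \<forall>m\<ge>N. \<forall>n\<ge>N. Lp_energy M p (\<lambda>x. u m x - u n x) \<le> e"
  obtains w where "in_Lp M p w" "(\<lambda>n. Lp_energy M p (\<lambda>x. u n x - w x)) \<longlonglongrightarrow> 0"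
proof -
  have meas [measurable]: "u n \<in> borel_measurable M" for n
    using u by (auto intro: in_Lp_measurable)
  have "\<exists>r. \<forall>k. (\<forall>m\<ge>r k. \<forall>n\<ge>r k. Lp_energy M p (\<lambda>x. u m x - u n x) \<le> geometric_tolerance p k) \<and> r k < r (Suc k)"
  proof (rule dependent_nat_choice)
    show "\<exists>r. \<forall>m\<ge>r. \<forall>n\<ge>r. Lp_energy M p (\<lambda>x. u m x - u n x) \<le> geometric_tolerance p 0"
      using cauchy[OF geometric_tolerance_pos[of p 0]] .
  next
    fix r k
    obtain N where "\<forall>m\<ge>N. \<forall>n\<ge>N. Lp_energy M p (\<lambda>x. u m x - u n x) \<le> geometric_tolerance p (Suc k)"
      using cauchy[OF geometric_tolerance_pos[of p "Suc k"]] by blast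
    then show "\<exists>y. (\<forall>m\<ge>y. \<forall>n\<ge>y. Lp_energy M p (\<lambda>x. u m x - u n x) \<le> geometric_tolerance p (Suc k)) \<and> r < y"
      by (intro exI[of _ "max N (Suc r)"]) auto
  qed
  then obtain r where r: "\<And>k m n. r k \<le> m \<Longrightarrow> r k \<le> n \<Longrightarrow> Lp_energy M p (\<lambda>x. u m x - u n x) \<le> geometric_tolerance p k"
    and r_less: "\<And>k. r k < r (Suc k)"
    by blast
  have r_mono: "strict_mono r" using r_less by (simp add: strict_mono_Suc_iff)
  define d where "d = (\<lambda>k x. u (r (Suc k)) x - u (r k) x)"
  define H where "H = (\<lambda>x. SUP k. ennreal (2 ^ k) * ennreal \<bar>d k x\<bar>)"
  have [measurable]: "H \<in> borel_measurable M" "d k \<in> borel_measurable M" for k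
    unfolding H_def d_def by measurable
  have "(\<integral>\<^sup>+ x. ennreal_powr (H x) p \<partial>M) < \<infinity>"
    unfolding H_def
  proof (rule nn_integral_weighted_SUP_le)
    show "(\<integral>\<^sup>+ x. ennreal_powr (ennreal \<bar>d k x\<bar>) p \<partial>M) \<le> ennreal (geometric_tolerance p k)" for k
      unfolding d_def using r[of k "r (Suc k)" "r k"] r_less[of k]
      by (subst nn_integral_ennreal_powr_abs) (auto intro!: in_Lp_diff ennreal_leI u p)
  qed (use p in auto)
  then have "AE x in M. H x < \<infinity>"
    by (intro AE_finite_of_nn_integral_ennreal_powr) auto
  moreover have "convergent (\<lambda>k. u (r k) x)" if "H x < \<infinity>" for x
  proof -
    have "ennreal (2 ^ k) * ennreal \<bar>d k x\<bar> \<le> H x" for k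
      unfolding H_def by (rule SUP_upper) simp
    then have "summable (\<lambda>k. d k x)"
      using that by (intro tendsto_0_of_geometric_bound(2)) auto
    then have "(\<lambda>n. \<Sum>k<n. d k x) \<longlonglongrightarrow> (\<Sum>k. d k x)"
      by (rule summable_LIMSEQ)
    moreover have "(\<Sum>k<n. d k x) = u (r n) x - u (r 0) x" for n
      unfolding d_def by (rule sum_lessThan_telescope)
    ultimately have "(\<lambda>n. (u (r n) x - u (r 0) x) + u (r 0) x) \<longlonglongrightarrow> (\<Sum>k. d k x) + u (r 0) x"
      by (intro tendsto_add tendsto_const) simp
    then show ?thesis by (auto simp: convergent_def)
  qed
  ultimately have conv: "AE x in M. convergent (\<lambda>k. u (r k) x)"
    by auto
  \<comment> \<open>Where the subsequence diverges, \<open>lim\<close> is an unspecified value; this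
    concerns a null set only.\<close>
  define w where "w = (\<lambda>x. lim (\<lambda>k. u (r k) x))"
  have [measurable]: "w \<in> borel_measurable M"
    unfolding w_def by measurable
  \<comment> \<open>Stated for \<open>nn_integral\<close>, since membership of
    \<open>u n - w\<close> in L^p is only a consequence.\<close>
  have fatou: "(\<integral>\<^sup>+ x. ennreal (\<bar>u n x - w x\<bar> powr p) \<partial>M) \<le> ennreal e"
    if N: "\<And>m. N \<le> m \<Longrightarrow> Lp_energy M p (\<lambda>x. u n x - u m x) \<le> e" for n N e
  proof -
    have "(\<integral>\<^sup>+ x. ennreal (\<bar>u n x - w x\<bar> powr p) \<partial>M)
        = (\<integral>\<^sup>+ x. liminf (\<lambda>k. ennreal (\<bar>u n x - u (r k) x\<bar> powr p)) \<partial>M)"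
    proof (rule nn_integral_cong_AE, use conv in eventually_elim)
      fix x assume "convergent (\<lambda>k. u (r k) x)"
      then have "(\<lambda>k. u (r k) x) \<longlonglongrightarrow> w x"
        by (simp add: w_def convergent_LIMSEQ_iff)
      then have "(\<lambda>k. ennreal (\<bar>u n x - u (r k) x\<bar> powr p)) \<longlonglongrightarrow> ennreal (\<bar>u n x - w x\<bar> powr p)"
        using p by (intro tendsto_ennrealI tendsto_powr' tendsto_intros) auto
      then show "ennreal (\<bar>u n x - w x\<bar> powr p) = liminf (\<lambda>k. ennreal (\<bar>u n x - u (r k) x\<bar> powr p))"
        by (intro lim_imp_Liminf[symmetric]) auto
    qed
    also have "\<dots> \<le> liminf (\<lambda>k. \<integral>\<^sup>+ x. ennreal (\<bar>u n x - u (r k) x\<bar> powr p) \<partial>M)"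
      by (rule nn_integral_liminf) measurable
    also have "\<dots> \<le> ennreal e"
    proof (rule Liminf_le)
      have "(\<integral>\<^sup>+ x. ennreal (\<bar>u n x - u (r k) x\<bar> powr p) \<partial>M) \<le> ennreal e" if "N \<le> k" for k
        using N[of "r k"] that seq_suble[OF r_mono, of k]
        by (subst nn_integral_Lp_energy) (auto intro!: in_Lp_diff u p ennreal_leI)
      then show "\<forall>\<^sub>F k in sequentially. (\<integral>\<^sup>+ x. ennreal (\<bar>u n x - u (r k) x\<bar> powr p) \<partial>M) \<le> ennreal e"
        by (auto simp: eventually_sequentially)
    qed simp
    finally show ?thesis .
  qed
  have diff: "\<exists>N. \<forall>n\<ge>N. in_Lp M p (\<lambda>x. u n x - w x) \<and> Lp_energy M p (\<lambda>x. u n x - w x) \<le> e" if e: "0 < e" for e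
  proof -
    obtain N where N: "\<forall>m\<ge>N. \<forall>n\<ge>N. Lp_energy M p (\<lambda>x. u m x - u n x) \<le> e"
      using cauchy[OF e] by blast
    have "in_Lp M p (\<lambda>x. u n x - w x) \<and> Lp_energy M p (\<lambda>x. u n x - w x) \<le> e" if "N \<le> n" for n
    proof -
      have le: "(\<integral>\<^sup>+ x. ennreal (\<bar>u n x - w x\<bar> powr p) \<partial>M) \<le> ennreal e"
        using N that by (intro fatou) auto
      then have "in_Lp M p (\<lambda>x. u n x - w x)"
        unfolding in_Lp_def by (auto intro: le_less_trans)
      then show ?thesis
        using le e by (simp add: nn_integral_Lp_energy)
    qed
    then show ?thesis by blast
  qed
  \<comment> \<open>\<open>w\<close> is recovered as the difference of \<open>u N\<close> and
    \<open>u N - w\<close>.\<close>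
  obtain N where "in_Lp M p (\<lambda>x. u N x - w x)"
    using diff[of 1] by auto
  then have "in_Lp M p w"
    using in_Lp_diff[OF p u[of N], of "\<lambda>x. u N x - w x"] by simp
  moreover have "(\<lambda>n. Lp_energy M p (\<lambda>x. u n x - w x)) \<longlonglongrightarrow> 0"
  proof (rule LIMSEQ_I)
    fix e :: real assume "0 < e"
    then obtain N where "\<forall>n\<ge>N. Lp_energy M p (\<lambda>x. u n x - w x) \<le> e / 2"
      using diff[of "e / 2"] by auto
    then show "\<exists>N. \<forall>n\<ge>N. norm (Lp_energy M p (\<lambda>x. u n x - w x) - 0) < e"
      using \<open>0 < e\<close> by (intro exI[of _ N]) (auto intro: le_less_trans)
  qed
  ultimately show ?thesis by (rule that)
qed

section \<open>Nearest points and duality in \<open>L\<^sup>p\<close>\<close>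

lemma Lp_energy_uniformly_convex:
  assumes "1 < p" "0 < e"
  obtains K where "0 \<le> K"
    "\<And>u v. in_Lp M p u \<Longrightarrow> in_Lp M p v \<Longrightarrow>
       Lp_energy M p (\<lambda>x. u x - v x) \<le> e * (Lp_energy M p u + Lp_energy M p v)
         + K * ((Lp_energy M p u + Lp_energy M p v) / 2 - Lp_energy M p (\<lambda>x. (u x + v x) / 2))"
proof -
  obtain K where K: "0 \<le> K" "\<And>a b :: real. \<bar>a - b\<bar> powr p \<le> e * (\<bar>a\<bar> powr p + \<bar>b\<bar> powr p)
      + K * ((\<bar>a\<bar> powr p + \<bar>b\<bar> powr p) / 2 - \<bar>(a + b) / 2\<bar> powr p)"
    using powr_uniformly_convex[OF assms] by blast
  show ?thesis
  proof (rule that[OF K(1)])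
    fix u v assume u: "in_Lp M p u" and v: "in_Lp M p v"
    have mid: "in_Lp M p (\<lambda>x. (u x + v x) / 2)"
      using in_Lp_lincomb[OF assms(1) u v, of "1 / 2" "1 / 2"] by (simp add: add_divide_distrib)
    note int = in_Lp_integrable[OF u] in_Lp_integrable[OF v] in_Lp_integrable[OF mid]
    have "Lp_energy M p (\<lambda>x. u x - v x)
        \<le> (\<integral>x. e * (\<bar>u x\<bar> powr p + \<bar>v x\<bar> powr p)
          + K * ((\<bar>u x\<bar> powr p + \<bar>v x\<bar> powr p) / 2 - \<bar>(u x + v x) / 2\<bar> powr p) \<partial>M)"
      unfolding Lp_energy_def
      by (intro integral_mono K Bochner_Integration.integrable_add Bochner_Integration.integrable_diff
          integrable_mult_right integrable_divide int in_Lp_integrable in_Lp_diff assms u v)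
    also have "\<dots> = e * (Lp_energy M p u + Lp_energy M p v)
         + K * ((Lp_energy M p u + Lp_energy M p v) / 2 - Lp_energy M p (\<lambda>x. (u x + v x) / 2))"
      unfolding Lp_energy_def using int by simp
    finally show "Lp_energy M p (\<lambda>x. u x - v x) \<le> e * (Lp_energy M p u + Lp_energy M p v)
         + K * ((Lp_energy M p u + Lp_energy M p v) / 2 - Lp_energy M p (\<lambda>x. (u x + v x) / 2))" .
  qed
qed

definition fun_convex :: "('a \<Rightarrow> real) set \<Rightarrow> bool" where
  "fun_convex C \<longleftrightarrow>
     (\<forall>u\<in>C. \<forall>v\<in>C. \<forall>t. 0 \<le> t \<and> t \<le> 1 \<longrightarrow> (\<lambda>x. (1 - t) * u x + t * v x) \<in> C)"

lemma fun_convexI: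
  assumes "\<And>u v t. u \<in> C \<Longrightarrow> v \<in> C \<Longrightarrow> 0 \<le> t \<Longrightarrow> t \<le> 1 \<Longrightarrow> (\<lambda>x. (1 - t) * u x + t * v x) \<in> C"
  shows "fun_convex C"
  using assms by (simp add: fun_convex_def)

lemma fun_convexD:
  "fun_convex C \<Longrightarrow> u \<in> C \<Longrightarrow> v \<in> C \<Longrightarrow> 0 \<le> t \<Longrightarrow> t \<le> 1 \<Longrightarrow> (\<lambda>x. (1 - t) * u x + t * v x) \<in> C"
  by (simp add: fun_convex_def)

text \<open>Sets of functions, not of classes: applied to constant sequences, closedness includes
  stability under changes on null sets within L^p.\<close>

definition Lp_closed :: "'a measure \<Rightarrow> real \<Rightarrow> ('a \<Rightarrow> real) set \<Rightarrow> bool" where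
  "Lp_closed M p C \<longleftrightarrow> (\<forall>u w. (\<forall>n. u n \<in> C) \<and> in_Lp M p w
      \<and> (\<lambda>n. Lp_energy M p (\<lambda>x. u n x - w x)) \<longlonglongrightarrow> 0 \<longrightarrow> w \<in> C)"

lemma Lp_closedI:
  assumes "\<And>u w. (\<And>n. u n \<in> C) \<Longrightarrow> in_Lp M p w \<Longrightarrow>
    (\<lambda>n. Lp_energy M p (\<lambda>x. u n x - w x)) \<longlonglongrightarrow> 0 \<Longrightarrow> w \<in> C"
  shows "Lp_closed M p C"
  using assms by (auto simp: Lp_closed_def)

lemma Lp_closedD:
  "Lp_closed M p C \<Longrightarrow> (\<And>n. u n \<in> C) \<Longrightarrow> in_Lp M p w \<Longrightarrow>
    (\<lambda>n. Lp_energy M p (\<lambda>x. u n x - w x)) \<longlonglongrightarrow> 0 \<Longrightarrow> w \<in> C"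
  unfolding Lp_closed_def by blast

text \<open>By uniform convexity, almost minimizers of the energy in a decreasing sequence of convex sets
  form a Cauchy sequence. This replaces weak compactness of bounded sets followed by Mazur's lemma.\<close>

lemma Lp_nested_convex_limit:
  fixes C :: "nat \<Rightarrow> ('a \<Rightarrow> real) set"
  assumes p: "1 < p" and Lp: "\<And>k u. u \<in> C k \<Longrightarrow> in_Lp M p u"
    and conv: "\<And>k. fun_convex (C k)" and dec: "\<And>j k. j \<le> k \<Longrightarrow> C k \<subseteq> C j"
    and bounded: "\<And>k. \<exists>u\<in>C k. Lp_energy M p u \<le> B"
  obtains u w where "\<And>k. u k \<in> C k" "in_Lp M p w"
    "(\<lambda>k. Lp_energy M p (\<lambda>x. u k x - w x)) \<longlonglongrightarrow> 0"
    "\<And>b. (\<And>k. \<exists>v\<in>C k. Lp_energy M p v \<le> b) \<Longrightarrow> Lp_energy M p w \<le> b"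
proof -
  \<comment> \<open>The sets shrink, so these infima increase; being at most \<open>B\<close>, they
    converge.\<close>
  define d where "d = (\<lambda>k. INF u\<in>C k. Lp_energy M p u)"
  have bdd: "bdd_below (Lp_energy M p ` C k)" for k
    by (rule bdd_belowI2[of _ 0]) simp
  have ne: "C k \<noteq> {}" for k using bounded[of k] by blast
  have d_le: "d k \<le> Lp_energy M p u" if "u \<in> C k" for k u
    unfolding d_def by (rule cINF_lower[OF bdd that])
  have d_le_b: "d k \<le> b" if "\<exists>v\<in>C k. Lp_energy M p v \<le> b" for k b
    using that d_le order_trans by blast
  have "incseq d"
    unfolding d_def by (intro monoI cINF_superset_mono ne bdd dec) auto
  then obtain D where D: "d \<longlonglongrightarrow> D" "\<And>k. d k \<le> D"
    using incseq_convergent[of d B] d_le_b[OF bounded] by blast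
  have "\<exists>u\<in>C k. Lp_energy M p u < d k + 1 / real (Suc k)" for k
    using cINF_less_iff[OF ne bdd, of k "d k + 1 / real (Suc k)"] by (simp add: d_def)
  then obtain u where u: "\<And>k. u k \<in> C k" and near: "\<And>k. Lp_energy M p (u k) < d k + 1 / real (Suc k)"
    by metis
  have uLp: "in_Lp M p (u k)" for k using Lp[OF u] .
  have E_le: "Lp_energy M p (u m) \<le> D + 1 / real (Suc N)" if "N \<le> m" for m N
  proof -
    have "1 / real (Suc m) \<le> 1 / real (Suc N)"
      using that by (intro divide_left_mono) auto
    then show ?thesis
      using near[of m] D(2)[of m] by linarith
  qed
  have "0 \<le> D"
    using E_le[of _ _] by (intro LIMSEQ_le_const[OF D(1)])
      (auto simp: d_def intro!: exI[of _ 0] cINF_greatest ne)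
  have cauchy: "\<exists>N. \<forall>m\<ge>N. \<forall>n\<ge>N. Lp_energy M p (\<lambda>x. u m x - u n x) \<le> e" if e: "0 < e" for e
  proof -
    \<comment> \<open>Energies along the sequence are at most \<open>D + 1\<close>, so this choice
      makes the first term of uniform convexity at most \<open>e / 2\<close>.\<close>
    define e' where "e' = e / (4 * (D + 1))"
    have e': "0 < e'" "e' * (2 * (D + 1)) = e / 2"
      using e \<open>0 \<le> D\<close> by (auto simp: e'_def field_simps)
    obtain K where K: "0 \<le> K"
      "\<And>u v. in_Lp M p u \<Longrightarrow> in_Lp M p v \<Longrightarrow>
         Lp_energy M p (\<lambda>x. u x - v x) \<le> e' * (Lp_energy M p u + Lp_energy M p v)
           + K * ((Lp_energy M p u + Lp_energy M p v) / 2 - Lp_energy M p (\<lambda>x. (u x + v x) / 2))"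
      using Lp_energy_uniformly_convex[OF p e'(1)] by blast
    have "(\<lambda>N. K * (D + 1 / real (Suc N) - d N)) \<longlonglongrightarrow> K * (D + 0 - D)"
      by (intro tendsto_intros D(1) LIMSEQ_Suc[OF lim_1_over_n])
    then have "\<forall>\<^sub>F N in sequentially. K * (D + 1 / real (Suc N) - d N) < e / 2"
      using e by (intro order_tendstoD(2)[of _ 0]) auto
    then obtain N where N: "K * (D + 1 / real (Suc N) - d N) < e / 2"
      by (auto simp: eventually_sequentially)
    have "Lp_energy M p (\<lambda>x. u m x - u n x) \<le> e" if mn: "N \<le> m" "N \<le> n" for m n
    proof -
      \<comment> \<open>The midpoint stays in \<open>C N\<close>, so its energy is at least
        \<open>d N\<close>, while both ends have energy near \<open>D\<close>: the convexity defect
        is small.\<close>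
      have "(\<lambda>x. (1 - 1 / 2) * u m x + 1 / 2 * u n x) \<in> C N"
        using u[of m] u[of n] dec[OF mn(1)] dec[OF mn(2)] by (intro fun_convexD conv) auto
      then have "d N \<le> Lp_energy M p (\<lambda>x. (u m x + u n x) / 2)"
        using d_le[of "\<lambda>x. (1 - 1 / 2) * u m x + 1 / 2 * u n x" N] by (simp add: add_divide_distrib)
      moreover have "(Lp_energy M p (u m) + Lp_energy M p (u n)) / 2 \<le> D + 1 / real (Suc N)"
      proof -
        have "(x + y) / 2 \<le> z" if "x \<le> z" "y \<le> z" for x y z :: real
          using that by simp
        then show ?thesis using E_le[OF mn(1)] E_le[OF mn(2)] by blast
      qed
      ultimately have "K * ((Lp_energy M p (u m) + Lp_energy M p (u n)) / 2
          - Lp_energy M p (\<lambda>x. (u m x + u n x) / 2)) \<le> K * (D + 1 / real (Suc N) - d N)"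
        by (intro mult_left_mono K(1) diff_mono)
      moreover have "e' * (Lp_energy M p (u m) + Lp_energy M p (u n)) \<le> e' * (2 * (D + 1))"
        using E_le[of 0 m] E_le[of 0 n] e'(1) by (intro mult_left_mono) auto
      ultimately show ?thesis
        using K(2)[OF uLp[of m] uLp[of n]] N e'(2) by linarith
    qed
    then show ?thesis by blast
  qed
  obtain w where w: "in_Lp M p w" "(\<lambda>k. Lp_energy M p (\<lambda>x. u k x - w x)) \<longlonglongrightarrow> 0"
    using Lp_complete[OF p, of M u] uLp cauchy by blast
  show ?thesis
  proof (rule that[OF u w])
    fix b assume b: "\<And>k. \<exists>v\<in>C k. Lp_energy M p v \<le> b"
    have "Lp_energy M p (u k) \<le> b + 1 / real (Suc k)" for k
      using near[of k] d_le_b[OF b] by (smt (verit))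
    moreover have "(\<lambda>k. b + 1 / real (Suc k)) \<longlonglongrightarrow> b + 0"
      by (intro tendsto_intros LIMSEQ_Suc[OF lim_1_over_n])
    ultimately show "Lp_energy M p w \<le> b"
      using Lp_energy_lower_semicontinuous[OF p uLp w] by simp
  qed
qed

text \<open>The derivative of the energy at \<open>w\<close> towards \<open>v\<close> is
  nonnegative. Instead of differentiating under the integral, take tangents at points
  \<open>c n\<close> of the segment; comparison with the minimizer \<open>w\<close> gives the sign
  there, and \<open>c n\<close> then tends to \<open>w\<close>.\<close>

lemma Lp_minimizer_variational:
  assumes p: "1 < p" and Lp: "\<And>u. u \<in> C \<Longrightarrow> in_Lp M p u" and conv: "fun_convex C"
    and w: "w \<in> C" "\<And>u. u \<in> C \<Longrightarrow> Lp_energy M p w \<le> Lp_energy M p u" and v: "v \<in> C"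
  shows "0 \<le> (\<integral>x. (v x - w x) * sgn_powr p (w x) \<partial>M)"
proof -
  define t where "t = (\<lambda>n. 1 / real (Suc n))"
  have t: "0 < t n" "t n \<le> 1" for n by (auto simp: t_def)
  have t0: "t \<longlonglongrightarrow> 0" unfolding t_def by (intro LIMSEQ_Suc[OF lim_1_over_n])
  define c where "c = (\<lambda>n x. (1 - t n) * w x + t n * v x)"
  have c: "c n \<in> C" for n
    unfolding c_def using t[of n] by (intro fun_convexD[OF conv] w v) auto
  have wL: "in_Lp M p w" and vL: "in_Lp M p v" and cL: "in_Lp M p (c n)" for n
    using Lp w v c by auto
  have [measurable]: "w \<in> borel_measurable M" "v \<in> borel_measurable M" "c n \<in> borel_measurable M" for n
    using wL vL cL by (auto dest: in_Lp_measurable)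
  have pos: "0 \<le> (\<integral>x. (v x - w x) * sgn_powr p (c n x) \<partial>M)" for n
  proof -
    have "Lp_energy M p (c n) + p * (\<integral>x. (w x - c n x) * sgn_powr p (c n x) \<partial>M) \<le> Lp_energy M p (c n)"
      using Lp_energy_tangent[OF p cL wL, of n] w(2)[OF c[of n]] by linarith
    moreover have "(\<integral>x. (w x - c n x) * sgn_powr p (c n x) \<partial>M)
        = (\<integral>x. - t n * ((v x - w x) * sgn_powr p (c n x)) \<partial>M)"
      by (rule Bochner_Integration.integral_cong) (auto simp: c_def algebra_simps)
    ultimately have "p * (t n * (\<integral>x. (v x - w x) * sgn_powr p (c n x) \<partial>M)) \<ge> 0"
      by simp
    then show ?thesis using p t(1)[of n] by (simp add: zero_le_mult_iff)
  qed
  \<comment> \<open>It dominates every \<open>c n\<close> in absolute value, and its image under the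
    duality map lies in L^q, so the majorant is integrable by Hoelder.\<close>
  let ?h = "\<lambda>x. \<bar>w x\<bar> + \<bar>v x\<bar>"
  have h: "in_Lp M p ?h"
    by (intro in_Lp_add in_Lp_abs p wL vL)
  have "(\<lambda>n. \<integral>x. (v x - w x) * sgn_powr p (c n x) \<partial>M) \<longlonglongrightarrow> (\<integral>x. (v x - w x) * sgn_powr p (w x) \<partial>M)"
  proof (rule integral_dominated_convergence)
    have "integrable M (\<lambda>x. (v x - w x) * sgn_powr p (?h x))"
      by (intro Holder_inequality(1)[OF p] in_Lp_diff in_Lp_sgn_powr p vL wL h)
    then show "integrable M (\<lambda>x. \<bar>(v x - w x) * sgn_powr p (?h x)\<bar>)" by simp
    show "AE x in M. (\<lambda>n. (v x - w x) * sgn_powr p (c n x)) \<longlonglongrightarrow> (v x - w x) * sgn_powr p (w x)"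
    proof (rule AE_I2)
      fix x
      have "(\<lambda>n. c n x) \<longlonglongrightarrow> (1 - 0) * w x + 0 * v x"
        unfolding c_def by (intro tendsto_intros t0)
      then have "(\<lambda>n. sgn_powr p (c n x)) \<longlonglongrightarrow> sgn_powr p (w x)"
        by (intro isCont_tendsto_compose[OF continuous_sgn_powr[OF p]]) simp
      then show "(\<lambda>n. (v x - w x) * sgn_powr p (c n x)) \<longlonglongrightarrow> (v x - w x) * sgn_powr p (w x)"
        by (intro tendsto_intros)
    qed
    show "AE x in M. norm ((v x - w x) * sgn_powr p (c n x)) \<le> \<bar>(v x - w x) * sgn_powr p (?h x)\<bar>" for n
    proof (rule AE_I2)
      fix x
      have "\<bar>c n x\<bar> \<le> (1 - t n) * \<bar>w x\<bar> + t n * \<bar>v x\<bar>"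
        unfolding c_def using t[of n] abs_triangle_ineq[of "(1 - t n) * w x" "t n * v x"]
        by (simp add: abs_mult)
      also have "\<dots> \<le> 1 * \<bar>w x\<bar> + 1 * \<bar>v x\<bar>"
        using t[of n] by (intro add_mono mult_right_mono) auto
      finally have "\<bar>sgn_powr p (c n x)\<bar> \<le> \<bar>sgn_powr p (?h x)\<bar>"
        unfolding abs_sgn_powr using p by (intro powr_mono2) auto
      then show "norm ((v x - w x) * sgn_powr p (c n x)) \<le> \<bar>(v x - w x) * sgn_powr p (?h x)\<bar>"
        by (simp add: abs_mult mult_left_mono)
    qed
  qed measurable
  then show ?thesis
    using pos by (intro LIMSEQ_le_const) auto
qed

text \<open>The point of \<open>C\<close> nearest to the origin, from
  \<open>Lp_nested_convex_limit\<close> with a constant sequence of sets; closedness keeps the limit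
  in \<open>C\<close>.\<close>

lemma Lp_projection:
  assumes p: "1 < p" and ne: "C \<noteq> {}" and Lp: "\<And>u. u \<in> C \<Longrightarrow> in_Lp M p u"
    and conv: "fun_convex C" and closed: "Lp_closed M p C"
  obtains w where "w \<in> C" "\<And>v. v \<in> C \<Longrightarrow> 0 \<le> (\<integral>x. (v x - w x) * sgn_powr p (w x) \<partial>M)"
proof -
  obtain u0 where u0: "u0 \<in> C" using ne by blast
  obtain u w where u: "\<And>k::nat. u k \<in> C" "in_Lp M p w"
    "(\<lambda>k. Lp_energy M p (\<lambda>x. u k x - w x)) \<longlonglongrightarrow> 0"
    "\<And>b. (\<And>k::nat. \<exists>v\<in>C. Lp_energy M p v \<le> b) \<Longrightarrow> Lp_energy M p w \<le> b"
    using Lp_nested_convex_limit[OF p, of "\<lambda>_. C" M "Lp_energy M p u0"] Lp conv u0 by blast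
  have w: "w \<in> C" using Lp_closedD[OF closed u(1-3)] .
  have "Lp_energy M p w \<le> Lp_energy M p v" if "v \<in> C" for v
    using u(4) that by blast
  then show ?thesis
    using that[OF w] Lp_minimizer_variational[OF p Lp conv w] by blast
qed

text \<open>Let \<open>w\<close> have least norm where \<Phi> = 1. Its image \<open>s\<close> under
  the duality map annihilates the kernel of \<Phi>, hence is proportional to \<Phi>; testing with
  \<open>w\<close> gives the factor.\<close>

theorem Lp_Riesz_representation:
  assumes p: "1 < p"
    and lin: "\<And>f g a b. in_Lp M p f \<Longrightarrow> in_Lp M p g \<Longrightarrow> \<Phi> (\<lambda>x. a * f x + b * g x) = a * \<Phi> f + b * \<Phi> g"
    and bound: "\<And>f. in_Lp M p f \<Longrightarrow> \<bar>\<Phi> f\<bar> \<le> C * Lp_norm M p f"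
  obtains h where "in_Lp M (conj_exp p) h" "\<And>g. in_Lp M p g \<Longrightarrow> \<Phi> g = (\<integral>x. g x * h x \<partial>M)"
proof (cases "\<forall>g. in_Lp M p g \<longrightarrow> \<Phi> g = 0")
  case True
  then show ?thesis using that[of "\<lambda>_. 0"] by simp
next
  case False
  then obtain g1 where g1: "in_Lp M p g1" "\<Phi> g1 \<noteq> 0" by blast
  define A where "A = {g. in_Lp M p g \<and> \<Phi> g = 1}"
  have diff: "\<Phi> (\<lambda>x. f x - g x) = \<Phi> f - \<Phi> g" if "in_Lp M p f" "in_Lp M p g" for f g
    using lin[OF that, of 1 "-1"] by simp
  \<comment> \<open>A scaling written as a two-term combination, the form that \<open>lin\<close>
    covers.\<close>
  have "(\<lambda>x. (1 / \<Phi> g1) * g1 x + 0 * g1 x) \<in> A"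
    unfolding A_def using g1 lin[OF g1(1) g1(1), of "1 / \<Phi> g1" 0]
      in_Lp_lincomb[OF p g1(1) g1(1), of "1 / \<Phi> g1" 0] by simp
  then have ne: "A \<noteq> {}" by blast
  have conv: "fun_convex A"
    by (rule fun_convexI) (auto simp: A_def lin intro!: in_Lp_lincomb p)
  have closed: "Lp_closed M p A"
  proof (rule Lp_closedI)
    fix u w assume u: "\<And>n. u n \<in> A" and w: "in_Lp M p w"
      and lim: "(\<lambda>n. Lp_energy M p (\<lambda>x. u n x - w x)) \<longlonglongrightarrow> 0"
    have uL: "in_Lp M p (u n)" "\<Phi> (u n) = 1" for n using u by (auto simp: A_def)
    have "(\<lambda>n. C * Lp_norm M p (\<lambda>x. u n x - w x)) \<longlonglongrightarrow> C * 0"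
      using lim Lp_norm_tendsto_0_iff[OF p, of M "\<lambda>n x. u n x - w x"] in_Lp_diff[OF p uL(1) w]
      by (intro tendsto_intros) auto
    moreover have "\<bar>1 - \<Phi> w\<bar> \<le> C * Lp_norm M p (\<lambda>x. u n x - w x)" for n
      using bound[OF in_Lp_diff[OF p uL(1) w], of n] diff[OF uL(1) w, of n] uL(2)[of n] by simp
    ultimately have "\<bar>1 - \<Phi> w\<bar> \<le> C * 0"
      by (intro LIMSEQ_le_const[of _ "C * 0"]) auto
    then show "w \<in> A" using w by (simp add: A_def)
  qed
  obtain w where w: "w \<in> A" and var: "\<And>v. v \<in> A \<Longrightarrow> 0 \<le> (\<integral>x. (v x - w x) * sgn_powr p (w x) \<partial>M)"
    using Lp_projection[OF p ne _ conv closed] A_def by blast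
  have wL: "in_Lp M p w" and w1: "\<Phi> w = 1" using w by (auto simp: A_def)
  define s where "s = (\<lambda>x. sgn_powr p (w x))"
  have sL: "in_Lp M (conj_exp p) s" unfolding s_def by (rule in_Lp_sgn_powr[OF p wL])
  note int = Holder_inequality(1)[OF p _ sL]
  have ker: "(\<integral>x. k x * s x \<partial>M) = 0" if k: "in_Lp M p k" "\<Phi> k = 0" for k
  proof -
    \<comment> \<open>Adding any multiple of \<open>k\<close> to \<open>w\<close> stays in
      \<open>A\<close>, so the inequality holds for both signs.\<close>
    have "0 \<le> (\<integral>x. (c * k x) * s x \<partial>M)" for c
    proof -
      have "(\<lambda>x. 1 * w x + c * k x) \<in> A"
        unfolding A_def using lin[OF wL k(1), of 1 c] w1 k in_Lp_lincomb[OF p wL k(1), of 1 c] by simp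
      from var[OF this] show ?thesis by (simp add: s_def)
    qed
    from this[of 1] this[of "-1"] show ?thesis by simp
  qed
  have rep: "(\<integral>x. g x * s x \<partial>M) = \<Phi> g * Lp_energy M p w" if g: "in_Lp M p g" for g
  proof -
    have "(\<integral>x. (1 * g x + - \<Phi> g * w x) * s x \<partial>M) = 0"
      using lin[OF g wL, of 1 "- \<Phi> g"] w1 by (intro ker in_Lp_lincomb p g wL) simp
    moreover have "(\<integral>x. (1 * g x + - \<Phi> g * w x) * s x \<partial>M)
        = (\<integral>x. g x * s x \<partial>M) - \<Phi> g * (\<integral>x. w x * s x \<partial>M)"
      using int[OF g] int[OF wL] by (simp add: algebra_simps)
    ultimately show ?thesis
      using integral_mult_sgn_powr[OF p, where u = w and M = M] by (simp add: s_def)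
  qed
  have "Lp_energy M p w \<noteq> 0"
  proof
    assume "Lp_energy M p w = 0"
    then have "Lp_norm M p w = 0" using p wL by (simp add: Lp_norm_eq)
    then show False using bound[OF wL] w1 by simp
  qed
  then show ?thesis
    using that[of "\<lambda>x. (1 / Lp_energy M p w) * s x"] in_Lp_cmult[OF sL, of "1 / Lp_energy M p w"] rep
    by simp
qed

section \<open>Curves and weak upper gradients\<close>

lemma curve_length_ge_dist:
  assumes "s \<le> t"
  shows "ennreal (dist (\<gamma> s) (\<gamma> t)) \<le> curve_length \<gamma> s t"
proof -
  have "(1, \<lambda>i. if i = 0 then s else t) \<in>
      {(n::nat, \<tau>::nat \<Rightarrow> real). \<tau> 0 = s \<and> \<tau> n = t \<and> (\<forall>i<n. \<tau> i \<le> \<tau> (Suc i))}"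
    using assms by simp
  then show ?thesis
    unfolding curve_length_def by (rule SUP_upper2) simp
qed

lemma arclength_curve_dist_le:
  assumes "arclength_curve \<gamma> l" "0 \<le> s" "s \<le> t" "t \<le> l"
  shows "dist (\<gamma> s) (\<gamma> t) \<le> t - s"
  using curve_length_ge_dist[OF assms(3), of \<gamma>] assms by (simp add: arclength_curve_def)

lemma arclength_curve_continuous_on:
  assumes "arclength_curve \<gamma> l"
  shows "continuous_on {0..l} \<gamma>"
proof (rule continuous_onI)
  fix s e :: real assume s: "s \<in> {0..l}" and e: "0 < e"
  have "dist (\<gamma> t) (\<gamma> s) \<le> e" if "t \<in> {0..l}" "dist t s < e" for t
    using arclength_curve_dist_le[OF assms, of s t] arclength_curve_dist_le[OF assms, of t s] s that
    by (cases "s \<le> t") (auto simp: dist_commute dist_real_def)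
  then show "\<exists>d>0. \<forall>t\<in>{0..l}. dist t s < d \<longrightarrow> dist (\<gamma> t) (\<gamma> s) \<le> e"
    using e by blast
qed

lemma arclength_curve_pos: "arclength_curve \<gamma> l \<Longrightarrow> 0 < l"
  by (simp add: arclength_curve_def)

text \<open>Nothing is known about \<open>\<gamma>\<close> outside {0..l}, hence the
  indicator.\<close>

lemma borel_measurable_along_curve:
  fixes \<rho> :: "'a::metric_space \<Rightarrow> ennreal"
  assumes "arclength_curve \<gamma> l" "\<rho> \<in> borel_measurable borel"
  shows "(\<lambda>t. \<rho> (\<gamma> t) * indicator {0..l} t) \<in> borel_measurable borel"
proof -
  have "\<gamma> \<in> borel_measurable (restrict_space borel {0..l})"
    by (intro borel_measurable_continuous_on_restrict arclength_curve_continuous_on assms)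
  then have "(\<lambda>t. \<rho> (\<gamma> t)) \<in> borel_measurable (restrict_space borel {0..l})"
    using assms(2) by (rule measurable_compose)
  then show ?thesis
    by (subst (asm) borel_measurable_restrict_space_iff_ennreal) auto
qed

lemma line_integral_mono:
  assumes "\<And>x. \<rho> x \<le> \<sigma> x"
  shows "line_integral \<rho> \<gamma> l \<le> line_integral \<sigma> \<gamma> l"
  unfolding line_integral_def by (intro nn_integral_mono mult_right_mono assms) auto

lemma line_integral_cmult:
  assumes "arclength_curve \<gamma> l" "\<rho> \<in> borel_measurable borel"
  shows "line_integral (\<lambda>x. c * \<rho> x) \<gamma> l = c * line_integral \<rho> \<gamma> l"
  unfolding line_integral_def
  using borel_measurable_along_curve[OF assms] by (simp add: nn_integral_cmult mult.assoc)

lemma line_integral_add: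
  assumes "arclength_curve \<gamma> l" "\<rho> \<in> borel_measurable borel" "\<sigma> \<in> borel_measurable borel"
  shows "line_integral (\<lambda>x. \<rho> x + \<sigma> x) \<gamma> l = line_integral \<rho> \<gamma> l + line_integral \<sigma> \<gamma> l"
  unfolding line_integral_def
  using borel_measurable_along_curve[OF assms(1)] assms
  by (subst nn_integral_add[symmetric]) (simp_all add: distrib_right)

section \<open>Subcurves and their line integrals\<close>

lemma curve_length_shift_le:
  "curve_length (\<lambda>r. \<gamma> (c + r)) a b \<le> curve_length \<gamma> (c + a) (c + b)"
  unfolding curve_length_def
proof (rule SUP_mono)
  fix z assume z: "z \<in> {(n::nat, \<tau>::nat \<Rightarrow> real). \<tau> 0 = a \<and> \<tau> n = b \<and> (\<forall>i<n. \<tau> i \<le> \<tau> (Suc i))}"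
  then show "\<exists>y\<in>{(n::nat, \<tau>::nat \<Rightarrow> real). \<tau> 0 = c + a \<and> \<tau> n = c + b \<and> (\<forall>i<n. \<tau> i \<le> \<tau> (Suc i))}.
      (\<Sum>i<fst z. ennreal (dist (\<gamma> (c + snd z i)) (\<gamma> (c + snd z (Suc i)))))
      \<le> (\<Sum>i<fst y. ennreal (dist (\<gamma> (snd y i)) (\<gamma> (snd y (Suc i)))))"
    by (intro bexI[of _ "(fst z, \<lambda>i. c + snd z i)"]) (auto simp: case_prod_unfold)
qed

text \<open>The reverse inequality is the same one for the shifted curve, translated back by
  \<open>- c\<close>.\<close>

lemma curve_length_shift:
  "curve_length (\<lambda>r. \<gamma> (c + r)) a b = curve_length \<gamma> (c + a) (c + b)"
  using curve_length_shift_le[of \<gamma> c a b]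
    curve_length_shift_le[of "\<lambda>r. \<gamma> (c + r)" "- c" "c + a" "c + b"]
  by (simp add: antisym)

lemma arclength_curve_subcurve:
  assumes "arclength_curve \<gamma> l" "0 \<le> s" "s < t" "t \<le> l"
  shows "arclength_curve (\<lambda>r. \<gamma> (s + r)) (t - s)"
  using assms unfolding arclength_curve_def curve_length_shift by auto

text \<open>With this, finiteness of a weight along a curve passes to subcurves, so gradient
  inequalities hold between any two points of a good curve.\<close>

lemma line_integral_subcurve_le:
  fixes \<rho> :: "'a::metric_space \<Rightarrow> ennreal"
  assumes "arclength_curve \<gamma> l" "\<rho> \<in> borel_measurable borel" "0 \<le> s" "s < t" "t \<le> l"
  shows "line_integral \<rho> (\<lambda>r. \<gamma> (s + r)) (t - s) \<le> line_integral \<rho> \<gamma> l"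
proof -
  define F where "F = (\<lambda>u. (\<rho> (\<gamma> u) * indicator {0..l} u) * indicator {s..t} u)"
  have [measurable]: "F \<in> borel_measurable borel"
    unfolding F_def by (intro borel_measurable_times_ennreal borel_measurable_along_curve assms) auto
  have "line_integral \<rho> (\<lambda>r. \<gamma> (s + r)) (t - s) = (\<integral>\<^sup>+ r. F (s + 1 * r) \<partial>lborel)"
    unfolding line_integral_def F_def using assms
    by (intro nn_integral_cong) (auto simp: indicator_def)
  also have "\<dots> = (\<integral>\<^sup>+ u. F u \<partial>lborel)"
    using nn_integral_real_affine[of F 1 s] by simp
  also have "\<dots> \<le> line_integral \<rho> \<gamma> l"
    unfolding line_integral_def F_def by (intro nn_integral_mono) (auto simp: indicator_def)
  finally show ?thesis .
qed

text \<open>Values in \<open>ennreal\<close> are essential: a weight equal to \<infinity> on a null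
  set excludes all curves that spend positive time there.\<close>

definition curve_weight :: "'a::metric_space measure \<Rightarrow> real \<Rightarrow> ('a \<Rightarrow> ennreal) \<Rightarrow> bool" where
  "curve_weight m p H \<longleftrightarrow> H \<in> borel_measurable borel \<and> (\<integral>\<^sup>+ x. ennreal_powr (H x) p \<partial>m) < \<infinity>"

lemma curve_weight_measurable: "curve_weight m p H \<Longrightarrow> H \<in> borel_measurable borel"
  by (simp add: curve_weight_def)

text \<open>Zero modulus supplies admissible functions of arbitrarily small energy. The supremum of
  2^k times the k-th one has finite energy, yet its integral along each curve of the family is at
  least 2^k for every k.\<close>

lemma exists_curve_weight_of_null_modulus:
  assumes m: "sets m = sets borel" and p: "1 < p" and null: "p_modulus m p \<Gamma> = 0"
  obtains H where "curve_weight m p H"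
    "\<And>\<gamma> l. (\<gamma>, l) \<in> \<Gamma> \<Longrightarrow> arclength_curve \<gamma> l \<Longrightarrow> line_integral H \<gamma> l = \<infinity>"
proof -
  have "\<forall>k. \<exists>\<rho>. \<rho> \<in> borel_measurable borel \<and> (\<forall>(\<gamma>, l) \<in> \<Gamma>. 1 \<le> line_integral \<rho> \<gamma> l)
      \<and> (\<integral>\<^sup>+ x. ennreal_powr (\<rho> x) p \<partial>m) < ennreal (geometric_tolerance p k)"
  proof
    fix k
    have "p_modulus m p \<Gamma> < ennreal (geometric_tolerance p k)"
      using null geometric_tolerance_pos[of p k] by simp
    then show "\<exists>\<rho>. \<rho> \<in> borel_measurable borel \<and> (\<forall>(\<gamma>, l) \<in> \<Gamma>. 1 \<le> line_integral \<rho> \<gamma> l)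
      \<and> (\<integral>\<^sup>+ x. ennreal_powr (\<rho> x) p \<partial>m) < ennreal (geometric_tolerance p k)"
      unfolding p_modulus_def INF_less_iff by auto
  qed
  from choice[OF this] obtain \<rho> where [measurable]: "\<And>k. \<rho> k \<in> borel_measurable borel"
    and adm: "\<And>k \<gamma> l. (\<gamma>, l) \<in> \<Gamma> \<Longrightarrow> 1 \<le> line_integral (\<rho> k) \<gamma> l"
    and small: "\<And>k. (\<integral>\<^sup>+ x. ennreal_powr (\<rho> k x) p \<partial>m) < ennreal (geometric_tolerance p k)"
    by blast
  have [measurable]: "\<rho> k \<in> borel_measurable m" for k
    using m by (simp cong: measurable_cong_sets)
  define H where "H = (\<lambda>x. SUP k. ennreal (2 ^ k) * \<rho> k x)"
  have "(\<integral>\<^sup>+ x. ennreal_powr (H x) p \<partial>m) < \<infinity>"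
    unfolding H_def
    by (intro nn_integral_weighted_SUP_le less_imp_le[OF small]) (use p in auto)
  then have "curve_weight m p H"
    unfolding curve_weight_def H_def by simp
  moreover have "line_integral H \<gamma> l = \<infinity>" if \<gamma>: "(\<gamma>, l) \<in> \<Gamma>" "arclength_curve \<gamma> l" for \<gamma> l
  proof -
    have ge: "ennreal (2 ^ k) \<le> line_integral H \<gamma> l" for k :: nat
    proof -
      have "ennreal (2 ^ k) * 1 \<le> ennreal (2 ^ k) * line_integral (\<rho> k) \<gamma> l"
        by (intro mult_left_mono adm \<gamma>) auto
      also have "\<dots> = line_integral (\<lambda>x. ennreal (2 ^ k) * \<rho> k x) \<gamma> l"
        by (rule line_integral_cmult[symmetric]) (use \<gamma> in auto)
      also have "\<dots> \<le> line_integral H \<gamma> l"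
        unfolding H_def by (intro line_integral_mono SUP_upper) simp
      finally show ?thesis by simp
    qed
    show ?thesis
    proof (cases "line_integral H \<gamma> l")
      case (real c)
      obtain k where "c < 2 ^ k"
        using real_arch_pow[of 2 c] by auto
      then show ?thesis
        using ge[of k] real by (simp add: ennreal_le_iff2)
    qed simp
  qed
  ultimately show ?thesis by (rule that)
qed

text \<open>Every positive multiple of \<open>H\<close> is admissible, and the energy of
  \<open>c * H\<close> scales like c^p.\<close>

lemma null_modulus_of_curve_weight:
  assumes m: "sets m = sets borel" and p: "1 < p" and H: "curve_weight m p H"
  shows "p_modulus m p {(\<gamma>, l). arclength_curve \<gamma> l \<and> line_integral H \<gamma> l = \<infinity>} = 0"
    (is "p_modulus m p ?\<Gamma> = 0")
proof -
  have [measurable]: "H \<in> borel_measurable borel" using H by (rule curve_weight_measurable)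
  have [measurable]: "H \<in> borel_measurable m" using m by (simp cong: measurable_cong_sets)
  obtain i where i: "(\<integral>\<^sup>+ x. ennreal_powr (H x) p \<partial>m) = ennreal i" "0 \<le> i"
    using H by (cases "\<integral>\<^sup>+ x. ennreal_powr (H x) p \<partial>m") (auto simp: curve_weight_def)
  have "p_modulus m p ?\<Gamma> \<le> ennreal ((1 / real (Suc n)) powr p * i)" for n
  proof -
    let ?c = "1 / real (Suc n)"
    have "p_modulus m p ?\<Gamma> \<le> (\<integral>\<^sup>+ x. ennreal_powr (ennreal ?c * H x) p \<partial>m)"
      unfolding p_modulus_def
    proof (rule INF_lower)
      have "1 \<le> line_integral (\<lambda>x. ennreal ?c * H x) \<gamma> l"
        if "arclength_curve \<gamma> l" "line_integral H \<gamma> l = \<infinity>" for \<gamma> l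
        using that by (simp add: line_integral_cmult ennreal_mult_top)
      then show "(\<lambda>x. ennreal ?c * H x)
          \<in> {\<rho>. \<rho> \<in> borel_measurable borel \<and> (\<forall>(\<gamma>, l) \<in> ?\<Gamma>. 1 \<le> line_integral \<rho> \<gamma> l)}"
        by auto
    qed
    also have "\<dots> = ennreal (?c powr p * i)"
      using i by (simp add: ennreal_powr_cmult nn_integral_cmult ennreal_mult)
    finally show ?thesis .
  qed
  moreover have "(\<lambda>n. (1 / real (Suc n)) powr p * i) \<longlonglongrightarrow> 0 powr p * i"
    by (intro tendsto_mult tendsto_powr' tendsto_const LIMSEQ_Suc[OF lim_1_over_n]) (use p in auto)
  then have "(\<lambda>n. ennreal ((1 / real (Suc n)) powr p * i)) \<longlonglongrightarrow> ennreal 0"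
    by (intro tendsto_ennrealI) simp
  ultimately have "p_modulus m p ?\<Gamma> \<le> ennreal 0"
    by (intro LIMSEQ_le_const) auto
  then show ?thesis by simp
qed

text \<open>Families of zero modulus are described by a single weight, infinite along all their curves.
  In this form countable unions and passage to subcurves are immediate.\<close>

lemma weak_upper_gradient_iff_weight:
  assumes m: "sets m = sets borel" and p: "1 < p"
  shows "weak_upper_gradient m p f \<rho> \<longleftrightarrow> \<rho> \<in> borel_measurable borel \<and> (\<forall>x. 0 \<le> \<rho> x) \<and>
    (\<exists>H. curve_weight m p H \<and> (\<forall>\<gamma> l. arclength_curve \<gamma> l \<longrightarrow> line_integral H \<gamma> l < \<infinity> \<longrightarrow>
      ennreal \<bar>f (\<gamma> l) - f (\<gamma> 0)\<bar> \<le> line_integral (\<lambda>x. ennreal (\<rho> x)) \<gamma> l))"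
    (is "?L \<longleftrightarrow> ?R")
proof
  assume L: ?L
  then obtain \<Gamma> where "p_modulus m p \<Gamma> = 0"
    and \<Gamma>: "\<And>\<gamma> l. arclength_curve \<gamma> l \<Longrightarrow> (\<gamma>, l) \<notin> \<Gamma> \<Longrightarrow>
      ennreal \<bar>f (\<gamma> l) - f (\<gamma> 0)\<bar> \<le> line_integral (\<lambda>x. ennreal (\<rho> x)) \<gamma> l"
    unfolding weak_upper_gradient_def by blast
  then obtain H where "curve_weight m p H"
    "\<And>\<gamma> l. (\<gamma>, l) \<in> \<Gamma> \<Longrightarrow> arclength_curve \<gamma> l \<Longrightarrow> line_integral H \<gamma> l = \<infinity>"
    using exists_curve_weight_of_null_modulus[OF m p] by blast
  then show ?R
    using L \<Gamma> unfolding weak_upper_gradient_def by (metis less_irrefl)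
next
  assume R: ?R
  then obtain H where H: "curve_weight m p H"
    "\<And>\<gamma> l. arclength_curve \<gamma> l \<Longrightarrow> line_integral H \<gamma> l < \<infinity> \<Longrightarrow>
      ennreal \<bar>f (\<gamma> l) - f (\<gamma> 0)\<bar> \<le> line_integral (\<lambda>x. ennreal (\<rho> x)) \<gamma> l"
    by blast
  show ?L
    unfolding weak_upper_gradient_def
    using R H(2) null_modulus_of_curve_weight[OF m p H(1)]
    by (intro conjI exI[of _ "{(\<gamma>, l). arclength_curve \<gamma> l \<and> line_integral H \<gamma> l = \<infinity>}"])
      (auto simp: less_top)
qed

text \<open>Positive factors do not change which curves have finite integral, so each weight may
  first be made small enough for one common supremum.\<close>

lemma countable_curve_weights:
  fixes H :: "nat \<Rightarrow> 'a::metric_space \<Rightarrow> ennreal"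
  assumes m: "sets m = sets borel" and p: "1 < p" and H: "\<And>k. curve_weight m p (H k)"
  obtains W where "curve_weight m p W"
    "\<And>k \<gamma> l. arclength_curve \<gamma> l \<Longrightarrow> line_integral W \<gamma> l < \<infinity> \<Longrightarrow> line_integral (H k) \<gamma> l < \<infinity>"
proof -
  have [measurable]: "H k \<in> borel_measurable borel" for k
    using H by (rule curve_weight_measurable)
  have [measurable]: "H k \<in> borel_measurable m" for k
    using m by (simp cong: measurable_cong_sets)
  have "\<exists>c>0. (\<integral>\<^sup>+ x. ennreal_powr (ennreal c * H k x) p \<partial>m) \<le> ennreal (geometric_tolerance p k)" for k
  proof -
    obtain i where i: "(\<integral>\<^sup>+ x. ennreal_powr (H k x) p \<partial>m) = ennreal i" "0 \<le> i"
      using H[of k] by (cases "\<integral>\<^sup>+ x. ennreal_powr (H k x) p \<partial>m") (auto simp: curve_weight_def)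
    \<comment> \<open>Makes c^p times the energy \<open>i\<close> at most the tolerance; adding 1
      covers \<open>i = 0\<close>.\<close>
    define c where "c = (geometric_tolerance p k / (i + 1)) powr (1 / p)"
    have c: "0 < c" "c powr p = geometric_tolerance p k / (i + 1)"
      using geometric_tolerance_pos[of p k] i p by (auto simp: c_def powr_powr)
    have "(\<integral>\<^sup>+ x. ennreal_powr (ennreal c * H k x) p \<partial>m) = ennreal (c powr p * i)"
      using i c(1) by (simp add: ennreal_powr_cmult nn_integral_cmult ennreal_mult)
    also have "\<dots> \<le> ennreal (geometric_tolerance p k)"
      using i geometric_tolerance_pos[of p k] unfolding c(2) by (intro ennreal_leI) (simp add: field_simps)
    finally show ?thesis using c(1) by blast
  qed
  then obtain c where c: "\<And>k. 0 < c k"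
    "\<And>k. (\<integral>\<^sup>+ x. ennreal_powr (ennreal (c k) * H k x) p \<partial>m) \<le> ennreal (geometric_tolerance p k)"
    by metis
  define W where "W = (\<lambda>x. SUP k. ennreal (2 ^ k) * (ennreal (c k) * H k x))"
  have "curve_weight m p W"
    unfolding curve_weight_def W_def
    by (intro conjI nn_integral_weighted_SUP_le c) (use p in auto)
  moreover have "line_integral (H k) \<gamma> l < \<infinity>"
    if \<gamma>: "arclength_curve \<gamma> l" and fin: "line_integral W \<gamma> l < \<infinity>" for k \<gamma> l
  proof -
    have "ennreal (2 ^ k) * (ennreal (c k) * line_integral (H k) \<gamma> l)
        = line_integral (\<lambda>x. ennreal (2 ^ k) * (ennreal (c k) * H k x)) \<gamma> l"
      using \<gamma> by (simp add: line_integral_cmult)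
    also have "\<dots> \<le> line_integral W \<gamma> l"
      unfolding W_def by (intro line_integral_mono SUP_upper) simp
    finally have "ennreal (2 ^ k) * (ennreal (c k) * line_integral (H k) \<gamma> l) < \<infinity>"
      using fin by (rule le_less_trans)
    then show ?thesis
      using c(1)[of k] by (cases "line_integral (H k) \<gamma> l") (auto simp: ennreal_mult_top)
  qed
  ultimately show ?thesis by (rule that)
qed

lemma weak_upper_gradient_lincomb:
  assumes m: "sets m = sets borel" and p: "1 < p"
    and f: "weak_upper_gradient m p f \<rho>" and g: "weak_upper_gradient m p g \<sigma>"
  shows "weak_upper_gradient m p (\<lambda>x. a * f x + b * g x) (\<lambda>x. \<bar>a\<bar> * \<rho> x + \<bar>b\<bar> * \<sigma> x)"
proof -
  obtain H where H: "curve_weight m p H"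
    "\<And>\<gamma> l. arclength_curve \<gamma> l \<Longrightarrow> line_integral H \<gamma> l < \<infinity> \<Longrightarrow>
      ennreal \<bar>f (\<gamma> l) - f (\<gamma> 0)\<bar> \<le> line_integral (\<lambda>x. ennreal (\<rho> x)) \<gamma> l"
    and \<rho>: "\<rho> \<in> borel_measurable borel" "\<And>x. 0 \<le> \<rho> x"
    using f unfolding weak_upper_gradient_iff_weight[OF m p] by blast
  obtain K where K: "curve_weight m p K"
    "\<And>\<gamma> l. arclength_curve \<gamma> l \<Longrightarrow> line_integral K \<gamma> l < \<infinity> \<Longrightarrow>
      ennreal \<bar>g (\<gamma> l) - g (\<gamma> 0)\<bar> \<le> line_integral (\<lambda>x. ennreal (\<sigma> x)) \<gamma> l"
    and \<sigma>: "\<sigma> \<in> borel_measurable borel" "\<And>x. 0 \<le> \<sigma> x"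
    using g unfolding weak_upper_gradient_iff_weight[OF m p] by blast
  \<comment> \<open>Two weights, presented as a sequence to be merged into one.\<close>
  have "curve_weight m p (if k = 0 then H else K)" for k :: nat
    using H K by simp
  then obtain W where W: "curve_weight m p W"
    "\<And>(k::nat) \<gamma> l. arclength_curve \<gamma> l \<Longrightarrow> line_integral W \<gamma> l < \<infinity> \<Longrightarrow>
       line_integral (if k = 0 then H else K) \<gamma> l < \<infinity>"
    using countable_curve_weights[OF m p, of "\<lambda>k. if k = 0 then H else K"] by blast
  have "ennreal \<bar>(a * f (\<gamma> l) + b * g (\<gamma> l)) - (a * f (\<gamma> 0) + b * g (\<gamma> 0))\<bar>
      \<le> line_integral (\<lambda>x. ennreal (\<bar>a\<bar> * \<rho> x + \<bar>b\<bar> * \<sigma> x)) \<gamma> l"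
    if \<gamma>: "arclength_curve \<gamma> l" and fin: "line_integral W \<gamma> l < \<infinity>" for \<gamma> l
  proof -
    have "(a * f (\<gamma> l) + b * g (\<gamma> l)) - (a * f (\<gamma> 0) + b * g (\<gamma> 0))
        = a * (f (\<gamma> l) - f (\<gamma> 0)) + b * (g (\<gamma> l) - g (\<gamma> 0))"
      by (simp add: algebra_simps)
    then have "\<bar>(a * f (\<gamma> l) + b * g (\<gamma> l)) - (a * f (\<gamma> 0) + b * g (\<gamma> 0))\<bar>
        \<le> \<bar>a\<bar> * \<bar>f (\<gamma> l) - f (\<gamma> 0)\<bar> + \<bar>b\<bar> * \<bar>g (\<gamma> l) - g (\<gamma> 0)\<bar>"
      by (metis abs_mult abs_triangle_ineq)
    then have "ennreal \<bar>(a * f (\<gamma> l) + b * g (\<gamma> l)) - (a * f (\<gamma> 0) + b * g (\<gamma> 0))\<bar>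
        \<le> ennreal \<bar>a\<bar> * ennreal \<bar>f (\<gamma> l) - f (\<gamma> 0)\<bar> + ennreal \<bar>b\<bar> * ennreal \<bar>g (\<gamma> l) - g (\<gamma> 0)\<bar>"
      by (simp add: ennreal_leI flip: ennreal_mult ennreal_plus)
    also have "\<dots> \<le> ennreal \<bar>a\<bar> * line_integral (\<lambda>x. ennreal (\<rho> x)) \<gamma> l
        + ennreal \<bar>b\<bar> * line_integral (\<lambda>x. ennreal (\<sigma> x)) \<gamma> l"
      using W(2)[OF \<gamma> fin, of 0] W(2)[OF \<gamma> fin, of 1]
      by (intro add_mono mult_left_mono H(2) K(2) \<gamma>) auto
    also have "\<dots> = line_integral (\<lambda>x. ennreal \<bar>a\<bar> * ennreal (\<rho> x) + ennreal \<bar>b\<bar> * ennreal (\<sigma> x)) \<gamma> l"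
      using \<gamma> \<rho> \<sigma> by (simp add: line_integral_cmult line_integral_add)
    also have "\<dots> = line_integral (\<lambda>x. ennreal (\<bar>a\<bar> * \<rho> x + \<bar>b\<bar> * \<sigma> x)) \<gamma> l"
      using \<rho> \<sigma> by (simp add: ennreal_mult ennreal_plus)
    finally show ?thesis .
  qed
  then show ?thesis
    unfolding weak_upper_gradient_iff_weight[OF m p] using W(1) \<rho> \<sigma> by auto
qed

section \<open>Limits of weak upper gradients\<close>

text \<open>Infinite upper limits are sent to 0 by \<open>real_of_ereal\<close>, so this is the true
  upper limit only for bounded sequences; hence the \<open>Bseq\<close> assumptions below.\<close>

definition real_limsup :: "(nat \<Rightarrow> real) \<Rightarrow> real" where
  "real_limsup a = real_of_ereal (limsup (\<lambda>k. ereal (a k)))"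

lemma real_limsup_eq:
  assumes "a \<longlonglongrightarrow> x"
  shows "real_limsup a = x"
proof -
  have "limsup (\<lambda>k. ereal (a k)) = ereal x"
    using assms by (intro lim_imp_Limsup) auto
  then show ?thesis by (simp add: real_limsup_def)
qed

lemma ereal_real_limsup:
  assumes "Bseq a"
  shows "ereal (real_limsup a) = limsup (\<lambda>k. ereal (a k))"
proof -
  obtain c where c: "\<And>k. \<bar>a k\<bar> \<le> c"
    using assms by (auto simp: Bseq_def)
  have "limsup (\<lambda>k. ereal (a k)) \<le> ereal c"
    using c by (intro Limsup_bounded always_eventually) (auto simp: abs_le_iff)
  moreover have "ereal (- c) \<le> liminf (\<lambda>k. ereal (a k))"
    using c by (intro Liminf_bounded always_eventually) (auto simp: abs_le_iff minus_le_iff)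
  then have "ereal (- c) \<le> limsup (\<lambda>k. ereal (a k))"
    using Liminf_le_Limsup[of sequentially "\<lambda>k. ereal (a k)"] order_trans by fastforce
  ultimately show ?thesis
    unfolding real_limsup_def by (cases "limsup (\<lambda>k. ereal (a k))") auto
qed

lemma real_limsup_le_add:
  assumes "Bseq a" "Bseq b" "\<And>k. a k \<le> b k + c k" "c \<longlonglongrightarrow> C"
  shows "real_limsup a \<le> real_limsup b + C"
proof -
  have "limsup (\<lambda>k. ereal (a k)) \<le> limsup (\<lambda>k. ereal (b k) + ereal (c k))"
    using assms(3) by (intro Limsup_mono always_eventually) simp
  also have "\<dots> \<le> limsup (\<lambda>k. ereal (b k)) + limsup (\<lambda>k. ereal (c k))"
    by (rule ereal_limsup_add_mono)
  also have "limsup (\<lambda>k. ereal (c k)) = ereal C"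
    using assms(4) by (intro lim_imp_Limsup) auto
  finally show ?thesis
    using ereal_real_limsup[OF assms(1)] ereal_real_limsup[OF assms(2)]
    by (metis ereal_less_eq(3) plus_ereal.simps(1))
qed

lemma abs_real_limsup_diff_le:
  assumes "Bseq a" "Bseq b" "\<And>k. \<bar>a k - b k\<bar> \<le> c k" "c \<longlonglongrightarrow> C"
  shows "\<bar>real_limsup a - real_limsup b\<bar> \<le> C"
proof -
  have "a k \<le> b k + c k" "b k \<le> a k + c k" for k
    using assms(3)[of k] by linarith+
  then show ?thesis
    using real_limsup_le_add[OF assms(1,2) _ assms(4)] real_limsup_le_add[OF assms(2,1) _ assms(4)]
    by (simp add: abs_le_iff)
qed

lemma in_sobolev_reps_iff:
  "(g, \<rho>) \<in> sobolev_reps m p f \<longleftrightarrow> (AE x in m. g x = f x) \<and> in_Lp m p \<rho> \<and> weak_upper_gradient m p g \<rho>"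
  by (simp add: sobolev_reps_def)

text \<open>Finiteness of this integral means that the curve spends zero time in \<open>Z\<close>,
  whereas (0, l) has positive length.\<close>

lemma exists_interior_point_avoiding:
  assumes \<gamma>: "arclength_curve \<gamma> l" and Z: "Z \<in> sets borel"
    and fin: "line_integral (\<lambda>x. \<infinity> * indicator Z x) \<gamma> l < \<infinity>"
  obtains t where "0 < t" "t < l" "\<gamma> t \<notin> Z"
proof -
  let ?F = "\<lambda>t. (\<infinity> * indicator Z (\<gamma> t) :: ennreal) * indicator {0..l} t"
  have F: "?F \<in> borel_measurable borel"
    by (rule borel_measurable_along_curve[OF \<gamma>]) (use Z in measurable)
  have "AE t in lborel. ?F t \<noteq> \<infinity>"
    by (rule nn_integral_PInf_AE) (use fin F in \<open>simp_all add: line_integral_def\<close>)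
  then have ae: "AE t in lborel. t \<in> {0..l} \<longrightarrow> \<gamma> t \<notin> Z"
    by (rule AE_mp) (auto simp: ennreal_top_mult intro!: AE_I2)
  have "\<exists>t\<in>{0<..<l}. \<gamma> t \<notin> Z"
  proof (rule ccontr)
    assume "\<not> (\<exists>t\<in>{0<..<l}. \<gamma> t \<notin> Z)"
    then have "AE t in lborel. t \<notin> {0<..<l}"
      using ae by (auto elim!: eventually_mono)
    then have "emeasure lborel {0<..<l} = 0"
      using AE_iff_measurable[of "{0<..<l}" lborel "\<lambda>t. t \<notin> {0<..<l}"]
      by (simp add: greaterThanLessThan_def greaterThan_def lessThan_def Collect_conj_eq)
    then show False
      using arclength_curve_pos[OF \<gamma>] by simp
  qed
  then show ?thesis using that by auto
qed

text \<open>Fuglede's lemma. Taking the upper limit as the representative of the limit function only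
  requires boundedness of the sequence at the endpoints of a curve, which one point of
  convergence on the curve provides.\<close>

lemma sobolev_reps_closed:
  assumes m: "sets m = sets borel" and p: "1 < p"
    and v: "\<And>n. in_Lp m p (v n)" and u: "in_Lp m p u"
    and vu: "(\<lambda>n. Lp_energy m p (\<lambda>x. v n x - u x)) \<longlonglongrightarrow> 0"
    and reps: "\<And>n. (g n, \<rho> n) \<in> sobolev_reps m p (v n)" and \<rho>0: "in_Lp m p \<rho>0"
    and lim: "(\<lambda>n. Lp_energy m p (\<lambda>x. \<rho> n x - \<rho>0 x)) \<longlonglongrightarrow> 0"
  obtains g0 where "(g0, \<lambda>x. \<bar>\<rho>0 x\<bar>) \<in> sobolev_reps m p u"
proof -
  have m_borel: "borel_measurable m = (borel_measurable borel :: ('a \<Rightarrow> 'b::topological_space) set)"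
    using m by (simp cong: measurable_cong_sets)
  have \<rho>L: "in_Lp m p (\<rho> n)" for n using reps by (simp add: in_sobolev_reps_iff)
  obtain r1 H1 where r1: "strict_mono r1" and H1 [measurable]: "H1 \<in> borel_measurable m"
    and H1_fin: "(\<integral>\<^sup>+ x. ennreal_powr (H1 x) p \<partial>m) < \<infinity>"
    and H1_le: "\<And>k x. ennreal (2 ^ k) * ennreal \<bar>v (r1 k) x - u x\<bar> \<le> H1 x"
    using Lp_geometric_subsequence[OF p v u vu] by blast
  \<comment> \<open>A second extraction: the first controls the functions, this one the
    gradients.\<close>
  have "(\<lambda>n. Lp_energy m p (\<lambda>x. \<rho> (r1 n) x - \<rho>0 x)) \<longlonglongrightarrow> 0"
    using LIMSEQ_subseq_LIMSEQ[OF lim r1] by (simp add: o_def)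
  then obtain r2 H2 where r2: "strict_mono r2" and H2 [measurable]: "H2 \<in> borel_measurable m"
    and H2_fin: "(\<integral>\<^sup>+ x. ennreal_powr (H2 x) p \<partial>m) < \<infinity>"
    and H2_le: "\<And>k x. ennreal (2 ^ k) * ennreal \<bar>\<rho> (r1 (r2 k)) x - \<rho>0 x\<bar> \<le> H2 x"
    using Lp_geometric_subsequence[OF p \<rho>L \<rho>0] by blast
  define r where "r = (\<lambda>k. r1 (r2 k))"
  have "AE x in m. H1 x < \<infinity>"
    using H1_fin by (intro AE_finite_of_nn_integral_ennreal_powr) auto
  moreover have "AE x in m. \<forall>k. g (r k) x = v (r k) x"
    using reps by (auto simp: AE_all_countable in_sobolev_reps_iff)
  ultimately have conv: "AE x in m. (\<lambda>k. g (r k) x) \<longlonglongrightarrow> u x"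
  proof eventually_elim
    fix x assume fin: "H1 x < \<infinity>" and eq: "\<forall>k. g (r k) x = v (r k) x"
    have "(\<lambda>k. v (r1 k) x - u x) \<longlonglongrightarrow> 0"
      by (rule tendsto_0_of_geometric_bound(1)[OF fin H1_le])
    then have "(\<lambda>k. v (r1 k) x) \<longlonglongrightarrow> u x" by (rule LIM_zero_cancel)
    then show "(\<lambda>k. g (r k) x) \<longlonglongrightarrow> u x"
      using LIMSEQ_subseq_LIMSEQ[OF _ r2, of "\<lambda>k. v (r1 k) x" "u x"] eq by (simp add: r_def o_def)
  qed
  then obtain Z where Z: "{x \<in> space m. \<not> (\<lambda>k. g (r k) x) \<longlonglongrightarrow> u x} \<subseteq> Z" "emeasure m Z = 0" "Z \<in> sets m"
    by (rule AE_E)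
  have Z_conv: "(\<lambda>k. g (r k) x) \<longlonglongrightarrow> u x" if "x \<notin> Z" for x
    using Z(1) that sets_eq_imp_space_eq[OF m] by auto
  have Zb: "Z \<in> sets borel" using Z m by simp
  have wug: "weak_upper_gradient m p (g (r k)) (\<rho> (r k))" for k
    using reps by (simp add: in_sobolev_reps_iff)
  have \<rho>b: "\<rho> (r k) \<in> borel_measurable borel" "0 \<le> \<rho> (r k) x" for k x
    using wug[of k] by (auto simp: weak_upper_gradient_def)
  have "\<exists>K. curve_weight m p K \<and> (\<forall>\<gamma> l. arclength_curve \<gamma> l \<longrightarrow> line_integral K \<gamma> l < \<infinity> \<longrightarrow>
      ennreal \<bar>g (r k) (\<gamma> l) - g (r k) (\<gamma> 0)\<bar> \<le> line_integral (\<lambda>x. ennreal (\<rho> (r k) x)) \<gamma> l)" for k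
    using wug[of k] unfolding weak_upper_gradient_iff_weight[OF m p] by blast
  then obtain K where K: "\<And>k. curve_weight m p (K k)"
    "\<And>k \<gamma> l. arclength_curve \<gamma> l \<Longrightarrow> line_integral (K k) \<gamma> l < \<infinity> \<Longrightarrow>
      ennreal \<bar>g (r k) (\<gamma> l) - g (r k) (\<gamma> 0)\<bar> \<le> line_integral (\<lambda>x. ennreal (\<rho> (r k) x)) \<gamma> l"
    by metis
  have \<rho>0b: "\<rho>0 \<in> borel_measurable borel" and H2b: "H2 \<in> borel_measurable borel"
    using in_Lp_measurable[OF \<rho>0] H2 unfolding m_borel by auto
  have w1: "curve_weight m p H2"
    unfolding curve_weight_def using H2b H2_fin by simp
  have w2: "curve_weight m p (\<lambda>x. ennreal \<bar>\<rho>0 x\<bar>)"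
    unfolding curve_weight_def using nn_integral_ennreal_powr_abs[OF \<rho>0] \<rho>0b by simp
  have w3: "curve_weight m p (\<lambda>x. \<infinity> * indicator Z x)"
  proof -
    have "AE x in m. x \<notin> Z"
      using Z by (intro AE_not_in) (auto simp: null_sets_def)
    then have "AE x in m. ennreal_powr (\<infinity> * indicator Z x) p = 0" by auto
    then have "(\<integral>\<^sup>+ x. ennreal_powr (\<infinity> * indicator Z x) p \<partial>m) = (\<integral>\<^sup>+ x. 0 \<partial>m)"
      by (rule nn_integral_cong_AE)
    then show ?thesis
      unfolding curve_weight_def using Zb by simp
  qed
  \<comment> \<open>All exceptional curves at once: infinite rate \<open>H2\<close>, infinite
    integral of the limit gradient, positive time in \<open>Z\<close>, and the exceptional families
    of each \<open>g (r k)\<close>.\<close>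
  let ?W = "\<lambda>k::nat. case k of 0 \<Rightarrow> H2 | Suc 0 \<Rightarrow> (\<lambda>x. ennreal \<bar>\<rho>0 x\<bar>)
      | Suc (Suc 0) \<Rightarrow> (\<lambda>x. \<infinity> * indicator Z x) | Suc (Suc (Suc k)) \<Rightarrow> K k"
  have "curve_weight m p (?W k)" for k
    using w1 w2 w3 K(1) by (auto split: nat.split)
  then obtain W where W: "curve_weight m p W"
    "\<And>k \<gamma> l. arclength_curve \<gamma> l \<Longrightarrow> line_integral W \<gamma> l < \<infinity> \<Longrightarrow> line_integral (?W k) \<gamma> l < \<infinity>"
    using countable_curve_weights[OF m p, of ?W] by blast
  define g0 where "g0 = (\<lambda>x. real_limsup (\<lambda>k. g (r k) x))"
  have "ennreal \<bar>g0 (\<gamma> l) - g0 (\<gamma> 0)\<bar> \<le> line_integral (\<lambda>x. ennreal \<bar>\<rho>0 x\<bar>) \<gamma> l"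
    if \<gamma>: "arclength_curve \<gamma> l" and fin: "line_integral W \<gamma> l < \<infinity>" for \<gamma> l
  proof -
    note W_fin = W(2)[OF \<gamma> fin]
    obtain \<beta> where \<beta>: "line_integral (\<lambda>x. ennreal \<bar>\<rho>0 x\<bar>) \<gamma> l = ennreal \<beta>" "0 \<le> \<beta>"
      using W_fin[of 1] by (cases "line_integral (\<lambda>x. ennreal \<bar>\<rho>0 x\<bar>) \<gamma> l") auto
    obtain \<eta> where \<eta>: "line_integral H2 \<gamma> l = ennreal \<eta>" "0 \<le> \<eta>"
      using W_fin[of 0] by (cases "line_integral H2 \<gamma> l") auto
    obtain t where t: "0 < t" "t < l" "\<gamma> t \<notin> Z"
      using exists_interior_point_avoiding[OF \<gamma> Zb] W_fin[of 2] by (auto simp: numeral_2_eq_2)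
    \<comment> \<open>From the pointwise bound of \<open>\<rho> (r k)\<close> by \<bar>\<rho>0\<bar>
      + 2^-k \<open>H2\<close>, integrated along the curve.\<close>
    define b where "b = (\<lambda>k. \<beta> + (1 / 2) ^ k * \<eta>)"
    have \<rho>_le: "line_integral (\<lambda>x. ennreal (\<rho> (r k) x)) \<gamma> l \<le> ennreal (b k)" for k
    proof -
      have "ennreal (\<rho> (r k) x) \<le> ennreal \<bar>\<rho>0 x\<bar> + ennreal ((1 / 2) ^ k) * H2 x" for x
      proof -
        have "ennreal (\<rho> (r k) x) \<le> ennreal (\<bar>\<rho>0 x\<bar> + \<bar>\<rho> (r k) x - \<rho>0 x\<bar>)"
          by (intro ennreal_leI) linarith
        also have "\<dots> = ennreal \<bar>\<rho>0 x\<bar> + ennreal \<bar>\<rho> (r k) x - \<rho>0 x\<bar>"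
          by simp
        also have "ennreal \<bar>\<rho> (r k) x - \<rho>0 x\<bar>
            = ennreal ((1 / 2) ^ k) * (ennreal (2 ^ k) * ennreal \<bar>\<rho> (r k) x - \<rho>0 x\<bar>)"
          by (simp add: power_one_over flip: ennreal_mult)
        also have "\<dots> \<le> ennreal ((1 / 2) ^ k) * H2 x"
          using H2_le[of k x] by (intro mult_left_mono) (auto simp: r_def)
        finally show ?thesis by simp
      qed
      then have "line_integral (\<lambda>x. ennreal (\<rho> (r k) x)) \<gamma> l
          \<le> line_integral (\<lambda>x. ennreal \<bar>\<rho>0 x\<bar> + ennreal ((1 / 2) ^ k) * H2 x) \<gamma> l"
        by (rule line_integral_mono)
      also have "\<dots> = ennreal (b k)"
        using \<gamma> \<rho>0b H2b \<beta> \<eta>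
        by (simp add: line_integral_add line_integral_cmult b_def flip: ennreal_mult ennreal_plus)
      finally show ?thesis .
    qed
    \<comment> \<open>Needed between arbitrary points of the curve, to link the endpoints to the
      point of convergence \<open>\<gamma> t\<close>.\<close>
    have sub: "\<bar>g (r k) (\<gamma> (s + (s' - s))) - g (r k) (\<gamma> s)\<bar> \<le> b k"
      if s: "0 \<le> s" "s < s'" "s' \<le> l" for s s' k
    proof -
      note sub = arclength_curve_subcurve[OF \<gamma> s]
      have "line_integral W (\<lambda>x. \<gamma> (s + x)) (s' - s) < \<infinity>"
        using line_integral_subcurve_le[OF \<gamma> curve_weight_measurable[OF W(1)] s] fin by (rule le_less_trans)
      then have "line_integral (K k) (\<lambda>x. \<gamma> (s + x)) (s' - s) < \<infinity>"
        using W(2)[OF sub, of "Suc (Suc (Suc k))"] by simp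
      then have "ennreal \<bar>g (r k) (\<gamma> (s + (s' - s))) - g (r k) (\<gamma> (s + 0))\<bar>
          \<le> line_integral (\<lambda>x. ennreal (\<rho> (r k) x)) (\<lambda>x. \<gamma> (s + x)) (s' - s)"
        by (rule K(2)[OF sub])
      also have "\<dots> \<le> line_integral (\<lambda>x. ennreal (\<rho> (r k) x)) \<gamma> l"
        using \<rho>b(1)[of k] by (intro line_integral_subcurve_le \<gamma> s) auto
      also have "\<dots> \<le> ennreal (b k)" by (rule \<rho>_le)
      finally have "ennreal \<bar>g (r k) (\<gamma> (s + (s' - s))) - g (r k) (\<gamma> (s + 0))\<bar> \<le> ennreal (b k)" .
      moreover have "0 \<le> b k" using \<beta>(2) \<eta>(2) by (simp add: b_def)
      ultimately show ?thesis by simp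
    qed
    have b_lim: "b \<longlonglongrightarrow> \<beta>"
    proof -
      have "b \<longlonglongrightarrow> \<beta> + 0 * \<eta>"
        unfolding b_def by (intro tendsto_intros LIMSEQ_power_zero) simp
      then show ?thesis by simp
    qed
    \<comment> \<open>Boundedness at \<open>\<gamma> t\<close> spreads to both endpoints through
      \<open>sub\<close>; only then is \<open>real_limsup\<close> the true upper limit
      there.\<close>
    obtain c where c: "\<And>k. \<bar>g (r k) (\<gamma> t)\<bar> \<le> c"
      using convergent_imp_Bseq[OF convergentI[OF Z_conv[OF t(3)]]] by (auto simp: Bseq_def)
    have b_le: "b k \<le> \<beta> + \<eta>" for k
      using \<eta>(2) mult_right_mono[of "(1 / 2) ^ k" 1 \<eta>] by (simp add: b_def power_le_one)
    have "\<bar>g (r k) (\<gamma> 0)\<bar> \<le> c + \<beta> + \<eta>" "\<bar>g (r k) (\<gamma> l)\<bar> \<le> c + \<beta> + \<eta>" for k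
      using sub[of 0 t k] sub[of t l k] c[of k] b_le[of k] t by (simp_all add: abs_le_iff)
    then have "Bseq (\<lambda>k. g (r k) (\<gamma> 0))" "Bseq (\<lambda>k. g (r k) (\<gamma> l))"
      by (auto intro!: BseqI'[of _ "c + \<beta> + \<eta>"])
    then have "\<bar>g0 (\<gamma> l) - g0 (\<gamma> 0)\<bar> \<le> \<beta>"
      unfolding g0_def using sub[of 0 l] arclength_curve_pos[OF \<gamma>]
      by (intro abs_real_limsup_diff_le[OF _ _ _ b_lim]) auto
    then show ?thesis
      unfolding \<beta>(1) by (rule ennreal_leI)
  qed
  then have "weak_upper_gradient m p g0 (\<lambda>x. \<bar>\<rho>0 x\<bar>)"
    unfolding weak_upper_gradient_iff_weight[OF m p] using W(1) \<rho>0b by auto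
  moreover have "AE x in m. g0 x = u x"
    using conv by eventually_elim (simp add: g0_def real_limsup_eq)
  ultimately show ?thesis
    using that[of g0] in_Lp_abs[OF \<rho>0] by (simp add: in_sobolev_reps_iff)
qed

section \<open>Balls of the Sobolev space\<close>

lemma in_W1p_in_Lp: "in_W1p m p f \<Longrightarrow> in_Lp m p f"
  by (simp add: in_W1p_def)

lemma in_W1pI: "in_Lp m p f \<Longrightarrow> (g, \<rho>) \<in> sobolev_reps m p f \<Longrightarrow> in_W1p m p f"
  by (auto simp: in_W1p_def)

lemma sobolev_reps_lincomb:
  assumes "sets m = sets borel" "1 < p" "(g, \<rho>) \<in> sobolev_reps m p f" "(h, \<sigma>) \<in> sobolev_reps m p k"
  shows "(\<lambda>x. a * g x + b * h x, \<lambda>x. \<bar>a\<bar> * \<rho> x + \<bar>b\<bar> * \<sigma> x) \<in> sobolev_reps m p (\<lambda>x. a * f x + b * k x)"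
  using assms weak_upper_gradient_lincomb[OF assms(1,2), of g \<rho> h \<sigma> a b]
  by (auto simp: in_sobolev_reps_iff intro: in_Lp_lincomb)

lemma zero_in_sobolev_reps: "(\<lambda>x. 0, \<lambda>x. 0) \<in> sobolev_reps m p (\<lambda>x. 0)"
proof -
  have "p_modulus m p {} \<le> (\<integral>\<^sup>+ x. ennreal_powr 0 p \<partial>m)"
    unfolding p_modulus_def by (rule INF_lower2[of "\<lambda>x. 0"]) auto
  then show ?thesis
    unfolding in_sobolev_reps_iff weak_upper_gradient_def by (auto intro!: exI[of _ "{}"])
qed

lemma in_W1p_zero: "in_W1p m p (\<lambda>x. 0)"
  using zero_in_sobolev_reps by (intro in_W1pI) auto

lemma W1p_norm_nonneg [simp]: "0 \<le> W1p_norm m p f"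
  by (simp add: W1p_norm_def)

text \<open>The gradient term of the norm is an infimum, so a bound on the norm provides gradients
  up to a slack \<open>e\<close>. In this form balls are handled without choosing a minimal
  gradient.\<close>

lemma W1p_norm_le_iff:
  assumes p: "1 < p" and f: "in_W1p m p f" and r: "0 \<le> r"
  shows "W1p_norm m p f \<le> r \<longleftrightarrow>
    (\<forall>e>0. \<exists>g \<rho>. (g, \<rho>) \<in> sobolev_reps m p f \<and> Lp_energy m p f + Lp_energy m p \<rho> \<le> r powr p + e)"
proof -
  let ?R = "sobolev_reps m p f"
  let ?I = "INF gr\<in>?R. Lp_norm m p (snd gr) powr p"
  have ne: "?R \<noteq> {}" and fL: "in_Lp m p f" using f by (auto simp: in_W1p_def)
  have bdd: "bdd_below ((\<lambda>gr. Lp_norm m p (snd gr) powr p) ` ?R)"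
    by (rule bdd_belowI2[of _ 0]) simp
  have E: "Lp_norm m p \<rho> powr p = Lp_energy m p \<rho>" if "(g, \<rho>) \<in> ?R" for g \<rho>
    using that p by (simp add: in_sobolev_reps_iff Lp_norm_powr)
  have I: "0 \<le> ?I" by (rule cINF_greatest[OF ne]) simp
  have "W1p_norm m p f \<le> r \<longleftrightarrow> W1p_norm m p f powr p \<le> r powr p"
    using p r powr_mono2[of p "W1p_norm m p f" r] powr_less_mono2[of p r "W1p_norm m p f"]
    by (meson W1p_norm_nonneg leD le_less_linear less_imp_le order_less_trans zero_less_one)
  also have "W1p_norm m p f powr p = Lp_energy m p f + ?I"
    using p I Lp_norm_powr[OF p fL] by (simp add: W1p_norm_def powr_powr)
  also have "(Lp_energy m p f + ?I \<le> r powr p) \<longleftrightarrow>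
    (\<forall>e>0. \<exists>g \<rho>. (g, \<rho>) \<in> ?R \<and> Lp_energy m p f + Lp_energy m p \<rho> \<le> r powr p + e)" (is "?A \<longleftrightarrow> ?B")
  proof
    assume A: ?A
    show ?B
    proof (intro allI impI)
      fix e :: real assume "0 < e"
      then have "?I < r powr p - Lp_energy m p f + e" using A by linarith
      then obtain gr where "gr \<in> ?R" "Lp_norm m p (snd gr) powr p < r powr p - Lp_energy m p f + e"
        unfolding cINF_less_iff[OF ne bdd] by blast
      then show "\<exists>g \<rho>. (g, \<rho>) \<in> ?R \<and> Lp_energy m p f + Lp_energy m p \<rho> \<le> r powr p + e"
        using E[of "fst gr" "snd gr"] by (intro exI[of _ "fst gr"] exI[of _ "snd gr"]) auto
    qed
  next
    assume B: ?B
    show ?A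
    proof (rule field_le_epsilon)
      fix e :: real assume "0 < e"
      then obtain g \<rho> where "(g, \<rho>) \<in> ?R" "Lp_energy m p f + Lp_energy m p \<rho> \<le> r powr p + e"
        using B by blast
      then show "Lp_energy m p f + ?I \<le> r powr p + e"
        using cINF_lower[OF bdd, of "(g, \<rho>)"] E[of g \<rho>] by simp
    qed
  qed
  finally show ?thesis .
qed

lemma Lp_norm_le_W1p_norm:
  assumes "1 < p" "in_W1p m p f"
  shows "Lp_norm m p f \<le> W1p_norm m p f"
proof -
  have ne: "sobolev_reps m p f \<noteq> {}" using assms by (simp add: in_W1p_def)
  have I: "0 \<le> (INF gr\<in>sobolev_reps m p f. Lp_norm m p (snd gr) powr p)"
    by (rule cINF_greatest[OF ne]) simp
  have "Lp_norm m p f = (Lp_norm m p f powr p) powr (1 / p)"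
    using assms by (simp add: powr_powr)
  also have "\<dots> \<le> W1p_norm m p f"
    unfolding W1p_norm_def using assms I by (intro powr_mono2) auto
  finally show ?thesis .
qed

definition W1p_ball :: "'a::metric_space measure \<Rightarrow> real \<Rightarrow> real \<Rightarrow> ('a \<Rightarrow> real) set" where
  "W1p_ball m p r = {f. in_W1p m p f \<and> W1p_norm m p f \<le> r}"

lemma W1p_ball_iff:
  assumes "1 < p" "0 \<le> r"
  shows "f \<in> W1p_ball m p r \<longleftrightarrow> in_Lp m p f \<and>
    (\<forall>e>0. \<exists>g \<rho>. (g, \<rho>) \<in> sobolev_reps m p f \<and> Lp_energy m p f + Lp_energy m p \<rho> \<le> r powr p + e)"
proof (cases "in_W1p m p f")
  case True
  then show ?thesis
    using W1p_norm_le_iff[OF assms(1) True assms(2)] by (simp add: W1p_ball_def in_W1p_in_Lp)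
next
  case False
  then have "f \<notin> W1p_ball m p r" by (simp add: W1p_ball_def)
  moreover have "\<not> (in_Lp m p f \<and> (\<exists>g \<rho>. (g, \<rho>) \<in> sobolev_reps m p f))"
    using in_W1pI False by blast
  ultimately show ?thesis
    using zero_less_one by blast
qed

lemma zero_in_W1p_ball:
  assumes "1 < p" "0 \<le> r"
  shows "(\<lambda>x. 0) \<in> W1p_ball m p r"
  unfolding W1p_ball_iff[OF assms] using zero_in_sobolev_reps[of m p] by force

lemma W1p_ball_convex:
  assumes m: "sets m = sets borel" and p: "1 < p" and r: "0 \<le> r"
  shows "fun_convex (W1p_ball m p r)"
proof (rule fun_convexI)
  fix f k t assume f: "f \<in> W1p_ball m p r" and k: "k \<in> W1p_ball m p r" and t: "0 \<le> t" "t \<le> (1::real)"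
  have fL: "in_Lp m p f" and kL: "in_Lp m p k" using f k by (auto simp: W1p_ball_iff[OF p r])
  show "(\<lambda>x. (1 - t) * f x + t * k x) \<in> W1p_ball m p r"
    unfolding W1p_ball_iff[OF p r]
  proof (intro conjI allI impI)
    fix e :: real assume e: "0 < e"
    obtain g \<rho> where g: "(g, \<rho>) \<in> sobolev_reps m p f" "Lp_energy m p f + Lp_energy m p \<rho> \<le> r powr p + e"
      using f e unfolding W1p_ball_iff[OF p r] by blast
    obtain h \<sigma> where h: "(h, \<sigma>) \<in> sobolev_reps m p k" "Lp_energy m p k + Lp_energy m p \<sigma> \<le> r powr p + e"
      using k e unfolding W1p_ball_iff[OF p r] by blast
    have "in_Lp m p \<rho>" "in_Lp m p \<sigma>" using g h by (auto simp: in_sobolev_reps_iff)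
    then have "Lp_energy m p (\<lambda>x. (1 - t) * f x + t * k x) + Lp_energy m p (\<lambda>x. (1 - t) * \<rho> x + t * \<sigma> x)
        \<le> ((1 - t) * Lp_energy m p f + t * Lp_energy m p k) + ((1 - t) * Lp_energy m p \<rho> + t * Lp_energy m p \<sigma>)"
      by (intro add_mono Lp_energy_convex p t fL kL)
    also have "\<dots> = (1 - t) * (Lp_energy m p f + Lp_energy m p \<rho>) + t * (Lp_energy m p k + Lp_energy m p \<sigma>)"
      by (simp add: algebra_simps)
    also have "\<dots> \<le> (1 - t) * (r powr p + e) + t * (r powr p + e)"
      by (intro add_mono mult_left_mono g h) (use t in auto)
    also have "\<dots> = r powr p + e" by (simp add: algebra_simps)
    finally show "\<exists>g \<rho>. (g, \<rho>) \<in> sobolev_reps m p (\<lambda>x. (1 - t) * f x + t * k x) \<and>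
        Lp_energy m p (\<lambda>x. (1 - t) * f x + t * k x) + Lp_energy m p \<rho> \<le> r powr p + e"
      using sobolev_reps_lincomb[OF m p g(1) h(1), of "1 - t" t] t by auto
  qed (intro in_Lp_lincomb p fL kL)
qed

lemma W1p_ball_cmult:
  assumes m: "sets m = sets borel" and p: "1 < p" and r: "0 \<le> r" and f: "f \<in> W1p_ball m p r"
  shows "(\<lambda>x. c * f x) \<in> W1p_ball m p (\<bar>c\<bar> * r)"
proof (cases "c = 0")
  case True
  then show ?thesis using zero_in_W1p_ball[OF p, of 0] by simp
next
  case False
  have r': "0 \<le> \<bar>c\<bar> * r" using r by simp
  show ?thesis
    unfolding W1p_ball_iff[OF p r']
  proof (intro conjI allI impI in_Lp_cmult)
    show "in_Lp m p f" using f by (simp add: W1p_ball_iff[OF p r])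
    fix e :: real assume e: "0 < e"
    have c: "0 < \<bar>c\<bar> powr p" using False by simp
    \<comment> \<open>Scaling by \<open>c\<close> multiplies energies by \<bar>c\<bar>^p, so the
      slack is divided by it beforehand.\<close>
    then have "0 < e / \<bar>c\<bar> powr p" using e by simp
    then obtain g \<rho> where g: "(g, \<rho>) \<in> sobolev_reps m p f"
      "Lp_energy m p f + Lp_energy m p \<rho> \<le> r powr p + e / \<bar>c\<bar> powr p"
      using f unfolding W1p_ball_iff[OF p r] by blast
    have "\<bar>c\<bar> powr p * (Lp_energy m p f + Lp_energy m p \<rho>) \<le> \<bar>c\<bar> powr p * (r powr p + e / \<bar>c\<bar> powr p)"
      using g(2) c by (intro mult_left_mono) auto
    also have "\<dots> = (\<bar>c\<bar> * r) powr p + e"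
      using c r by (simp add: powr_mult distrib_left)
    finally have "Lp_energy m p (\<lambda>x. c * f x) + Lp_energy m p (\<lambda>x. \<bar>c\<bar> * \<rho> x) \<le> (\<bar>c\<bar> * r) powr p + e"
      by (simp add: Lp_energy_cmult distrib_left)
    then show "\<exists>g \<rho>. (g, \<rho>) \<in> sobolev_reps m p (\<lambda>x. c * f x) \<and>
        Lp_energy m p (\<lambda>x. c * f x) + Lp_energy m p \<rho> \<le> (\<bar>c\<bar> * r) powr p + e"
      using sobolev_reps_lincomb[OF m p g(1) g(1), of c 0] by auto
  qed
qed

text \<open>Lower semicontinuity of the Sobolev norm: the upper gradients of a sequence converging in
  \<open>L\<^sup>p\<close> need not converge, but suitable convex combinations of their tails do.\<close>

lemma W1p_ball_closed:
  assumes m: "sets m = sets borel" and p: "1 < p" and r: "0 \<le> r"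
  shows "Lp_closed m p (W1p_ball m p r)"
proof (rule Lp_closedI)
  fix u w assume u: "\<And>n. u n \<in> W1p_ball m p r" and w: "in_Lp m p w"
    and lim: "(\<lambda>n. Lp_energy m p (\<lambda>x. u n x - w x)) \<longlonglongrightarrow> 0"
  have uL: "in_Lp m p (u n)" for n using u by (simp add: W1p_ball_iff[OF p r])
  \<comment> \<open>Gradients of functions close to \<open>w\<close>: a convex combination of
    gradients belongs to the same combination of functions, which remains close to
    \<open>w\<close>.\<close>
  define C where "C = (\<lambda>k::nat. {\<rho>. in_Lp m p \<rho> \<and> (\<exists>v g. in_Lp m p v \<and> (g, \<rho>) \<in> sobolev_reps m p v
    \<and> Lp_energy m p (\<lambda>x. v x - w x) \<le> 1 / real (Suc k))})"
  have CL: "in_Lp m p \<rho>" if "\<rho> \<in> C k" for k \<rho> using that by (simp add: C_def)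
  have conv: "fun_convex (C k)" for k
  proof (rule fun_convexI)
    fix \<rho> \<sigma> t assume \<rho>: "\<rho> \<in> C k" and \<sigma>: "\<sigma> \<in> C k" and t: "0 \<le> t" "t \<le> (1::real)"
    obtain v g where v: "in_Lp m p v" "(g, \<rho>) \<in> sobolev_reps m p v"
      "Lp_energy m p (\<lambda>x. v x - w x) \<le> 1 / real (Suc k)"
      using \<rho> by (auto simp: C_def)
    obtain v' g' where v': "in_Lp m p v'" "(g', \<sigma>) \<in> sobolev_reps m p v'"
      "Lp_energy m p (\<lambda>x. v' x - w x) \<le> 1 / real (Suc k)"
      using \<sigma> by (auto simp: C_def)
    have "Lp_energy m p (\<lambda>x. ((1 - t) * v x + t * v' x) - w x)
        = Lp_energy m p (\<lambda>x. (1 - t) * (v x - w x) + t * (v' x - w x))"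
      by (simp add: algebra_simps)
    also have "\<dots> \<le> (1 - t) * Lp_energy m p (\<lambda>x. v x - w x) + t * Lp_energy m p (\<lambda>x. v' x - w x)"
      by (intro Lp_energy_convex in_Lp_diff p t v v' w)
    also have "\<dots> \<le> (1 - t) * (1 / real (Suc k)) + t * (1 / real (Suc k))"
      by (intro add_mono mult_left_mono v v') (use t in auto)
    also have "\<dots> = 1 / real (Suc k)" by (simp only: distrib_right[symmetric]) simp
    finally have "Lp_energy m p (\<lambda>x. ((1 - t) * v x + t * v' x) - w x) \<le> 1 / real (Suc k)" .
    moreover have "(\<lambda>x. (1 - t) * g x + t * g' x, \<lambda>x. (1 - t) * \<rho> x + t * \<sigma> x)
        \<in> sobolev_reps m p (\<lambda>x. (1 - t) * v x + t * v' x)"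
      using sobolev_reps_lincomb[OF m p v(2) v'(2), of "1 - t" t] t by simp
    ultimately show "(\<lambda>x. (1 - t) * \<rho> x + t * \<sigma> x) \<in> C k"
      unfolding C_def using in_Lp_lincomb[OF p CL[OF \<rho>] CL[OF \<sigma>]] in_Lp_lincomb[OF p v(1) v'(1)] by blast
  qed
  have dec: "C k \<subseteq> C j" if "j \<le> k" for j k
  proof -
    have "1 / real (Suc k) \<le> 1 / real (Suc j)" using that by (intro divide_left_mono) auto
    then show ?thesis unfolding C_def by (blast intro: order_trans)
  qed
  \<comment> \<open>By the tangent at \<open>w\<close>, the energy of \<open>u n\<close> eventually
    exceeds that of \<open>w\<close> minus \<open>e / 2\<close>; the rest of the budget
    \<open>r powr p\<close> bounds the gradient.\<close>
  have small: "\<exists>\<rho>\<in>C k. Lp_energy m p \<rho> \<le> r powr p - Lp_energy m p w + e" if e: "0 < e" for k e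
  proof -
    let ?L = "\<lambda>n. p * (\<integral>x. (u n x - w x) * sgn_powr p (w x) \<partial>m)"
    have "(\<lambda>n. \<integral>x. (u n x - w x) * sgn_powr p (w x) \<partial>m) \<longlonglongrightarrow> (\<integral>x. 0 * sgn_powr p (w x) \<partial>m)"
      using lim by (intro tendsto_integral_mult[OF p]) (auto intro!: in_Lp_diff in_Lp_sgn_powr p uL w)
    then have "?L \<longlonglongrightarrow> 0" by (auto intro!: tendsto_eq_intros)
    then have "\<forall>\<^sub>F n in sequentially. - (e / 2) < ?L n"
      using e by (intro order_tendstoD) auto
    moreover have "\<forall>\<^sub>F n in sequentially. Lp_energy m p (\<lambda>x. u n x - w x) < 1 / real (Suc k)"
      by (intro order_tendstoD(2)[OF lim]) simp
    ultimately have "\<forall>\<^sub>F n in sequentially. - (e / 2) < ?L n \<and> Lp_energy m p (\<lambda>x. u n x - w x) < 1 / real (Suc k)"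
      by eventually_elim simp
    then obtain n where n: "- (e / 2) < ?L n" "Lp_energy m p (\<lambda>x. u n x - w x) < 1 / real (Suc k)"
      by (auto simp: eventually_sequentially)
    have "0 < e / 2" using e by simp
    then obtain g \<rho> where g: "(g, \<rho>) \<in> sobolev_reps m p (u n)"
      "Lp_energy m p (u n) + Lp_energy m p \<rho> \<le> r powr p + e / 2"
      using u[of n] unfolding W1p_ball_iff[OF p r] by blast
    have "Lp_energy m p \<rho> \<le> r powr p - Lp_energy m p w + e"
      using Lp_energy_tangent[OF p w uL[of n]] n(1) g(2) by linarith
    moreover have "\<rho> \<in> C k"
      unfolding C_def using g(1) uL[of n] n(2) by (auto simp: in_sobolev_reps_iff intro!: less_imp_le)
    ultimately show ?thesis by blast
  qed
  obtain \<rho> \<rho>0 where \<rho>: "\<And>k. \<rho> k \<in> C k" and \<rho>0: "in_Lp m p \<rho>0"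
    and \<rho>_lim: "(\<lambda>k. Lp_energy m p (\<lambda>x. \<rho> k x - \<rho>0 x)) \<longlonglongrightarrow> 0"
    and \<rho>0_le: "\<And>b. (\<And>k. \<exists>v\<in>C k. Lp_energy m p v \<le> b) \<Longrightarrow> Lp_energy m p \<rho>0 \<le> b"
    by (rule Lp_nested_convex_limit[where C = C and M = m and p = p, OF p _ conv _ small[OF zero_less_one]])
      (use CL dec in blast)+
  have "\<forall>k. \<exists>vg. in_Lp m p (fst vg) \<and> (snd vg, \<rho> k) \<in> sobolev_reps m p (fst vg)
      \<and> Lp_energy m p (\<lambda>x. fst vg x - w x) \<le> 1 / real (Suc k)"
    using \<rho> by (force simp: C_def)
  from choice[OF this] obtain vg where vg: "\<And>k. in_Lp m p (fst (vg k))"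
    "\<And>k. (snd (vg k), \<rho> k) \<in> sobolev_reps m p (fst (vg k))"
    "\<And>k. Lp_energy m p (\<lambda>x. fst (vg k) x - w x) \<le> 1 / real (Suc k)"
    by blast
  have vlim: "(\<lambda>k. Lp_energy m p (\<lambda>x. fst (vg k) x - w x)) \<longlonglongrightarrow> 0"
    by (rule tendsto_sandwich[OF _ _ tendsto_const LIMSEQ_Suc[OF lim_1_over_n]]) (use vg(3) in auto)
  obtain g0 where g0: "(g0, \<lambda>x. \<bar>\<rho>0 x\<bar>) \<in> sobolev_reps m p w"
    by (rule sobolev_reps_closed[OF m p vg(1) w vlim vg(2) \<rho>0 \<rho>_lim])
  show "w \<in> W1p_ball m p r"
    unfolding W1p_ball_iff[OF p r]
  proof (intro conjI allI impI w)
    fix e :: real assume e: "0 < e"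
    have "Lp_energy m p w + Lp_energy m p (\<lambda>x. \<bar>\<rho>0 x\<bar>) \<le> r powr p + e"
      using \<rho>0_le[OF small[OF e]] by (simp add: Lp_energy_def)
    then show "\<exists>g \<rho>. (g, \<rho>) \<in> sobolev_reps m p w \<and> Lp_energy m p w + Lp_energy m p \<rho> \<le> r powr p + e"
      using g0 by blast
  qed
qed

lemma W1p_ball_in_Lp: "f \<in> W1p_ball m p r \<Longrightarrow> in_Lp m p f"
  by (simp add: W1p_ball_def in_W1p_in_Lp)

section \<open>Functionals on the Sobolev space\<close>

lemma W1p_ball_mono: "r \<le> s \<Longrightarrow> W1p_ball m p r \<subseteq> W1p_ball m p s"
  by (auto simp: W1p_ball_def)

lemma W_dual_lincomb:
  "W_dual m p T \<Longrightarrow> in_W1p m p f \<Longrightarrow> in_W1p m p g \<Longrightarrow> T (\<lambda>x. a * f x + b * g x) = a * T f + b * T g"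
  by (simp add: W_dual_def)

lemma W_dual_cmult: "W_dual m p T \<Longrightarrow> in_W1p m p f \<Longrightarrow> T (\<lambda>x. c * f x) = c * T f"
  using W_dual_lincomb[of m p T f f c 0] by simp

lemma W_dual_zero: "W_dual m p T \<Longrightarrow> T (\<lambda>x. 0) = 0"
  using W_dual_cmult[OF _ in_W1p_zero, of m p T 0] by simp

lemma W_dual_norm_eq: "W_dual_norm m p T = (SUP f\<in>W1p_ball m p 1. \<bar>T f\<bar>)"
  by (simp add: W_dual_norm_def W1p_ball_def)

lemma W_dual_norm_upper:
  assumes T: "W_dual m p T" and f: "f \<in> W1p_ball m p 1"
  shows "\<bar>T f\<bar> \<le> W_dual_norm m p T"
proof -
  obtain C where C: "\<And>f. in_W1p m p f \<Longrightarrow> \<bar>T f\<bar> \<le> C * W1p_norm m p f"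
    using T by (auto simp: W_dual_def)
  have "\<bar>T f\<bar> \<le> \<bar>C\<bar>" if "f \<in> W1p_ball m p 1" for f
  proof -
    have "C * W1p_norm m p f \<le> \<bar>C\<bar> * 1"
      using that by (intro mult_mono) (auto simp: W1p_ball_def)
    then show ?thesis using C[of f] that by (simp add: W1p_ball_def)
  qed
  then have "bdd_above ((\<lambda>f. \<bar>T f\<bar>) ` W1p_ball m p 1)"
    by (intro bdd_aboveI2)
  then show ?thesis
    unfolding W_dual_norm_eq using f by (rule cSUP_upper[rotated])
qed

lemma W_dual_norm_le:
  assumes "1 < p" "\<And>f. f \<in> W1p_ball m p 1 \<Longrightarrow> \<bar>T f\<bar> \<le> c"
  shows "W_dual_norm m p T \<le> c"
  unfolding W_dual_norm_eq using zero_in_W1p_ball[OF assms(1), of 1 m] assms(2)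
  by (intro cSUP_least) auto

lemma W_dual_norm_nonneg: "1 < p \<Longrightarrow> W_dual m p T \<Longrightarrow> 0 \<le> W_dual_norm m p T"
  using W_dual_norm_upper[OF _ zero_in_W1p_ball, of m p T] W_dual_zero[of m p T] by simp

lemma W_dual_bound:
  assumes m: "sets m = sets borel" and p: "1 < p" and T: "W_dual m p T" and f: "in_W1p m p f"
  shows "\<bar>T f\<bar> \<le> W_dual_norm m p T * W1p_norm m p f"
proof (cases "W1p_norm m p f = 0")
  case True
  \<comment> \<open>A function of norm 0 cannot be scaled, but boundedness forces
    \<open>T f = 0\<close>.\<close>
  obtain C where "\<bar>T f\<bar> \<le> C * W1p_norm m p f"
    using T f by (auto simp: W_dual_def)
  then show ?thesis using True by simp
next
  case False
  let ?n = "W1p_norm m p f"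
  have n: "0 < ?n" using False by (simp add: less_le)
  have "f \<in> W1p_ball m p ?n" using f by (simp add: W1p_ball_def)
  then have "(\<lambda>x. (1 / ?n) * f x) \<in> W1p_ball m p (\<bar>1 / ?n\<bar> * ?n)"
    by (intro W1p_ball_cmult m p) auto
  then have "(\<lambda>x. (1 / ?n) * f x) \<in> W1p_ball m p 1" using n by simp
  from W_dual_norm_upper[OF T this] have "\<bar>T f\<bar> / ?n \<le> W_dual_norm m p T"
    using n by (simp only: W_dual_cmult[OF T f] abs_mult) simp
  then show ?thesis using n by (simp add: field_simps)
qed

section \<open>Functionals continuous under bounded L^p convergence\<close>

lemma W_dual_pd_imp_W_dual: "W_dual_pd m p T \<Longrightarrow> W_dual m p T"
  by (simp add: W_dual_pd_def)

lemma W_dual_pd_tendsto: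
  assumes p: "1 < p" and T: "W_dual_pd m p T"
    and F: "\<And>n. F n \<in> W1p_ball m p r" and f: "in_W1p m p f"
    and lim: "(\<lambda>n. Lp_energy m p (\<lambda>x. F n x - f x)) \<longlonglongrightarrow> 0"
  shows "(\<lambda>n. T (F n)) \<longlonglongrightarrow> T f"
proof -
  have "in_Lp m p (\<lambda>x. F n x - f x)" for n
    using F by (intro in_Lp_diff p W1p_ball_in_Lp in_W1p_in_Lp f)
  then have "(\<lambda>n. Lp_norm m p (\<lambda>x. F n x - f x)) \<longlonglongrightarrow> 0"
    using lim Lp_norm_tendsto_0_iff[OF p, of m "\<lambda>n x. F n x - f x"] by blast
  moreover have "bounded (range (\<lambda>n. W1p_norm m p (F n)))"
    using F by (intro boundedI[of _ r]) (auto simp: W1p_ball_def)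
  ultimately show ?thesis
    using T F f unfolding W_dual_pd_def W1p_ball_def by blast
qed

lemma W_dual_pd_lincomb:
  assumes S: "W_dual_pd m p S" and T: "W_dual_pd m p T"
  shows "W_dual_pd m p (\<lambda>f. a * S f + b * T f)"
proof -
  obtain C D where C: "\<And>f. in_W1p m p f \<Longrightarrow> \<bar>S f\<bar> \<le> C * W1p_norm m p f"
    and D: "\<And>f. in_W1p m p f \<Longrightarrow> \<bar>T f\<bar> \<le> D * W1p_norm m p f"
    using S T unfolding W_dual_pd_def W_dual_def by blast
  have "\<bar>a * S f + b * T f\<bar> \<le> (\<bar>a\<bar> * C + \<bar>b\<bar> * D) * W1p_norm m p f" if "in_W1p m p f" for f
  proof -
    have "\<bar>a * S f + b * T f\<bar> \<le> \<bar>a\<bar> * \<bar>S f\<bar> + \<bar>b\<bar> * \<bar>T f\<bar>"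
      by (metis abs_mult abs_triangle_ineq)
    also have "\<dots> \<le> \<bar>a\<bar> * (C * W1p_norm m p f) + \<bar>b\<bar> * (D * W1p_norm m p f)"
      by (intro add_mono mult_left_mono C D that) auto
    finally show ?thesis by (simp add: algebra_simps)
  qed
  moreover have "a * S (\<lambda>x. c * f x + d * g x) + b * T (\<lambda>x. c * f x + d * g x)
      = c * (a * S f + b * T f) + d * (a * S g + b * T g)" if "in_W1p m p f" "in_W1p m p g" for f g c d
    unfolding W_dual_lincomb[OF W_dual_pd_imp_W_dual[OF S] that] W_dual_lincomb[OF W_dual_pd_imp_W_dual[OF T] that]
    by (simp add: algebra_simps)
  ultimately have "W_dual m p (\<lambda>f. a * S f + b * T f)"
    unfolding W_dual_def by blast
  then show ?thesis
    using S T unfolding W_dual_pd_def by (auto intro!: tendsto_intros)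
qed

lemma W_dual_pd_pairing_functional:
  assumes p: "1 < p" and g: "in_Lp m (conj_exp p) g"
  shows "W_dual_pd m p (pairing_functional m g)"
    and "W_dual_norm m p (pairing_functional m g) \<le> Lp_norm m (conj_exp p) g"
proof -
  let ?L = "pairing_functional m g"
  have bound: "\<bar>?L f\<bar> \<le> Lp_norm m (conj_exp p) g * W1p_norm m p f" if f: "in_W1p m p f" for f
  proof -
    have "\<bar>?L f\<bar> \<le> Lp_norm m p f * Lp_norm m (conj_exp p) g"
      unfolding pairing_functional_def by (rule Holder_inequality(2)[OF p in_W1p_in_Lp[OF f] g])
    also have "\<dots> \<le> W1p_norm m p f * Lp_norm m (conj_exp p) g"
      by (intro mult_right_mono Lp_norm_le_W1p_norm p f) simp
    finally show ?thesis by (simp add: mult.commute)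
  qed
  have "?L (\<lambda>x. a * f x + b * k x) = a * ?L f + b * ?L k" if "in_W1p m p f" "in_W1p m p k" for f k a b
    using Holder_inequality(1)[OF p in_W1p_in_Lp[OF that(1)] g] Holder_inequality(1)[OF p in_W1p_in_Lp[OF that(2)] g]
    by (simp add: pairing_functional_def distrib_right mult.assoc)
  then have "W_dual m p ?L"
    unfolding W_dual_def using bound by blast
  moreover have "(\<lambda>n. ?L (F n)) \<longlonglongrightarrow> ?L f"
    if F: "\<And>n. in_W1p m p (F n)" and f: "in_W1p m p f"
      and lim: "(\<lambda>n. Lp_norm m p (\<lambda>x. F n x - f x)) \<longlonglongrightarrow> 0" for F f
  proof -
    have "in_Lp m p (\<lambda>x. F n x - f x)" for n
      by (intro in_Lp_diff p in_W1p_in_Lp F f)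
    then have "(\<lambda>n. Lp_energy m p (\<lambda>x. F n x - f x)) \<longlonglongrightarrow> 0"
      using lim Lp_norm_tendsto_0_iff[OF p, of m "\<lambda>n x. F n x - f x"] by blast
    then show ?thesis
      unfolding pairing_functional_def by (intro tendsto_integral_mult[OF p] in_W1p_in_Lp F f g)
  qed
  ultimately show "W_dual_pd m p ?L"
    unfolding W_dual_pd_def by blast
  show "W_dual_norm m p ?L \<le> Lp_norm m (conj_exp p) g"
  proof (rule W_dual_norm_le[OF p])
    fix f assume f: "f \<in> W1p_ball m p 1"
    then have "\<bar>?L f\<bar> \<le> Lp_norm m (conj_exp p) g * W1p_norm m p f"
      by (intro bound) (simp add: W1p_ball_def)
    also have "\<dots> \<le> Lp_norm m (conj_exp p) g * 1"
      using f by (intro mult_left_mono) (auto simp: W1p_ball_def)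
    finally show "\<bar>?L f\<bar> \<le> Lp_norm m (conj_exp p) g" by simp
  qed
qed

text \<open>Projecting the origin onto \<open>{u. T u \<ge> \<epsilon>}\<close> within the unit ball yields \<open>g\<^sub>0\<close> such that \<open>T\<close> is
  smaller than \<open>\<epsilon>\<close> on the unit ball intersected with the kernel of \<open>L\<close> for \<open>g\<^sub>0\<close>; hence \<open>T\<close> is close
  to a multiple of that \<open>L\<close>.\<close>

lemma pairing_functional_dense:
  assumes m: "sets m = sets borel" and p: "1 < p" and T: "W_dual_pd m p T" and e: "0 < e"
  obtains g where "in_Lp m (conj_exp p) g"
    "\<And>u. u \<in> W1p_ball m p 1 \<Longrightarrow> \<bar>T u - pairing_functional m g u\<bar> \<le> e"
proof -
  let ?B = "W1p_ball m p 1"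
  define K where "K = {u \<in> ?B. e / 3 \<le> T u}"
  have TW: "W_dual m p T" using T by (rule W_dual_pd_imp_W_dual)
  have BW: "in_W1p m p u" if "u \<in> ?B" for u using that by (simp add: W1p_ball_def)
  have B_cmult: "(\<lambda>x. c * u x) \<in> ?B" if "u \<in> ?B" "\<bar>c\<bar> \<le> 1" for u c
    using W1p_ball_cmult[OF m p _ that(1), of c] W1p_ball_mono[of "\<bar>c\<bar> * 1" 1 m p] that(2) by auto
  \<comment> \<open>The ball is symmetric, so a large negative value of \<open>T\<close> at u puts -
    u into \<open>K\<close>.\<close>
  have small: "\<bar>T u\<bar> \<le> e / 3" if u: "u \<in> ?B" "u \<notin> K" "(\<lambda>x. (- 1) * u x) \<notin> K" for u
    using u W_dual_cmult[OF TW BW[OF u(1)], of "- 1"] B_cmult[OF u(1), of "- 1"] by (auto simp: K_def)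
  show ?thesis
  proof (cases "K = {}")
    case True
    show ?thesis
    proof (rule that[of "\<lambda>_. 0"])
      fix u assume "u \<in> ?B"
      then have "\<bar>T u\<bar> \<le> e / 3" using small True by blast
      then show "\<bar>T u - pairing_functional m (\<lambda>_. 0) u\<bar> \<le> e"
        using e by (simp add: pairing_functional_def)
    qed simp
  next
    case False
    have "fun_convex K"
    proof (rule fun_convexI)
      fix u v t assume u: "u \<in> K" and v: "v \<in> K" and t: "0 \<le> t" "t \<le> (1::real)"
      have "(\<lambda>x. (1 - t) * u x + t * v x) \<in> ?B"
        using u v t by (intro fun_convexD[OF W1p_ball_convex[OF m p]]) (auto simp: K_def)
      moreover have "e / 3 \<le> (1 - t) * T u + t * T v"
      proof -
        have "(1 - t) * (e / 3) + t * (e / 3) \<le> (1 - t) * T u + t * T v"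
          using u v t by (intro add_mono mult_left_mono) (auto simp: K_def)
        moreover have "(1 - t) * (e / 3) + t * (e / 3) = e / 3"
          by (simp only: distrib_right[symmetric]) simp
        ultimately show ?thesis by simp
      qed
      moreover have "T (\<lambda>x. (1 - t) * u x + t * v x) = (1 - t) * T u + t * T v"
        using u v by (intro W_dual_lincomb[OF TW] BW) (auto simp: K_def)
      ultimately show "(\<lambda>x. (1 - t) * u x + t * v x) \<in> K" by (simp add: K_def)
    qed
    moreover have "Lp_closed m p K"
    proof (rule Lp_closedI)
      fix u w assume u: "\<And>n. u n \<in> K" and w: "in_Lp m p w"
        and lim: "(\<lambda>n. Lp_energy m p (\<lambda>x. u n x - w x)) \<longlonglongrightarrow> 0"
      have uB: "u n \<in> ?B" "e / 3 \<le> T (u n)" for n using u[of n] by (auto simp: K_def)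
      have "w \<in> ?B" by (rule Lp_closedD[OF W1p_ball_closed[OF m p] uB(1) w lim]) simp
      moreover have "(\<lambda>n. T (u n)) \<longlonglongrightarrow> T w"
        by (rule W_dual_pd_tendsto[OF p T uB(1) BW[OF \<open>w \<in> ?B\<close>] lim])
      then have "e / 3 \<le> T w" using uB(2) by (intro LIMSEQ_le_const) auto
      ultimately show "w \<in> K" by (simp add: K_def)
    qed
    ultimately obtain u0 where u0: "u0 \<in> K"
      and var: "\<And>v. v \<in> K \<Longrightarrow> 0 \<le> (\<integral>x. (v x - u0 x) * sgn_powr p (u0 x) \<partial>m)"
      using Lp_projection[OF p False, of m] W1p_ball_in_Lp unfolding K_def by blast
    have u0L: "in_Lp m p u0" and u0B: "u0 \<in> ?B" using u0 by (auto simp: K_def W1p_ball_in_Lp)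
    define g0 where "g0 = (\<lambda>x. sgn_powr p (u0 x))"
    have g0: "in_Lp m (conj_exp p) g0" unfolding g0_def by (rule in_Lp_sgn_powr[OF p u0L])
    define P where "P = pairing_functional m g0"
    have PW: "W_dual m p P"
      unfolding P_def by (intro W_dual_pd_imp_W_dual W_dual_pd_pairing_functional p g0)
    have P_u0: "P u0 = Lp_energy m p u0"
      unfolding P_def pairing_functional_def g0_def by (rule integral_mult_sgn_powr[OF p])
    have P_K: "P u0 \<le> P v" if "v \<in> K" for v
    proof -
      have "in_Lp m p v" using that by (auto simp: K_def W1p_ball_in_Lp)
      moreover have "0 \<le> (\<integral>x. (v x - u0 x) * g0 x \<partial>m)"
        using var[OF that] by (simp add: g0_def)
      ultimately show ?thesis
        using Holder_inequality(1)[OF p _ g0] u0L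
        by (simp add: P_def pairing_functional_def left_diff_distrib)
    qed
    \<comment> \<open>Otherwise \<open>u0\<close> vanishes a.e.; the zero sequence then converges to
      it in L^p, and continuity of \<open>T\<close> gives \<open>T u0 = 0\<close>.\<close>
    have "P u0 \<noteq> 0"
    proof
      assume "P u0 = 0"
      then have "(\<lambda>n. T ((\<lambda>n::nat. \<lambda>x. 0) n)) \<longlonglongrightarrow> T u0"
        by (intro W_dual_pd_tendsto[OF p T zero_in_W1p_ball[OF p zero_le_one] BW[OF u0B]])
          (simp add: P_u0 Lp_energy_def)
      then have "T u0 = 0"
        by (simp add: W_dual_zero[OF TW] LIMSEQ_const_iff)
      then show False using u0 e by (simp add: K_def)
    qed
    then have P_pos: "0 < P u0" using P_u0 by (simp add: less_le)
    define M where "M = (SUP u\<in>?B. P u)"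
    have bdd: "bdd_above (P ` ?B)"
      by (rule bdd_aboveI2[of _ _ "W_dual_norm m p P"])
        (use W_dual_norm_upper[OF PW] in \<open>auto simp: abs_le_iff\<close>)
    have le_M: "P u \<le> M" if "u \<in> ?B" for u unfolding M_def by (rule cSUP_upper[OF that bdd])
    have M: "0 < M" using P_pos le_M[OF u0B] by simp
    then have "M / 2 < (SUP u\<in>?B. P u)" by (simp add: M_def)
    \<comment> \<open>An almost maximal value replaces a maximizer of \<open>P\<close>; the loss is
      the factor 2 in \<open>abs_le\<close>.\<close>
    then obtain w where w: "w \<in> ?B" "M / 2 < P w"
      using less_cSUP_iff[OF _ bdd, of "M / 2"] u0B by blast
    have abs_le: "\<bar>P u\<bar> \<le> 2 * P w" if "u \<in> ?B" for u
      using le_M[OF that] le_M[OF B_cmult[OF that, of "- 1"]] w(2) W_dual_cmult[OF PW BW[OF that], of "- 1"]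
      by simp
    have Pw: "0 < P w" using w(2) M by simp
    let ?g = "\<lambda>x. (T w / P w) * g0 x"
    show ?thesis
    proof (rule that[of ?g])
      show "in_Lp m (conj_exp p) ?g" by (rule in_Lp_cmult[OF g0])
      fix u assume u: "u \<in> ?B"
      \<comment> \<open>Chosen so that \<open>v\<close> is one third of u - (P u / P w) w, the
        component of u in the kernel of \<open>P\<close>, and still a convex combination of ball
        elements. The factor 3 explains \<open>e / 3\<close>.\<close>
      define c where "c = - (P u / (2 * P w))"
      have c: "\<bar>c\<bar> \<le> 1" using abs_le[OF u] Pw by (simp add: c_def abs_divide)
      define v where "v = (\<lambda>x. (1 - 2 / 3) * u x + 2 / 3 * (c * w x))"
      have cw: "(\<lambda>x. c * w x) \<in> ?B" by (rule B_cmult[OF w(1) c])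
      have vB: "v \<in> ?B"
        unfolding v_def by (rule fun_convexD[OF W1p_ball_convex[OF m p] u cw]) auto
      have S_v: "S v = (1 / 3) * (S u - (P u / P w) * S w)" if "W_dual m p S" for S
        unfolding v_def W_dual_lincomb[OF that BW[OF u] BW[OF cw]] W_dual_cmult[OF that BW[OF w(1)]]
        by (simp add: c_def field_simps)
      have P_v: "P v = 0" using S_v[OF PW] Pw by simp
      then have "P (\<lambda>x. (- 1) * v x) = 0" using W_dual_cmult[OF PW BW[OF vB], of "- 1"] by simp
      \<comment> \<open>\<open>P\<close> is at least \<open>P u0 > 0\<close> on \<open>K\<close>, so
        neither v nor - v lies in \<open>K\<close>.\<close>
      then have "\<bar>T v\<bar> \<le> e / 3" using P_v P_K P_pos by (intro small vB) force+
      then have "\<bar>T u - (P u / P w) * T w\<bar> \<le> e" using S_v[OF TW] by (simp add: abs_mult)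
      moreover have "pairing_functional m ?g u = (P u / P w) * T w"
      proof -
        have "pairing_functional m ?g u = (\<integral>x. (T w / P w) * (u x * g0 x) \<partial>m)"
          unfolding pairing_functional_def by (rule Bochner_Integration.integral_cong) auto
        also have "\<dots> = (T w / P w) * P u"
          by (simp only: integral_mult_right_zero P_def pairing_functional_def)
        finally show ?thesis by simp
      qed
      ultimately show "\<bar>T u - pairing_functional m ?g u\<bar> \<le> e" by simp
    qed
  qed
qed

section \<open>The bidual\<close>

lemma pd_bidual_lincomb:
  "pd_bidual m p \<Omega> \<Longrightarrow> W_dual_pd m p S \<Longrightarrow> W_dual_pd m p T \<Longrightarrow>
    \<Omega> (\<lambda>f. a * S f + b * T f) = a * \<Omega> S + b * \<Omega> T"
  by (simp add: pd_bidual_def)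

text \<open>Functionals on \<open>W\<^sup>1\<^sup>,\<^sup>p\<close> are encoded as functions on all real functions; an element of the
  bidual does not see their values outside \<open>W\<^sup>1\<^sup>,\<^sup>p\<close>.\<close>

lemma pd_bidual_cong:
  assumes p: "1 < p" and \<Omega>: "pd_bidual m p \<Omega>" and S: "W_dual_pd m p S" and T: "W_dual_pd m p T"
    and eq: "\<And>f. in_W1p m p f \<Longrightarrow> S f = T f"
  shows "\<Omega> S = \<Omega> T"
proof -
  obtain C where C: "\<And>T. W_dual_pd m p T \<Longrightarrow> \<bar>\<Omega> T\<bar> \<le> C * W_dual_norm m p T"
    using \<Omega> by (auto simp: pd_bidual_def)
  let ?D = "\<lambda>f. 1 * S f + (- 1) * T f"
  have D: "W_dual_pd m p ?D" by (rule W_dual_pd_lincomb[OF S T])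
  have "W_dual_norm m p ?D \<le> 0"
    using eq by (intro W_dual_norm_le[OF p]) (simp add: W1p_ball_def)
  then have "W_dual_norm m p ?D = 0"
    using W_dual_norm_nonneg[OF p W_dual_pd_imp_W_dual[OF D]] by simp
  then have "\<Omega> ?D = 0" using C[OF D] by simp
  then show ?thesis using pd_bidual_lincomb[OF \<Omega> S T, of 1 "- 1"] by simp
qed

lemma pd_bidual_norm_upper:
  assumes p: "1 < p" and \<Omega>: "pd_bidual m p \<Omega>" and T: "W_dual_pd m p T" "W_dual_norm m p T \<le> 1"
  shows "\<bar>\<Omega> T\<bar> \<le> pd_bidual_norm m p \<Omega>"
proof -
  obtain C where C: "\<And>T. W_dual_pd m p T \<Longrightarrow> \<bar>\<Omega> T\<bar> \<le> C * W_dual_norm m p T"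
    using \<Omega> by (auto simp: pd_bidual_def)
  have "bdd_above ((\<lambda>T. \<bar>\<Omega> T\<bar>) ` {T. W_dual_pd m p T \<and> W_dual_norm m p T \<le> 1})"
  proof (rule bdd_aboveI2)
    fix T assume "T \<in> {T. W_dual_pd m p T \<and> W_dual_norm m p T \<le> 1}"
    then have T: "W_dual_pd m p T" "W_dual_norm m p T \<le> 1" by auto
    have "C * W_dual_norm m p T \<le> \<bar>C\<bar> * 1"
      using T W_dual_norm_nonneg[OF p W_dual_pd_imp_W_dual[OF T(1)]] by (intro mult_mono) auto
    then show "\<bar>\<Omega> T\<bar> \<le> \<bar>C\<bar>" using C[OF T(1)] by simp
  qed
  then show ?thesis
    unfolding pd_bidual_norm_def using T by (intro cSUP_upper) auto
qed

lemma W_dual_pd_zero: "1 < p \<Longrightarrow> W_dual_pd m p (\<lambda>f. 0)"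
  using W_dual_pd_pairing_functional(1)[of p m "\<lambda>_. 0"] by (simp add: pairing_functional_def)

lemma W_dual_norm_zero: "1 < p \<Longrightarrow> W_dual_norm m p (\<lambda>f. 0) = 0"
  using W_dual_norm_le[of p m "\<lambda>f. 0" 0] W_dual_norm_nonneg[of p m "\<lambda>f. 0"]
    W_dual_pd_imp_W_dual[OF W_dual_pd_zero, of p m] by fastforce

lemma pd_bidual_norm_nonneg:
  assumes "1 < p" "pd_bidual m p \<Omega>"
  shows "0 \<le> pd_bidual_norm m p \<Omega>"
  using pd_bidual_norm_upper[OF assms W_dual_pd_zero[OF assms(1)]] assms(1)
  by (simp add: W_dual_norm_zero)

lemma pd_bidual_bound:
  assumes p: "1 < p" and \<Omega>: "pd_bidual m p \<Omega>" and T: "W_dual_pd m p T"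
  shows "\<bar>\<Omega> T\<bar> \<le> pd_bidual_norm m p \<Omega> * W_dual_norm m p T"
proof (cases "W_dual_norm m p T = 0")
  case True
  obtain C where "\<bar>\<Omega> T\<bar> \<le> C * W_dual_norm m p T"
    using \<Omega> T by (auto simp: pd_bidual_def)
  then show ?thesis using True by simp
next
  case False
  let ?n = "W_dual_norm m p T"
  have n: "0 < ?n" using False W_dual_norm_nonneg[OF p W_dual_pd_imp_W_dual[OF T]] by simp
  let ?S = "\<lambda>f. (1 / ?n) * T f + 0 * T f"
  have S: "W_dual_pd m p ?S" by (rule W_dual_pd_lincomb[OF T T])
  have "W_dual_norm m p ?S \<le> 1"
    using W_dual_norm_upper[OF W_dual_pd_imp_W_dual[OF T]] n
    by (intro W_dual_norm_le[OF p]) (simp add: abs_mult)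
  then have "\<bar>\<Omega> ?S\<bar> \<le> pd_bidual_norm m p \<Omega>" by (rule pd_bidual_norm_upper[OF p \<Omega> S])
  then have "\<bar>\<Omega> T\<bar> / ?n \<le> pd_bidual_norm m p \<Omega>"
    unfolding pd_bidual_lincomb[OF \<Omega> T T] using n by (simp add: abs_mult)
  then show ?thesis using n by (simp add: field_simps)
qed

text \<open>Shows that the choice in \<open>adjoint_L\<close> succeeds, by Riesz representation on
  L^q. Linearity in g passes through \<open>pd_bidual_cong\<close>, because the functionals compared
  are only shown to agree on W^{1,p}.\<close>

lemma adjoint_L_spec:
  assumes p: "1 < p" and \<Omega>: "pd_bidual m p \<Omega>"
  shows "in_Lp m p (adjoint_L m p \<Omega>)"
    and "\<And>g. in_Lp m (conj_exp p) g \<Longrightarrow>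
      \<Omega> (pairing_functional m g) = (\<integral>x. adjoint_L m p \<Omega> x * g x \<partial>m)"
proof -
  have q: "1 < conj_exp p" by (rule conj_exp_gt_1[OF p])
  note pd = W_dual_pd_pairing_functional(1)[OF p]
  obtain h where h: "in_Lp m (conj_exp (conj_exp p)) h"
    "\<And>g. in_Lp m (conj_exp p) g \<Longrightarrow> \<Omega> (pairing_functional m g) = (\<integral>x. g x * h x \<partial>m)"
  proof (rule Lp_Riesz_representation[OF q, where M = m])
    fix f g a b assume f: "in_Lp m (conj_exp p) f" and g: "in_Lp m (conj_exp p) g"
    have "\<Omega> (pairing_functional m (\<lambda>x. a * f x + b * g x))
        = \<Omega> (\<lambda>u. a * pairing_functional m f u + b * pairing_functional m g u)"
    proof (rule pd_bidual_cong[OF p \<Omega>])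
      fix u assume "in_W1p m p u"
      then have u: "in_Lp m p u" by (rule in_W1p_in_Lp)
      show "pairing_functional m (\<lambda>x. a * f x + b * g x) u
          = a * pairing_functional m f u + b * pairing_functional m g u"
        using Holder_inequality(1)[OF p u f] Holder_inequality(1)[OF p u g]
        by (simp add: pairing_functional_def distrib_left mult.left_commute)
    qed (intro pd W_dual_pd_lincomb in_Lp_lincomb q f g)+
    then show "\<Omega> (pairing_functional m (\<lambda>x. a * f x + b * g x))
        = a * \<Omega> (pairing_functional m f) + b * \<Omega> (pairing_functional m g)"
      using pd_bidual_lincomb[OF \<Omega> pd[OF f] pd[OF g]] by simp
  next
    fix g assume g: "in_Lp m (conj_exp p) g"
    have "\<bar>\<Omega> (pairing_functional m g)\<bar> \<le> pd_bidual_norm m p \<Omega> * W_dual_norm m p (pairing_functional m g)"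
      by (rule pd_bidual_bound[OF p \<Omega> pd[OF g]])
    also have "\<dots> \<le> pd_bidual_norm m p \<Omega> * Lp_norm m (conj_exp p) g"
      by (intro mult_left_mono W_dual_pd_pairing_functional(2) p g pd_bidual_norm_nonneg \<Omega>)
    finally show "\<bar>\<Omega> (pairing_functional m g)\<bar> \<le> pd_bidual_norm m p \<Omega> * Lp_norm m (conj_exp p) g" .
  qed (use that in blast)
  have "in_Lp m p h \<and> (\<forall>g. in_Lp m (conj_exp p) g \<longrightarrow> \<Omega> (pairing_functional m g) = (\<integral>x. h x * g x \<partial>m))"
    using h by (simp add: conj_exp_conj_exp[OF p] mult.commute)
  from someI[of "\<lambda>f. in_Lp m p f \<and> (\<forall>g. in_Lp m (conj_exp p) g \<longrightarrow>
    \<Omega> (pairing_functional m g) = (\<integral>x. f x * g x \<partial>m))", OF this]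
  show "in_Lp m p (adjoint_L m p \<Omega>)"
    "\<And>g. in_Lp m (conj_exp p) g \<Longrightarrow>
      \<Omega> (pairing_functional m g) = (\<integral>x. adjoint_L m p \<Omega> x * g x \<partial>m)"
    unfolding adjoint_L_def by blast+
qed

text \<open>Otherwise the nearest point in the ball would yield \<open>g\<close> separating \<open>adjoint_L m p \<Omega>\<close> from
  the ball, whose radius is the norm of \<open>\<Omega>\<close>; this contradicts \<open>\<bar>\<Omega> L\<^sub>g\<bar> \<le> \<parallel>\<Omega>\<parallel> \<parallel>L\<^sub>g\<parallel>\<close>.\<close>

lemma adjoint_L_in_W1p_ball:
  assumes m: "sets m = sets borel" and p: "1 < p" and \<Omega>: "pd_bidual m p \<Omega>"
  shows "adjoint_L m p \<Omega> \<in> W1p_ball m p (pd_bidual_norm m p \<Omega>)"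
proof -
  define f where "f = adjoint_L m p \<Omega>"
  define R where "R = pd_bidual_norm m p \<Omega>"
  let ?B = "W1p_ball m p R"
  note spec = adjoint_L_spec[OF p \<Omega>, folded f_def]
  have R: "0 \<le> R" unfolding R_def by (rule pd_bidual_norm_nonneg[OF p \<Omega>])
  note closed = W1p_ball_closed[OF m p R]
  \<comment> \<open>Translation by f turns the nearest point to f into a point of least
    norm.\<close>
  define C where "C = (\<lambda>u x. u x - f x) ` ?B"
  have CL: "in_Lp m p u" if "u \<in> C" for u
    using that in_Lp_diff[OF p W1p_ball_in_Lp spec(1)] by (auto simp: C_def)
  have "fun_convex C"
  proof (rule fun_convexI)
    fix u v t assume "u \<in> C" "v \<in> C" and t: "0 \<le> t" "t \<le> (1::real)"
    then obtain a b where ab: "a \<in> ?B" "b \<in> ?B" "u = (\<lambda>x. a x - f x)" "v = (\<lambda>x. b x - f x)"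
      by (auto simp: C_def)
    have "(\<lambda>x. (1 - t) * u x + t * v x) = (\<lambda>x. ((1 - t) * a x + t * b x) - f x)"
      by (simp add: ab algebra_simps)
    then show "(\<lambda>x. (1 - t) * u x + t * v x) \<in> C"
      unfolding C_def using fun_convexD[OF W1p_ball_convex[OF m p R] ab(1,2) t]
      by (intro image_eqI[where x = "\<lambda>x. (1 - t) * a x + t * b x"])
  qed
  moreover have "Lp_closed m p C"
  proof (rule Lp_closedI)
    fix u w assume u: "\<And>n. u n \<in> C" and w: "in_Lp m p w"
      and lim: "(\<lambda>n. Lp_energy m p (\<lambda>x. u n x - w x)) \<longlonglongrightarrow> 0"
    have "\<forall>n. \<exists>a\<in>?B. u n = (\<lambda>x. a x - f x)" using u by (auto simp: C_def)
    then obtain a where a: "\<And>n. a n \<in> ?B" "\<And>n. u n = (\<lambda>x. a n x - f x)" by metis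
    have "(\<lambda>x. w x + f x) \<in> ?B"
      using lim by (intro Lp_closedD[OF closed a(1)] in_Lp_add p w spec(1)) (simp add: a(2) algebra_simps)
    then show "w \<in> C" unfolding C_def by (force intro!: image_eqI[of _ _ "\<lambda>x. w x + f x"])
  qed
  moreover have "C \<noteq> {}" unfolding C_def using zero_in_W1p_ball[OF p R] by blast
  ultimately obtain w where "w \<in> C"
    and var: "\<And>v. v \<in> C \<Longrightarrow> 0 \<le> (\<integral>x. (v x - w x) * sgn_powr p (w x) \<partial>m)"
    using Lp_projection[OF p, of C m] CL by blast
  then obtain u0 where u0: "u0 \<in> ?B" and w: "w = (\<lambda>x. u0 x - f x)" by (auto simp: C_def)
  have wL: "in_Lp m p w" using CL \<open>w \<in> C\<close> .
  define g where "g = (\<lambda>x. sgn_powr p (w x))"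
  have g: "in_Lp m (conj_exp p) g" unfolding g_def by (rule in_Lp_sgn_powr[OF p wL])
  define P where "P = pairing_functional m g"
  have P_pd: "W_dual_pd m p P" unfolding P_def by (rule W_dual_pd_pairing_functional[OF p g])
  note int = Holder_inequality(1)[OF p _ g]
  have P_u0: "P u0 \<le> P v" if v: "v \<in> ?B" for v
  proof -
    have "0 \<le> (\<integral>x. (v x - u0 x) * g x \<partial>m)"
      using var[of "\<lambda>x. v x - f x"] v by (simp add: C_def w g_def)
    then show ?thesis
      using int[OF W1p_ball_in_Lp[OF v]] int[OF W1p_ball_in_Lp[OF u0]]
      by (simp add: P_def pairing_functional_def left_diff_distrib)
  qed
  have B_cmult: "(\<lambda>x. c * v x) \<in> ?B" if "v \<in> W1p_ball m p r" "\<bar>c\<bar> * r \<le> R" "0 \<le> r" for v c r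
    using W1p_ball_cmult[OF m p that(3,1), of c] W1p_ball_mono[OF that(2)] by blast
  have P_cmult: "P (\<lambda>x. c * v x) = c * P v" if "v \<in> W1p_ball m p r" for v c r
    using W_dual_cmult[OF W_dual_pd_imp_W_dual[OF P_pd]] that by (simp add: W1p_ball_def)
  \<comment> \<open>\<open>P u0\<close> is the minimum of \<open>P\<close> over a symmetric
    ball.\<close>
  have P_abs: "\<bar>P v\<bar> \<le> - P u0" if v: "v \<in> ?B" for v
    using P_u0[OF v] P_u0[OF B_cmult[OF v _ R, of "- 1"]] P_u0[OF B_cmult[OF u0 _ R, of "- 1"]]
      P_u0[OF B_cmult[OF v _ R, of 1]] P_cmult[OF v, of "- 1"] R P_u0[OF zero_in_W1p_ball[OF p R]]
    by simp
  have norm_le: "R * W_dual_norm m p P \<le> - P u0"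
  proof (cases "R = 0")
    case True
    then show ?thesis using P_abs[OF u0] by simp
  next
    case False
    then have R: "0 < R" using R by simp
    have "W_dual_norm m p P \<le> - P u0 / R"
    proof (rule W_dual_norm_le[OF p])
      fix v assume v: "v \<in> W1p_ball m p 1"
      have "R * \<bar>P v\<bar> \<le> - P u0"
        using P_abs[OF B_cmult[OF v, of R]] P_cmult[OF v, of R] R by (simp add: abs_mult)
      then show "\<bar>P v\<bar> \<le> - P u0 / R" using R by (simp add: field_simps)
    qed
    then show ?thesis using R by (simp add: field_simps)
  qed
  have "\<bar>\<Omega> P\<bar> \<le> R * W_dual_norm m p P"
    unfolding R_def by (rule pd_bidual_bound[OF p \<Omega> P_pd])
  then have "\<bar>\<Omega> P\<bar> \<le> - P u0" using norm_le by simp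
  \<comment> \<open>Pairing u0 - f with its own image under the duality map; the bound on
    \<bar>\<Omega> P\<bar> makes this at most 0.\<close>
  moreover have "Lp_energy m p w = P u0 - \<Omega> P"
  proof -
    have "Lp_energy m p w = (\<integral>x. u0 x * g x - f x * g x \<partial>m)"
      using integral_mult_sgn_powr[OF p, where u = w and M = m] by (simp add: g_def w left_diff_distrib)
    also have "\<dots> = (\<integral>x. u0 x * g x \<partial>m) - (\<integral>x. f x * g x \<partial>m)"
      by (rule Bochner_Integration.integral_diff[OF int[OF W1p_ball_in_Lp[OF u0]] int[OF spec(1)]])
    finally show ?thesis using spec(2)[OF g] by (simp add: P_def pairing_functional_def)
  qed
  ultimately have "Lp_energy m p w = 0"
    using Lp_energy_nonneg[of m p w] by linarith
  \<comment> \<open>f agrees with \<open>u0\<close> a.e.; closedness for the constant sequence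
    \<open>u0\<close> transfers membership.\<close>
  then have "f \<in> ?B"
    using Lp_closedD[OF closed, of "\<lambda>n. u0" f] u0 spec(1) by (simp add: w)
  then show ?thesis by (simp add: f_def R_def)
qed

text \<open>On the L_g this is the defining property of the adjoint; both sides are Lipschitz in the
  dual norm, with constants adding up to \<open>c\<close>.\<close>

lemma pd_bidual_eq_evaluation:
  assumes m: "sets m = sets borel" and p: "1 < p" and \<Omega>: "pd_bidual m p \<Omega>" and T: "W_dual_pd m p T"
  shows "\<Omega> T = T (adjoint_L m p \<Omega>)"
proof -
  define f where "f = adjoint_L m p \<Omega>"
  define c where "c = pd_bidual_norm m p \<Omega> + W1p_norm m p f"
  have f: "in_W1p m p f"
    using adjoint_L_in_W1p_ball[OF m p \<Omega>] by (simp add: f_def W1p_ball_def)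
  have c: "0 \<le> c" unfolding c_def using pd_bidual_norm_nonneg[OF p \<Omega>] by simp
  have close: "\<bar>\<Omega> T - T f\<bar> \<le> c * e" if e: "0 < e" for e
  proof -
    obtain g where g: "in_Lp m (conj_exp p) g"
      and near: "\<And>u. u \<in> W1p_ball m p 1 \<Longrightarrow> \<bar>T u - pairing_functional m g u\<bar> \<le> e"
      using pairing_functional_dense[OF m p T e] by blast
    let ?L = "pairing_functional m g"
    let ?D = "\<lambda>u. 1 * T u + (- 1) * ?L u"
    have L: "W_dual_pd m p ?L" by (rule W_dual_pd_pairing_functional[OF p g])
    have D: "W_dual_pd m p ?D" by (rule W_dual_pd_lincomb[OF T L])
    have D_le: "W_dual_norm m p ?D \<le> e" using near by (intro W_dual_norm_le[OF p]) simp
    have "\<bar>\<Omega> ?D\<bar> \<le> pd_bidual_norm m p \<Omega> * e"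
      using pd_bidual_bound[OF p \<Omega> D] mult_left_mono[OF D_le pd_bidual_norm_nonneg[OF p \<Omega>]] by linarith
    moreover have "\<bar>?D f\<bar> \<le> e * W1p_norm m p f"
      using W_dual_bound[OF m p W_dual_pd_imp_W_dual[OF D] f] mult_right_mono[OF D_le W1p_norm_nonneg[of m p f]]
      by linarith
    moreover have "\<Omega> ?D = \<Omega> T - \<Omega> ?L"
      using pd_bidual_lincomb[OF \<Omega> T L, of 1 "- 1"] by simp
    moreover have "\<Omega> ?L = ?L f"
      using adjoint_L_spec(2)[OF p \<Omega> g] by (simp add: f_def pairing_functional_def)
    ultimately show ?thesis
      unfolding c_def by (simp add: algebra_simps abs_le_iff)
  qed
  have "\<bar>\<Omega> T - T f\<bar> \<le> 0"
  proof (rule field_le_epsilon)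
    fix e :: real assume e: "0 < e"
    \<comment> \<open>Dividing by \<open>c + 1\<close> also covers \<open>c = 0\<close>.\<close>
    have "\<bar>\<Omega> T - T f\<bar> \<le> c * (e / (c + 1))" using e c by (intro close) simp
    also have "\<dots> \<le> 0 + e" using e c by (simp add: field_simps)
    finally show "\<bar>\<Omega> T - T f\<bar> \<le> 0 + e" .
  qed
  then show ?thesis by (simp add: f_def)
qed

lemma W1p_norm_adjoint_L:
  assumes m: "sets m = sets borel" and p: "1 < p" and \<Omega>: "pd_bidual m p \<Omega>"
  shows "W1p_norm m p (adjoint_L m p \<Omega>) = pd_bidual_norm m p \<Omega>"
proof (rule antisym)
  let ?f = "adjoint_L m p \<Omega>"
  have f: "in_W1p m p ?f" and le: "W1p_norm m p ?f \<le> pd_bidual_norm m p \<Omega>"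
    using adjoint_L_in_W1p_ball[OF m p \<Omega>] by (auto simp: W1p_ball_def)
  show "W1p_norm m p ?f \<le> pd_bidual_norm m p \<Omega>" by (rule le)
  show "pd_bidual_norm m p \<Omega> \<le> W1p_norm m p ?f"
    unfolding pd_bidual_norm_def
  proof (rule cSUP_least)
    show "{T. W_dual_pd m p T \<and> W_dual_norm m p T \<le> 1} \<noteq> {}"
      using W_dual_pd_zero[OF p, of m] W_dual_norm_zero[OF p, of m] by (auto intro!: exI[of _ "\<lambda>f. 0"])
    fix T assume "T \<in> {T. W_dual_pd m p T \<and> W_dual_norm m p T \<le> 1}"
    then have T: "W_dual_pd m p T" "W_dual_norm m p T \<le> 1" by auto
    have "\<bar>\<Omega> T\<bar> \<le> W_dual_norm m p T * W1p_norm m p ?f"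
      unfolding pd_bidual_eq_evaluation[OF m p \<Omega> T(1)]
      by (rule W_dual_bound[OF m p W_dual_pd_imp_W_dual[OF T(1)] f])
    also have "\<dots> \<le> 1 * W1p_norm m p ?f"
      by (intro mult_right_mono T) simp
    finally show "\<bar>\<Omega> T\<bar> \<le> W1p_norm m p ?f" by simp
  qed
qed

text \<open>The preimage of f is evaluation at f. Its image under the adjoint has the same pairings
  with L^q as f; testing with the duality map of their difference shows that they agree a.e.\<close>

lemma pd_bidual_evaluation:
  assumes m: "sets m = sets borel" and p: "1 < p" and f: "in_W1p m p f"
  shows "pd_bidual m p (\<lambda>T. T f)" and "AE x in m. adjoint_L m p (\<lambda>T. T f) x = f x"
proof -
  let ?\<Omega> = "\<lambda>T::('a \<Rightarrow> real) \<Rightarrow> real. T f"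
  have "\<bar>T f\<bar> \<le> W1p_norm m p f * W_dual_norm m p T" if "W_dual_pd m p T" for T
    using W_dual_bound[OF m p W_dual_pd_imp_W_dual[OF that] f] by (simp add: mult.commute)
  then show \<Omega>: "pd_bidual m p ?\<Omega>" unfolding pd_bidual_def by auto
  let ?h = "adjoint_L m p ?\<Omega>"
  note spec = adjoint_L_spec[OF p \<Omega>]
  have fL: "in_Lp m p f" by (rule in_W1p_in_Lp[OF f])
  have d: "in_Lp m p (\<lambda>x. ?h x - f x)" by (rule in_Lp_diff[OF p spec(1) fL])
  define g where "g = (\<lambda>x. sgn_powr p (?h x - f x))"
  have g: "in_Lp m (conj_exp p) g" unfolding g_def by (rule in_Lp_sgn_powr[OF p d])
  have "Lp_energy m p (\<lambda>x. ?h x - f x) = (\<integral>x. ?h x * g x - f x * g x \<partial>m)"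
    using integral_mult_sgn_powr[OF p, where u = "\<lambda>x. ?h x - f x" and M = m] by (simp add: g_def left_diff_distrib)
  also have "\<dots> = (\<integral>x. ?h x * g x \<partial>m) - (\<integral>x. f x * g x \<partial>m)"
    by (intro Bochner_Integration.integral_diff Holder_inequality(1)[OF p] spec(1) fL g)
  also have "\<dots> = 0"
    using spec(2)[OF g] by (simp add: pairing_functional_def)
  finally show "AE x in m. ?h x = f x"
    using Lp_energy_eq_0_iff[OF d] by simp
qed

text \<open>The second conjunct, surjectivity, is an a.e. equality because \<open>adjoint_L\<close>
  selects one function from its class.\<close>

theorem theorem6p13:
  fixes m :: "'a::polish_space measure" and p :: real
  assumes "sets m = sets borel"
    and "\<forall>A \<in> sets borel. bounded A \<longrightarrow> emeasure m A < \<infinity>"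
    and "1 < p"
  shows "(\<forall>\<Omega>. pd_bidual m p \<Omega> \<longrightarrow>
            in_W1p m p (adjoint_L m p \<Omega>) \<and>
            W1p_norm m p (adjoint_L m p \<Omega>) = pd_bidual_norm m p \<Omega>)
       \<and> (\<forall>f. in_W1p m p f \<longrightarrow>
            (\<exists>\<Omega>. pd_bidual m p \<Omega> \<and> (AE x in m. adjoint_L m p \<Omega> x = f x)))"
proof (intro conjI allI impI)
  fix \<Omega> assume \<Omega>: "pd_bidual m p \<Omega>"
  show "in_W1p m p (adjoint_L m p \<Omega>)"
    using adjoint_L_in_W1p_ball[OF assms(1,3) \<Omega>] by (simp add: W1p_ball_def)
  show "W1p_norm m p (adjoint_L m p \<Omega>) = pd_bidual_norm m p \<Omega>"
    by (rule W1p_norm_adjoint_L[OF assms(1,3) \<Omega>])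
next
  fix f assume "in_W1p m p f"
  then show "\<exists>\<Omega>. pd_bidual m p \<Omega> \<and> (AE x in m. adjoint_L m p \<Omega> x = f x)"
    using pd_bidual_evaluation[OF assms(1,3)] by blast
qed

end
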